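(* Let $n\ge 7$ and let $(u_\lambda)$ be a family of least energy radial sign-changing solutions of $$-\Delta u=\lambda u+|u|^{2^*-2}u \ \text{ in } B_1,\qquad u=0\ \text{ on }\partial B_1,$$ with $u_\lambda(0)>0$. As $\lambda\to0$ we have $$\lambda^{-\frac{n-2}{2n-8}}u_\lambda\to\tilde c(n)\,G(x,0)\quad\text{in } C^1_{loc}(B_1\setminus\{0\}),$$ where $G(x,y)$ is the Green function for the Laplacian in the unit ball, $\tilde c(n):=\omega_n\,\dfrac{c_2(n)^{\frac{n-2}{2n-8}}}{c_1(n)^{\frac{4}{2n-8}}}$, $\omega_n$ is the measure of the $(n-1)$-dimensional unit sphere $S^{n-1}$, $c_1(n):=\int_0^\infty\delta_{0,\mu}^{2^*-1}(s)s^{n-1}ds$, $c_2(n):=2\int_0^\infty\delta_{0,\mu}^2(s)s^{n-1}ds$, and $\mu=\sqrt{n(n-2)}$.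
   Context: $B_1$ is the open unit ball of $\mathbb{R}^n$, $2^*=\frac{2n}{n-2}$, and $\lambda_1$ is the first Dirichlet eigenvalue of $-\Delta$ in $B_1$. A least energy radial sign-changing solution is a radial sign-changing solution minimizing $I_\lambda(u)=\frac12\int_{B_1}(|\nabla u|^2-\lambda u^2)\,dx-\frac1{2^*}\int_{B_1}|u|^{2^*}dx$ among all radial sign-changing solutions of the problem with parameter $\lambda$. The family consists of one such solution $u_\lambda$ for each $\lambda\in(0,\lambda_1)$; $\lambda\to 0$ means $\lambda\to0^+$. Solutions are classical. Each $u_\lambda$ has exactly two nodal regions: it is positive in a ball $\{|x|<r_\lambda\}$ and negative in the annulus $\{r_\lambda<|x|<1\}$ for some $r_\lambda\in(0,1)$. $\delta_{0,\mu}(x):=\dfrac{[n(n-2)\mu^2]^{(n-2)/4}}{[\mu^2+|x|^2]^{(n-2)/2}}$, and $\delta_{0,\mu}(s)$ denotes its radial profile, $s=|x|$. The Green function has the sign convention $\Delta_xG(\cdot,y)=\delta_y$ (Dirac mass) in $B_1$, $G(\cdot,y)=0$ on $\partial B_1$; thus $G\le0$ and $G(x,0)=\frac{1}{(2-n)\omega_n}\left(|x|^{2-n}-1\right)$. Convergence in $C^1_{loc}(B_1\setminus\{0\})$ means convergence in $C^1(K)$ for every compact $K\subset B_1\setminus\{0\}$. *)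

theory Defs
  imports "HOL-Analysis.Analysis"
begin

section \<open>Differential operators on Euclidean space\<close>

definition partial :: "'a::euclidean_space \<Rightarrow> ('a \<Rightarrow> real) \<Rightarrow> 'a \<Rightarrow> real" where
  "partial b u x = frechet_derivative u (at x) b"

definition gradient :: "('a::euclidean_space \<Rightarrow> real) \<Rightarrow> 'a \<Rightarrow> 'a" where
  "gradient u x = (\<Sum>b\<in>Basis. partial b u x *\<^sub>R b)"

definition laplacian :: "('a::euclidean_space \<Rightarrow> real) \<Rightarrow> 'a \<Rightarrow> real" where
  "laplacian u x = (\<Sum>b\<in>Basis. partial b (partial b u) x)"

text \<open>Membership in \<open>C\<^sup>k(\<Omega>)\<close>; meant for open \<open>\<Omega>\<close>. The differentiability clause ensures that
  \<^const>\<open>partial\<close> takes its intended values on \<open>\<Omega>\<close>.\<close>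

primrec Ck_on :: "nat \<Rightarrow> 'a::euclidean_space set \<Rightarrow> ('a \<Rightarrow> real) \<Rightarrow> bool" where
  "Ck_on 0 \<Omega> u \<longleftrightarrow> continuous_on \<Omega> u"
| "Ck_on (Suc k) \<Omega> u \<longleftrightarrow>
     (\<forall>x\<in>\<Omega>. u differentiable (at x)) \<and> (\<forall>b\<in>Basis. Ck_on k \<Omega> (partial b u))"

text \<open>Convergence in \<open>C\<^sup>1(K)\<close> for every compact \<open>K \<subseteq> \<Omega>\<close>.\<close>

definition C1_loc_limit ::
  "'a::euclidean_space set \<Rightarrow> ('i \<Rightarrow> 'a \<Rightarrow> real) \<Rightarrow> ('a \<Rightarrow> real) \<Rightarrow> 'i filter \<Rightarrow> bool" where
  "C1_loc_limit \<Omega> f g F \<longleftrightarrow>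
     Ck_on 1 \<Omega> g \<and> (\<forall>\<^sub>F i in F. Ck_on 1 \<Omega> (f i)) \<and>
     (\<forall>K. compact K \<and> K \<subseteq> \<Omega> \<longrightarrow>
        uniform_limit K f g F \<and> uniform_limit K (\<lambda>i. gradient (f i)) (gradient g) F)"


section \<open>Dirichlet problems on a bounded open set\<close>

definition classical_dirichlet :: "'a::euclidean_space set \<Rightarrow> ('a \<Rightarrow> real) \<Rightarrow> bool" where
  "classical_dirichlet \<Omega> u \<longleftrightarrow>
     Ck_on 2 \<Omega> u \<and> continuous_on (closure \<Omega>) u \<and> (\<forall>x\<in>frontier \<Omega>. u x = 0)"

definition dirichlet_eigenvalue :: "'a::euclidean_space set \<Rightarrow> real \<Rightarrow> bool" where
  "dirichlet_eigenvalue \<Omega> lam \<longleftrightarrow>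
     (\<exists>\<phi>. classical_dirichlet \<Omega> \<phi> \<and> (\<exists>x\<in>\<Omega>. \<phi> x \<noteq> 0) \<and>
          (\<forall>x\<in>\<Omega>. - laplacian \<phi> x = lam * \<phi> x))"

definition first_dirichlet_eigenvalue :: "'a::euclidean_space set \<Rightarrow> real" where
  "first_dirichlet_eigenvalue \<Omega> = Inf {lam. dirichlet_eigenvalue \<Omega> lam}"

definition test_function :: "'a::euclidean_space set \<Rightarrow> ('a \<Rightarrow> real) \<Rightarrow> bool" where
  "test_function \<Omega> \<phi> \<longleftrightarrow>
     (\<forall>k. Ck_on k UNIV \<phi>) \<and> (\<exists>K. compact K \<and> K \<subseteq> \<Omega> \<and> (\<forall>x. x \<notin> K \<longrightarrow> \<phi> x = 0))"

text \<open>Sign convention: \<open>\<Delta>\<^sub>x G(\<cdot>,y) = \<delta>\<^sub>y\<close> in the sense of distributions, hence \<open>G \<le> 0\<close>.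
  The value \<open>G y y\<close> is left unspecified.\<close>

definition green_function :: "'a::euclidean_space set \<Rightarrow> ('a \<Rightarrow> 'a \<Rightarrow> real) \<Rightarrow> bool" where
  "green_function \<Omega> G \<longleftrightarrow>
     (\<forall>y\<in>\<Omega>.
        continuous_on (closure \<Omega> - {y}) (\<lambda>x. G x y) \<and>
        (\<forall>x\<in>frontier \<Omega>. G x y = 0) \<and>
        set_integrable lborel \<Omega> (\<lambda>x. G x y) \<and>
        (\<forall>\<phi>. test_function \<Omega> \<phi> \<longrightarrow> (LINT x:\<Omega>|lborel. G x y * laplacian \<phi> x) = \<phi> y))"


section \<open>The Brezis--Nirenberg problem\<close>

definition critical_exponent :: "nat \<Rightarrow> real" where
  "critical_exponent n = 2 * real n / (real n - 2)"

definition BN_solution :: "'a::euclidean_space set \<Rightarrow> real \<Rightarrow> ('a \<Rightarrow> real) \<Rightarrow> bool" where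
  "BN_solution \<Omega> lam u \<longleftrightarrow>
     classical_dirichlet \<Omega> u \<and>
     (\<forall>x\<in>\<Omega>. - laplacian u x =
        lam * u x + \<bar>u x\<bar> powr (critical_exponent DIM('a) - 2) * u x)"

definition BN_energy :: "'a::euclidean_space set \<Rightarrow> real \<Rightarrow> ('a \<Rightarrow> real) \<Rightarrow> real" where
  "BN_energy \<Omega> lam u =
     1 / 2 * (LINT x:\<Omega>|lborel. (norm (gradient u x))\<^sup>2 - lam * (u x)\<^sup>2)
     - 1 / critical_exponent DIM('a) *
         (LINT x:\<Omega>|lborel. \<bar>u x\<bar> powr critical_exponent DIM('a))"

definition radial_on :: "'a::euclidean_space set \<Rightarrow> ('a \<Rightarrow> real) \<Rightarrow> bool" where
  "radial_on \<Omega> u \<longleftrightarrow> (\<forall>x\<in>\<Omega>. \<forall>y\<in>\<Omega>. norm x = norm y \<longrightarrow> u x = u y)"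

definition sign_changing_on :: "'a set \<Rightarrow> ('a \<Rightarrow> real) \<Rightarrow> bool" where
  "sign_changing_on \<Omega> u \<longleftrightarrow> (\<exists>x\<in>\<Omega>. u x > 0) \<and> (\<exists>x\<in>\<Omega>. u x < 0)"

definition radial_sign_changing_solution :: "real \<Rightarrow> ('a::euclidean_space \<Rightarrow> real) \<Rightarrow> bool" where
  "radial_sign_changing_solution lam u \<longleftrightarrow>
     BN_solution (ball 0 1) lam u \<and> radial_on (ball 0 1) u \<and>
     sign_changing_on (ball 0 1) u"

definition least_energy_radial_sign_changing_solution ::
  "real \<Rightarrow> ('a::euclidean_space \<Rightarrow> real) \<Rightarrow> bool" where
  "least_energy_radial_sign_changing_solution lam u \<longleftrightarrow>
     radial_sign_changing_solution lam u \<and>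
     (\<forall>v :: 'a \<Rightarrow> real. radial_sign_changing_solution lam v \<longrightarrow>
          BN_energy (ball 0 1) lam u \<le> BN_energy (ball 0 1) lam v)"


section \<open>The limit constant\<close>

text \<open>The measure of \<open>S\<^sup>n\<^sup>-\<^sup>1\<close>, as the derivative at \<open>r = 1\<close> of the volume
  \<open>r\<^sup>n * unit_ball_vol n\<close> of the ball of radius \<open>r\<close>.\<close>

definition sphere_area :: "nat \<Rightarrow> real" where
  "sphere_area n = real n * unit_ball_vol (real n)"

text \<open>Radial profile, \<open>s = norm x\<close>, of the bubble centred at the origin.\<close>

definition bubble :: "nat \<Rightarrow> real \<Rightarrow> real \<Rightarrow> real" where
  "bubble n \<mu> s =
     (real n * (real n - 2) * \<mu>\<^sup>2) powr ((real n - 2) / 4)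
     / (\<mu>\<^sup>2 + s\<^sup>2) powr ((real n - 2) / 2)"

definition c1 :: "nat \<Rightarrow> real" where
  "c1 n = (let \<mu> = sqrt (real n * (real n - 2)) in
     LBINT s:{0..}. bubble n \<mu> s powr (critical_exponent n - 1) * s ^ (n - 1))"

definition c2 :: "nat \<Rightarrow> real" where
  "c2 n = (let \<mu> = sqrt (real n * (real n - 2)) in
     2 * (LBINT s:{0..}. (bubble n \<mu> s)\<^sup>2 * s ^ (n - 1)))"

definition c_tilde :: "nat \<Rightarrow> real" where
  "c_tilde n =
     sphere_area n * (c2 n powr ((real n - 2) / (2 * real n - 8))
                      / c1 n powr (4 / (2 * real n - 8)))"

end

theory Submission
  imports Defs "HOL-Computational_Algebra.Polynomial"
begin

text \<open>
  In the radius \<open>r = |x|\<close> the equation becomes \<open>v' = r\<^sup>1\<^sup>-\<^sup>n f\<close>, \<open>f' = - r\<^sup>n\<^sup>-\<^sup>1 (\<lambda> v + |v|\<^sup>4\<^sup>/\<^sup>(\<^sup>n\<^sup>-\<^sup>2\<^sup>) v)\<close>, and the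
  Pohozaev energy \<open>H\<close> satisfies \<open>H' = \<lambda> r\<^sup>n\<^sup>-\<^sup>1 v\<^sup>2 \<ge> 0\<close>. Hence \<open>H \<ge> 0\<close>, and \<open>H\<close> is small with \<open>\<lambda>\<close>, which
  bounds the Emden--Fowler variable \<open>r\<^sup>(\<^sup>n\<^sup>-\<^sup>2\<^sup>)\<^sup>/\<^sup>2 v\<close> uniformly. Let \<open>-M\<close> be the minimum of the negative part and
  \<open>\<epsilon> = M\<^sup>-\<^sup>2\<^sup>/\<^sup>(\<^sup>n\<^sup>-\<^sup>2\<^sup>)\<close>. The function \<open>-v (\<epsilon> t) / M\<close> solves an equation with parameter \<open>\<lambda> \<epsilon>\<^sup>2\<close>, and the
  radius of the minimum tends to \<open>0\<close> in the variable \<open>t\<close>; so it converges to the standard bubble. Nonnegativity of the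
  energy is a quadratic inequality for the logarithmic slope, which traps the slope near \<open>n - 2\<close> once the
  bubble has passed its peak; the resulting decay dominates the integrals below. With \<open>\<phi> = f 1\<close>, integrating
  \<open>f'\<close> and \<open>H'\<close> beyond the minimum gives \<open>M \<phi> \<rightarrow> c\<^sub>1\<close> and \<open>\<phi>\<^sup>2 / (\<lambda> \<epsilon>\<^sup>2) \<rightarrow> c\<^sub>2\<close>. Eliminating \<open>\<epsilon>\<close>
  yields the rate \<open>\<lambda>\<^sup>(\<^sup>n\<^sup>-\<^sup>2\<^sup>)\<^sup>/\<^sup>(\<^sup>2\<^sup>n\<^sup>-\<^sup>8\<^sup>)\<close>, and away from the origin \<open>v\<close> is close to the harmonic
  function with flux \<open>\<phi>\<close>.

  The Green function enters only through its distributional definition, so its values are recovered by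
  testing. The infimum defining the first eigenvalue has to be shown positive: an eigenfunction with a
  small eigenvalue is excluded by comparison with a paraboloid, and existence of an eigenvalue
  follows from a Bessel series.
\<close>

section \<open>Iterated partial derivatives\<close>

text \<open>The annular part starts not at the origin but at an unknown radius \<open>rm\<close>,
  behind a positive core of unknown shape. Only the number \<open>H rm\<close> carries information
  across the node. As \<open>f rm = 0\<close>, \<open>H rm\<close> dominates its power term, a fixed
  multiple of \<open>(rm / eps) ^ n\<close>; hence small energy forces \<open>rm / eps\<close> to 0,
  and the rescaled profile starts with nearly the data 1 and 0 of a bubble at the origin. A bound of
  order lam suffices for that, but the identity behind \<open>c2\<close> divides the energy by lam
  eps^2, which calls for the sharper \<open>H rm\<close> = O(lam rm^2). Gronwall keeps the profile
  near the bubble on bounded intervals only, while the interval grows like 1 / eps, so the tail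
  needs a bound uniform in lam. The slope argument gives decay of order n - 5/2 instead of n - 2;
  the lost 1/2 is harmless, because both integrands still have a majorant of order t^(-2). As M =
  eps^(-(n-2)/2), the two limits say that phi behaves like c1 eps^((n-2)/2) and phi^2 like c2 lam
  eps^2, whence eps^(n-4) behaves like lam c2 / c1^2.\<close>

lemma partial_eqI: "(u has_derivative D) (at x) \<Longrightarrow> partial b u x = D b"
  unfolding partial_def using frechet_derivative_at by metis

lemma differentiable_cong_open:
  assumes "open S" "x \<in> S" "\<And>y. y \<in> S \<Longrightarrow> u y = v y" "u differentiable (at x)"
  shows "v differentiable (at x)"
proof -
  obtain D where "(u has_derivative D) (at x)" using assms(4) unfolding differentiable_def by blast
  then have "(v has_derivative D) (at x)"
    by (rule has_derivative_transform_within_open[OF _ assms(1,2)]) (use assms(3) in auto)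
  then show ?thesis unfolding differentiable_def by blast
qed

lemma partial_cong:
  assumes "open S" "x \<in> S" "\<And>y. y \<in> S \<Longrightarrow> u y = v y"
  shows "partial b u x = partial b v x"
proof -
  have "(u has_derivative D) (at x) \<longleftrightarrow> (v has_derivative D) (at x)" for D
    using has_derivative_transform_within_open[OF _ assms(1,2)] assms(3) by metis
  then show ?thesis unfolding partial_def frechet_derivative_def by simp
qed

lemma Ck_on_cong:
  assumes "open S" "\<And>x. x \<in> S \<Longrightarrow> u x = v x" "Ck_on k S u"
  shows "Ck_on k S v"
  using assms(2,3)
proof (induction k arbitrary: u v)
  case 0
  then show ?case using continuous_on_cong by (metis Ck_on.simps(1))
next
  case (Suc k)
  have "Ck_on k S (partial b v)" if "b \<in> Basis" for b
  proof (rule Suc.IH)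
    show "partial b u x = partial b v x" if "x \<in> S" for x
      by (rule partial_cong[OF assms(1) that]) (use Suc.prems in auto)
    show "Ck_on k S (partial b u)" using Suc.prems that by auto
  qed
  moreover have "v differentiable (at x)" if "x \<in> S" for x
    by (rule differentiable_cong_open[OF assms(1) that, of u]) (use Suc.prems that in auto)
  ultimately show ?case by simp
qed

lemma Ck_on_subset: "Ck_on k S u \<Longrightarrow> T \<subseteq> S \<Longrightarrow> Ck_on k T u"
  by (induction k arbitrary: u) (auto intro: continuous_on_subset)

lemma Ck_on_Un: "open S \<Longrightarrow> open T \<Longrightarrow> Ck_on k S u \<Longrightarrow> Ck_on k T u \<Longrightarrow> Ck_on k (S \<union> T) u"
  by (induction k arbitrary: u) (auto intro: continuous_on_open_Un)

lemma Ck_on_Suc_imp: "Ck_on (Suc k) S u \<Longrightarrow> Ck_on k S u"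
proof (induction k arbitrary: u)
  case 0
  then show ?case
    by (auto intro!: continuous_at_imp_continuous_on differentiable_imp_continuous_within)
next
  case (Suc k)
  have "Ck_on (Suc k) S (partial b u)" if "b \<in> Basis" for b
    using Suc.prems that by simp
  then show ?case using Suc by simp
qed

lemma Ck_on_le: "Ck_on k S u \<Longrightarrow> j \<le> k \<Longrightarrow> Ck_on j S u"
  by (induction k) (auto simp: le_Suc_eq simp del: Ck_on.simps intro: Ck_on_Suc_imp)

lemma Ck_on_const [simp]: "Ck_on k S (\<lambda>x. c)"
proof (induction k arbitrary: c)
  case (Suc k)
  have "partial b (\<lambda>x. c) = (\<lambda>x. 0)" for b :: 'a
    by (rule ext, rule partial_eqI[of _ "\<lambda>_. 0"]) simp
  then show ?case using Suc by simp
qed simp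

lemma has_derivative_frechet: "u differentiable (at x) \<Longrightarrow> (u has_derivative (\<lambda>b. partial b u x)) (at x)"
  unfolding partial_def by (simp add: frechet_derivative_works)

lemma Ck_on_add:
  assumes "open S" "Ck_on k S u" "Ck_on k S v"
  shows "Ck_on k S (\<lambda>x. u x + v x)"
  using assms(2,3)
proof (induction k arbitrary: u v)
  case 0
  then show ?case by (auto intro: continuous_intros)
next
  case (Suc k)
  have "Ck_on k S (partial b (\<lambda>x. u x + v x))" if "b \<in> Basis" for b
  proof (rule Ck_on_cong[OF assms(1)])
    show "Ck_on k S (\<lambda>x. partial b u x + partial b v x)" using Suc that by simp
    show "partial b u x + partial b v x = partial b (\<lambda>x. u x + v x) x" if "x \<in> S" for x
      using Suc.prems that
      by (intro partial_eqI[symmetric, where D="\<lambda>b. partial b u x + partial b v x"]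
            has_derivative_add has_derivative_frechet) auto
  qed
  then show ?case using Suc.prems by simp
qed

lemma Ck_on_mult:
  assumes "open S" "Ck_on k S u" "Ck_on k S v"
  shows "Ck_on k S (\<lambda>x. u x * v x)"
  using assms(2,3)
proof (induction k arbitrary: u v)
  case 0
  then show ?case by (auto intro: continuous_intros)
next
  case (Suc k)
  have uv: "Ck_on k S u" "Ck_on k S v" using Suc.prems Ck_on_Suc_imp by blast+
  have "Ck_on k S (partial b (\<lambda>x. u x * v x))" if b: "b \<in> Basis" for b
  proof (rule Ck_on_cong[OF assms(1)])
    show "Ck_on k S (\<lambda>x. u x * partial b v x + partial b u x * v x)"
      using Suc.prems uv b by (intro Ck_on_add[OF assms(1)] Suc.IH) auto
    show "u x * partial b v x + partial b u x * v x = partial b (\<lambda>x. u x * v x) x" if "x \<in> S" for x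
      using Suc.prems that
      by (intro partial_eqI[symmetric, where D="\<lambda>b. u x * partial b v x + partial b u x * v x"]
            has_derivative_mult has_derivative_frechet) auto
  qed
  then show ?case using Suc.prems by simp
qed

lemma Ck_on_uminus: "open S \<Longrightarrow> Ck_on k S u \<Longrightarrow> Ck_on k S (\<lambda>x. - u x)"
  using Ck_on_mult[of S k "\<lambda>x. - 1" u] by simp

lemma Ck_on_diff: "open S \<Longrightarrow> Ck_on k S u \<Longrightarrow> Ck_on k S v \<Longrightarrow> Ck_on k S (\<lambda>x. u x - v x)"
  using Ck_on_add[of S k u "\<lambda>x. - v x"] Ck_on_uminus[of S k v] by simp

lemma Ck_on_inner_right [simp]: "Ck_on k S (\<lambda>x. x \<bullet> c)"
proof (cases k)
  case (Suc j)
  have "partial b (\<lambda>x. x \<bullet> c) = (\<lambda>x. b \<bullet> c)" for b :: 'a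
    by (rule ext, rule partial_eqI[of _ "\<lambda>h. h \<bullet> c"]) (auto intro!: derivative_eq_intros)
  then show ?thesis using Suc by (auto intro!: derivative_intros)
qed (auto intro!: continuous_intros)

lemma Ck_on_inner_self [simp]: "Ck_on k S (\<lambda>x. x \<bullet> x)"
proof (cases k)
  case (Suc j)
  have "partial b (\<lambda>x. x \<bullet> x) = (\<lambda>x. x \<bullet> (2 *\<^sub>R b))" for b :: 'a
  proof
    show "partial b (\<lambda>x. x \<bullet> x) x = x \<bullet> (2 *\<^sub>R b)" for x
      by (rule partial_eqI[where D="\<lambda>h. x \<bullet> h + h \<bullet> x", THEN trans])
         (auto intro!: derivative_eq_intros simp: inner_commute)
  qed
  then show ?thesis using Suc Ck_on_inner_right[of j S] by (auto intro!: derivative_intros simp del: inner_scaleR_right)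
qed (auto intro!: continuous_intros)

lemma partial_comp:
  assumes "(h has_real_derivative h') (at (u x))" "u differentiable (at x)"
  shows "partial b (\<lambda>x. h (u x)) x = h' * partial b u x"
    and "(\<lambda>x. h (u x)) differentiable (at x)"
proof -
  have "((\<lambda>x. h (u x)) has_derivative (\<lambda>b. h' * partial b u x)) (at x)"
    using has_derivative_compose[OF has_derivative_frechet[OF assms(2)], of h "(*) h'"] assms(1)
    unfolding has_field_derivative_def by simp
  then show "partial b (\<lambda>x. h (u x)) x = h' * partial b u x" "(\<lambda>x. h (u x)) differentiable (at x)"
    by (auto intro: partial_eqI simp: differentiable_def)
qed

lemma has_real_derivative_partial:
  fixes h :: "real \<Rightarrow> real"
  assumes "h differentiable (at t)"
  shows "(h has_real_derivative partial 1 h t) (at t)"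
proof -
  obtain d where d: "(h has_real_derivative d) (at t)"
    using assms real_differentiableE by blast
  then have "partial 1 h t = d"
    using partial_eqI[of h "(*) d" t 1] by (simp add: has_field_derivative_def)
  with d show ?thesis by simp
qed

lemma Ck_on_compose:
  assumes "open S" "open T"
  shows "Ck_on k T h \<Longrightarrow> Ck_on k S u \<Longrightarrow> (\<And>x. x \<in> S \<Longrightarrow> u x \<in> T) \<Longrightarrow> Ck_on k S (\<lambda>x. h (u x :: real))"
proof (induction k arbitrary: h u)
  case 0
  then show ?case by (auto intro: continuous_on_compose2)
next
  case (Suc k)
  have d: "(h has_real_derivative partial 1 h (u x)) (at (u x))" "u differentiable (at x)" if "x \<in> S" for x
    using Suc.prems that has_real_derivative_partial[of h "u x"] by auto
  have "Ck_on k S (partial b (\<lambda>x. h (u x)))" if b: "b \<in> Basis" for b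
  proof (rule Ck_on_cong[OF assms(1)])
    show "Ck_on k S (\<lambda>x. partial 1 h (u x) * partial b u x)"
    proof (rule Ck_on_mult[OF assms(1)])
      show "Ck_on k S (\<lambda>x. partial 1 h (u x))"
        by (rule Suc.IH) (use Suc.prems Ck_on_Suc_imp[OF Suc.prems(2)] in auto)
      show "Ck_on k S (partial b u)" using Suc.prems b by simp
    qed
    show "partial 1 h (u x) * partial b u x = partial b (\<lambda>x. h (u x)) x" if "x \<in> S" for x
      using partial_comp(1)[OF d[OF that]] by simp
  qed
  then show ?case using partial_comp(2)[OF d] by simp
qed

lemma Ck_on_antiderivative:
  fixes A h :: "real \<Rightarrow> real"
  assumes "open T" "\<And>t. t \<in> T \<Longrightarrow> (A has_real_derivative h t) (at t)" "Ck_on k T h"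
  shows "Ck_on (Suc k) T A"
proof -
  have "Ck_on k T (partial 1 A)"
  proof (rule Ck_on_cong[OF assms(1) _ assms(3)])
    show "h x = partial 1 A x" if "x \<in> T" for x
      using partial_eqI[of A "(*) (h x)" x 1] assms(2)[OF that] unfolding has_field_derivative_def by simp
  qed
  then show ?thesis using assms(2) real_differentiable_def by auto
qed

text \<open>Exhibiting all derivatives at once avoids computing iterated \<open>partial\<close>.
  Powers, \<open>flat_fun\<close> and the Bessel series are handled this way.\<close>

lemma Ck_on_derivative_sequence:
  fixes D :: "nat \<Rightarrow> real \<Rightarrow> real"
  assumes "open T" "\<And>j t. t \<in> T \<Longrightarrow> (D j has_real_derivative D (Suc j) t) (at t)"
  shows "Ck_on k T (D j)"
proof (induction k arbitrary: j)
  case 0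
  show ?case using assms(2) by (auto intro!: continuous_at_imp_continuous_on DERIV_isCont)
next
  case (Suc k)
  show ?case by (rule Ck_on_antiderivative[OF assms Suc])
qed

lemma Ck_on_powr: "Ck_on k {0<..} (\<lambda>t. t powr q)"
proof -
  have "Ck_on k {0<..} (\<lambda>t. (\<Prod>i<0. q - real i) * t powr (q - real 0))"
    by (rule Ck_on_derivative_sequence[where D="\<lambda>j t. (\<Prod>i<j. q - real i) * t powr (q - real j)"])
       (auto intro!: derivative_eq_intros simp: algebra_simps)
  then show ?thesis by simp
qed

subsection \<open>A smooth step function\<close>

text \<open>With x = 1/t the operator d/dt is -x^2 d/dx, so p(x) exp(-x) has the derivative x^2 (p -
  p') exp(-x). The recursion yields the polynomial factors of the successive derivatives of
  exp(-1/t).\<close>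

definition flat_poly :: "nat \<Rightarrow> real poly" where
  "flat_poly j = rec_nat 1 (\<lambda>_ p. [:0,0,1:] * (p - pderiv p)) j"

definition flat_fun :: "nat \<Rightarrow> real \<Rightarrow> real" where
  "flat_fun j t = (if t > 0 then poly (flat_poly j) (1 / t) * exp (- (1 / t)) else 0)"

lemma poly_times_exp_tendsto_0: "((\<lambda>x. poly p x * exp (- x)) \<longlongrightarrow> 0) at_top" for p :: "real poly"
proof -
  have "((\<lambda>x. \<Sum>i\<le>degree p. coeff p i * (x ^ i / exp x)) \<longlongrightarrow> (\<Sum>i\<le>degree p. coeff p i * 0)) at_top"
    by (intro tendsto_intros tendsto_power_div_exp_0)
  then show ?thesis
    by (simp add: poly_altdef sum_distrib_right exp_minus divide_inverse mult.assoc)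
qed

lemma flat_fun_derivative: "(flat_fun j has_real_derivative flat_fun (Suc j) t) (at t)"
proof (cases t "0::real" rule: linorder_cases)
  case less
  have "((\<lambda>_. 0) has_real_derivative 0) (at t)" by simp
  then have "(flat_fun j has_real_derivative 0) (at t)"
    by (rule has_field_derivative_transform_within_open[where S="{..<0}"]) (use less in \<open>auto simp: flat_fun_def\<close>)
  then show ?thesis using less by (simp add: flat_fun_def)
next
  case greater
  have "((\<lambda>t. poly (flat_poly j) (1 / t) * exp (- (1 / t))) has_real_derivative
      poly (flat_poly (Suc j)) (1 / t) * exp (- (1 / t))) (at t)"
    using greater unfolding flat_poly_def
    by (auto intro!: derivative_eq_intros poly_DERIV[THEN DERIV_chain2] simp: field_simps power2_eq_square)
  then have "(flat_fun j has_real_derivative poly (flat_poly (Suc j)) (1 / t) * exp (- (1 / t))) (at t)"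
    by (rule has_field_derivative_transform_within_open[where S="{0<..}"]) (use greater in \<open>auto simp: flat_fun_def\<close>)
  then show ?thesis using greater by (simp add: flat_fun_def)
next
  case equal
  have "((\<lambda>y. poly ([:0,1:] * flat_poly j) (inverse y) * exp (- inverse y)) \<longlongrightarrow> 0) (at_right 0)"
    using poly_times_exp_tendsto_0 filterlim_inverse_at_top_right by (rule filterlim_compose)
  then have "((\<lambda>y. flat_fun j y / y) \<longlongrightarrow> 0) (at_right 0)"
    by (rule Lim_transform_eventually)
       (auto simp: eventually_at_filter flat_fun_def field_simps intro!: always_eventually)
  moreover have "((\<lambda>y. flat_fun j y / y) \<longlongrightarrow> 0) (at_left 0)"
    by (rule tendsto_eventually) (auto simp: eventually_at_filter flat_fun_def)
  ultimately have "((\<lambda>y. flat_fun j y / y) \<longlongrightarrow> 0) (at 0)"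
    using filterlim_split_at by blast
  then have "(flat_fun j has_real_derivative 0) (at 0)"
    by (simp add: has_field_derivative_iff flat_fun_def)
  then show ?thesis using equal by (simp add: flat_fun_def)
qed

text \<open>A primitive of the bump exp(-1/(t - 1/2)) exp(-1/(1 - t)), supported in [1/2, 1],
  divided by its total mass. The mass is positive because the mean value theorem evaluates it at an
  interior point.\<close>

lemma smooth_step_exists:
  obtains \<sigma> \<sigma>' :: "real \<Rightarrow> real"
  where "\<And>k. Ck_on k UNIV \<sigma>" "\<And>k. Ck_on k UNIV \<sigma>'" "\<And>t. (\<sigma> has_real_derivative \<sigma>' t) (at t)"
    "\<And>t. \<sigma>' t \<ge> 0" "\<And>t. t \<le> 1/2 \<Longrightarrow> \<sigma> t = 0" "\<And>t. t \<ge> 1 \<Longrightarrow> \<sigma> t = 1"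
    "\<And>t. t \<le> 1/2 \<Longrightarrow> \<sigma>' t = 0" "\<And>t. t \<ge> 1 \<Longrightarrow> \<sigma>' t = 0" "\<And>t. 0 \<le> \<sigma> t" "\<And>t. \<sigma> t \<le> 1"
proof -
  define k where "k t = flat_fun 0 (t - 1/2) * flat_fun 0 (1 - t)" for t
  have f0: "flat_fun 0 t = (if t > 0 then exp (- (1 / t)) else 0)" for t
    by (simp add: flat_fun_def flat_poly_def)
  have kC: "Ck_on j UNIV k" for j
  proof -
    have ff: "Ck_on j UNIV (flat_fun 0)"
      by (rule Ck_on_derivative_sequence) (auto intro: flat_fun_derivative)
    have i: "Ck_on j UNIV (\<lambda>t::real. t)" using Ck_on_inner_right[of j UNIV "1::real"] by simp
    have "Ck_on j UNIV (\<lambda>t. flat_fun 0 (t - 1/2))" "Ck_on j UNIV (\<lambda>t. flat_fun 0 (1 - t))"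
      by (rule Ck_on_compose[OF _ _ ff]; auto intro: Ck_on_diff i)+
    then show ?thesis unfolding k_def[abs_def] by (intro Ck_on_mult) auto
  qed
  have cont: "isCont k x" for x
    using kC[of 0] continuous_on_eq_continuous_at[OF open_UNIV, of k] by simp
  obtain A where A: "\<And>t. (A has_real_derivative k t) (at t)"
    using einterval_antiderivative[of "-\<infinity>" "\<infinity>" k] cont
    by (auto simp: has_real_derivative_iff_has_vector_derivative)
  have k0: "k t \<ge> 0" for t by (auto simp: k_def f0)
  have kz: "k t = 0" if "t \<le> 1/2 \<or> t \<ge> 1" for t using that by (auto simp: k_def f0)
  have "\<exists>z>1/2. z < 1 \<and> A 1 - A (1/2) = (1 - 1/2) * k z"
    by (rule MVT2) (auto intro: A)
  then obtain z where z: "z > 1/2" "z < 1" "A 1 - A (1/2) = (1 - 1/2) * k z" by auto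
  have "k z > 0" using z by (auto simp: k_def f0)
  then have c: "A 1 - A (1/2) > 0" using z by simp
  have mono: "A s \<le> A t" if "s \<le> t" for s t
    by (rule DERIV_nonneg_imp_nondecreasing[OF that]) (use A k0 in blast)
  have const: "A s = A t" if "s \<le> t" "t \<le> 1/2 \<or> s \<ge> 1" for s t
  proof (rule order_antisym)
    show "A s \<le> A t" by (rule mono[OF that(1)])
    show "A t \<le> A s"
    proof (rule DERIV_nonpos_imp_nonincreasing[OF that(1)])
      fix x assume "s \<le> x" "x \<le> t"
      then show "\<exists>y. (A has_real_derivative y) (at x) \<and> y \<le> 0"
        using A[of x] kz[of x] that(2) by force
    qed
  qed
  define c where "c = A 1 - A (1/2)"
  have c: "c > 0" using c c_def by simp
  define \<sigma> where "\<sigma> t = (1/c) * A t - A (1/2) / c" for t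
  define \<sigma>' where "\<sigma>' t = (1/c) * k t" for t
  show ?thesis
  proof (rule that[of \<sigma> \<sigma>'])
    show "Ck_on j UNIV \<sigma>'" for j unfolding \<sigma>'_def[abs_def] using kC by (intro Ck_on_mult) auto
    show d: "(\<sigma> has_real_derivative \<sigma>' t) (at t)" for t
      unfolding \<sigma>_def[abs_def] \<sigma>'_def using c by (auto intro!: derivative_eq_intros A)
    show "Ck_on j UNIV \<sigma>" for j
      by (rule Ck_on_Suc_imp, rule Ck_on_antiderivative[OF _ d]) (use \<open>\<And>j. Ck_on j UNIV \<sigma>'\<close> in auto)
    show "\<sigma>' t \<ge> 0" for t using k0 c by (simp add: \<sigma>'_def)
    show s0: "\<sigma> t = 0" if "t \<le> 1/2" for t using const[of t "1/2"] that by (simp add: \<sigma>_def)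
    show s1: "\<sigma> t = 1" if "t \<ge> 1" for t
    proof -
      have "\<sigma> t = (A 1 - A (1/2)) / c" using const[of 1 t] that by (simp add: \<sigma>_def diff_divide_distrib)
      then show ?thesis using c unfolding c_def by simp
    qed
    show "\<sigma>' t = 0" if "t \<le> 1/2" for t using kz that by (simp add: \<sigma>'_def)
    show "\<sigma>' t = 0" if "t \<ge> 1" for t using kz that by (simp add: \<sigma>'_def)
    have m: "\<sigma> s \<le> \<sigma> t" if "s \<le> t" for s t using mono[OF that] c by (simp add: \<sigma>_def divide_right_mono)
    show "0 \<le> \<sigma> t" for t using m[of "min t (1/2)" t] s0[of "min t (1/2)"] by simp
    show "\<sigma> t \<le> 1" for t using m[of t "max t 1"] s1[of "max t 1"] by simp
  qed
qed

subsection \<open>The Laplacian\<close>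

lemma laplacian_cong:
  assumes "open S" "x \<in> S" "\<And>y. y \<in> S \<Longrightarrow> u y = v y"
  shows "laplacian u x = laplacian v x"
proof -
  have "partial b (partial b u) x = partial b (partial b v) x" for b
    by (rule partial_cong[OF assms(1,2)], rule partial_cong[OF assms(1)]) (use assms(3) in auto)
  then show ?thesis unfolding laplacian_def by simp
qed

lemma laplacian_comp:
  assumes S: "open S" "x \<in> S" and u: "Ck_on 2 S u"
    and h: "\<And>y. y \<in> S \<Longrightarrow> (h has_real_derivative h' (u y)) (at (u y))"
    and h': "(h' has_real_derivative h'') (at (u x))"
  shows "laplacian (\<lambda>x. h (u x)) x = h' (u x) * laplacian u x + h'' * (\<Sum>b\<in>Basis. (partial b u x)\<^sup>2)"
proof -
  have d: "u differentiable (at y)" "partial b u differentiable (at y)" if "y \<in> S" "b \<in> Basis" for y b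
    using u that by (auto simp: numeral_2_eq_2)
  have "partial b (partial b (\<lambda>x. h (u x))) x = h' (u x) * partial b (partial b u) x + h'' * (partial b u x)\<^sup>2"
    if b: "b \<in> Basis" for b
  proof -
    have "partial b (partial b (\<lambda>x. h (u x))) x = partial b (\<lambda>x. h' (u x) * partial b u x) x"
      by (rule partial_cong[OF S]) (use partial_comp(1) h d b in blast)
    also have "\<dots> = h' (u x) * partial b (partial b u) x + partial b (\<lambda>x. h' (u x)) x * partial b u x"
      by (rule partial_eqI[where D="\<lambda>c. h' (u x) * partial c (partial b u) x + partial c (\<lambda>x. h' (u x)) x * partial b u x"],
          intro has_derivative_mult has_derivative_frechet partial_comp(2)[where u=u, OF h'] d[where b=b] S(2) b)
    also have "partial b (\<lambda>x. h' (u x)) x = h'' * partial b u x"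
      by (rule partial_comp(1)[where u=u, OF h' d(1)[OF S(2) b]])
    finally show ?thesis by (simp add: power2_eq_square)
  qed
  then show ?thesis
    unfolding laplacian_def by (simp add: sum.distrib sum_distrib_left)
qed

lemma partial_add:
  "u differentiable (at x) \<Longrightarrow> v differentiable (at x) \<Longrightarrow> partial b (\<lambda>x. u x + v x) x = partial b u x + partial b v x"
  by (rule partial_eqI[where D="\<lambda>b. partial b u x + partial b v x"], intro has_derivative_add has_derivative_frechet)

lemma laplacian_add:
  assumes S: "open S" "x \<in> S" and "Ck_on 2 S u" "Ck_on 2 S v"
  shows "laplacian (\<lambda>x. u x + v x) x = laplacian u x + laplacian v x"
proof -
  have d: "u differentiable (at y)" "partial b u differentiable (at y)"
    "v differentiable (at y)" "partial b v differentiable (at y)" if "y \<in> S" "b \<in> Basis" for y b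
    using assms that by (auto simp: numeral_2_eq_2)
  have "partial b (partial b (\<lambda>x. u x + v x)) x = partial b (\<lambda>x. partial b u x + partial b v x) x"
    if "b \<in> Basis" for b
    by (rule partial_cong[OF S]) (use partial_add d that in blast)
  then show ?thesis
    unfolding laplacian_def by (simp add: sum.distrib[symmetric] partial_add d S)
qed

text \<open>Radial functions are built below as one-variable functions of quadratic polynomials,
  which are smooth at their centre, unlike the norm.\<close>

lemma
  fixes c :: "'a::euclidean_space"
  shows partial_quadratic: "partial b (\<lambda>x. p + x \<bullet> c + q * (x \<bullet> x)) = (\<lambda>x. b \<bullet> c + x \<bullet> ((2 * q) *\<^sub>R b))"
    and laplacian_quadratic: "laplacian (\<lambda>x. p + x \<bullet> c + q * (x \<bullet> x)) x = 2 * q * real DIM('a)"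
    and Ck_on_quadratic: "open S \<Longrightarrow> Ck_on k S (\<lambda>x. p + x \<bullet> c + q * (x \<bullet> x))"
proof -
  show *: "partial b (\<lambda>x. p + x \<bullet> c + q * (x \<bullet> x)) = (\<lambda>x. b \<bullet> c + x \<bullet> ((2 * q) *\<^sub>R b))" for b
  proof
    show "partial b (\<lambda>x. p + x \<bullet> c + q * (x \<bullet> x)) x = b \<bullet> c + x \<bullet> ((2 * q) *\<^sub>R b)" for x
      by (rule partial_eqI[where D="\<lambda>h. h \<bullet> c + q * (x \<bullet> h + h \<bullet> x)", THEN trans])
         (auto intro!: derivative_eq_intros simp: inner_commute)
  qed
  have "partial b (\<lambda>x. b \<bullet> c + x \<bullet> ((2 * q) *\<^sub>R b)) x = 2 * q * (b \<bullet> b)" for b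
    by (rule partial_eqI[where D="\<lambda>h. h \<bullet> ((2 * q) *\<^sub>R b)" and b=b, simplified])
       (auto intro!: derivative_eq_intros)
  then show "laplacian (\<lambda>x. p + x \<bullet> c + q * (x \<bullet> x)) x = 2 * q * real DIM('a)"
    unfolding laplacian_def * by (simp add: mult.commute)
  show "open S \<Longrightarrow> Ck_on k S (\<lambda>x. p + x \<bullet> c + q * (x \<bullet> x))"
    by (intro Ck_on_add Ck_on_mult) auto
qed

section \<open>The first Dirichlet eigenvalue of the ball is positive\<close>

lemma DERIV_along_line:
  assumes "u differentiable (at (x + s *\<^sub>R b))"
  shows "((\<lambda>s. u (x + s *\<^sub>R b)) has_real_derivative partial b u (x + s *\<^sub>R b)) (at s)"
proof -
  define D where "D = (\<lambda>h. partial h u (x + s *\<^sub>R b))"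
  have D: "(u has_derivative D) (at (x + s *\<^sub>R b))"
    unfolding D_def by (rule has_derivative_frechet[OF assms])
  have "((\<lambda>s. x + s *\<^sub>R b) has_derivative (\<lambda>h. h *\<^sub>R b)) (at s)"
    by (auto intro!: derivative_eq_intros)
  then have "((\<lambda>s. u (x + s *\<^sub>R b)) has_derivative (\<lambda>h. D (h *\<^sub>R b))) (at s)"
    using has_derivative_compose D by blast
  moreover have "(\<lambda>h. D (h *\<^sub>R b)) = (*) (D b)"
    using linear_scale[OF has_derivative_linear[OF D]] by (auto simp: mult.commute)
  ultimately show ?thesis unfolding has_field_derivative_def by (simp add: D_def)
qed

text \<open>If a pure second derivative were positive, the first derivative in that direction, zero
  at the maximum, would be positive just beyond it, and the mean value theorem would produce a
  larger value.\<close>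

lemma laplacian_nonpos_at_max:
  assumes S: "open S" "x \<in> S" and u: "Ck_on 2 S u" and max: "\<And>y. y \<in> S \<Longrightarrow> u y \<le> u x"
  shows "laplacian u x \<le> 0"
  unfolding laplacian_def
proof (rule sum_nonpos, rule ccontr)
  fix b :: 'a assume b: "b \<in> Basis" and "\<not> partial b (partial b u) x \<le> 0"
  then have pos: "partial b (partial b u) x > 0" by simp
  have d: "u differentiable (at y)" "partial b u differentiable (at y)" if "y \<in> S" for y
    using u that b by (auto simp: numeral_2_eq_2)
  obtain e where e: "e > 0" "ball x e \<subseteq> S" using S open_contains_ball by blast
  have inS: "x + s *\<^sub>R b \<in> S" if "\<bar>s\<bar> < e" for s
    using e(2) that b by (auto simp: dist_norm)
  define g where "g s = u (x + s *\<^sub>R b)" for s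
  define g' where "g' s = partial b u (x + s *\<^sub>R b)" for s
  have g: "(g has_real_derivative g' s) (at s)" if "\<bar>s\<bar> < e" for s
    unfolding g_def[abs_def] g'_def by (rule DERIV_along_line[OF d(1)[OF inS[OF that]]])
  have g'': "(g' has_real_derivative partial b (partial b u) x) (at 0)"
    using DERIV_along_line[of "partial b u" x 0 b] d(2)[OF S(2)] by (simp add: g'_def[abs_def])
  have g0: "g' 0 = 0"
    by (rule DERIV_local_max[OF g[of 0] e(1)]) (use e max inS in \<open>auto simp: g_def\<close>)
  obtain c where c: "c > 0" "\<And>h. h > 0 \<Longrightarrow> h < c \<Longrightarrow> g' 0 < g' h"
    using DERIV_pos_inc_right[OF g'' pos] by auto
  define h where "h = min c e / 2"
  have h: "0 < h" "h < c" "h < e" using c e by (auto simp: h_def)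
  have "\<exists>z>0. z < h \<and> g h - g 0 = (h - 0) * g' z"
    by (rule MVT2) (use h in \<open>auto intro!: g\<close>)
  then obtain z where z: "z > 0" "z < h" "g h - g 0 = (h - 0) * g' z" by auto
  have "g' z > 0" using c z h g0 by auto
  then have "(h - 0) * g' z > 0" using h by simp
  moreover have "g h \<le> g 0" using max[OF inS[of h]] h by (simp add: g_def)
  ultimately show False using z(3) by linarith
qed

text \<open>The paraboloid c (1 - |x|^2) has negative Laplacian 2 n c. With m the maximum of
  \<open>\<phi>\<close> and \<open>lam\<close> < 2 n, some c < m satisfies max(lam, 0) m < 2 n c.
  The difference of \<open>\<phi>\<close> and the paraboloid is then still positive at its maximum,
  which is interior, and there 2 n c \<le> lam \<open>\<phi>\<close> \<le> max(lam, 0) m, a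
  contradiction.\<close>

lemma eigenfunction_positive_lower_bound:
  fixes \<phi> :: "'a::euclidean_space \<Rightarrow> real"
  assumes cd: "classical_dirichlet (ball 0 1) \<phi>"
    and eq: "\<And>x. x \<in> ball 0 1 \<Longrightarrow> - laplacian \<phi> x = lam * \<phi> x"
    and y: "y \<in> ball 0 1" "\<phi> y > 0"
  shows "2 * real DIM('a) \<le> lam"
proof (rule ccontr)
  define n where "n = real DIM('a)"
  assume "\<not> 2 * real DIM('a) \<le> lam"
  then have lam: "lam < 2 * n" and n: "n > 0" by (auto simp: n_def)
  have cont: "continuous_on (cball 0 1) \<phi>" and fr: "\<phi> x = 0" if "norm x = 1" for x
    using cd that by (auto simp: classical_dirichlet_def)
  have cont: "continuous_on (cball 0 1) \<phi>" using cd by (auto simp: classical_dirichlet_def)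
  obtain x1 where x1: "x1 \<in> cball 0 1" "\<And>x. x \<in> cball 0 1 \<Longrightarrow> \<phi> x \<le> \<phi> x1"
    using continuous_attains_sup[OF compact_cball _ cont] by auto
  define m where "m = \<phi> x1"
  have m: "m > 0" using x1(2)[of y] y by (auto simp: m_def)
  have "max lam 0 * m / (2 * n) < m" using lam n m by (simp add: field_simps max_def)
  then obtain c where c: "max lam 0 * m / (2 * n) < c" "c < m" using dense by blast
  have c0: "c > 0" using c(1) m n by (smt (verit) divide_nonneg_pos max.cobounded2 mult_nonneg_nonneg)
  define \<psi> where "\<psi> x = \<phi> x + (- c + x \<bullet> 0 + c * (x \<bullet> x))" for x
  have "continuous_on (cball 0 1) \<psi>" unfolding \<psi>_def by (intro continuous_intros cont)
  then obtain x0 where x0: "x0 \<in> cball 0 1" "\<And>x. x \<in> cball 0 1 \<Longrightarrow> \<psi> x \<le> \<psi> x0"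
    using continuous_attains_sup[OF compact_cball, of 0 1 \<psi>] by auto
  have "\<psi> x1 \<ge> m - c" using c0 by (simp add: \<psi>_def m_def)
  then have p0: "\<psi> x0 > 0" using x0(2)[OF x1(1)] c by linarith
  have "norm x0 \<noteq> 1" using fr[of x0] p0 by (auto simp: \<psi>_def power2_norm_eq_inner[symmetric])
  then have b0: "x0 \<in> ball 0 1" using x0(1) by auto
  have C2: "Ck_on 2 (ball 0 1) \<phi>" using cd by (auto simp: classical_dirichlet_def)
  have q2: "Ck_on 2 (ball 0 1) (\<lambda>x::'a. - c + x \<bullet> 0 + c * (x \<bullet> x))"
    by (rule Ck_on_quadratic) simp
  have "laplacian \<psi> x0 \<le> 0"
  proof (rule laplacian_nonpos_at_max[OF open_ball b0])
    show "Ck_on 2 (ball 0 1) \<psi>" unfolding \<psi>_def by (rule Ck_on_add[OF open_ball C2 q2])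
    show "\<psi> y \<le> \<psi> x0" if "y \<in> ball 0 1" for y using x0(2)[of y] that by auto
  qed
  moreover have "laplacian \<psi> x0 = - lam * \<phi> x0 + 2 * c * n"
    using laplacian_add[OF open_ball b0 C2 q2] laplacian_quadratic[of "-c" 0 c x0] eq[OF b0]
    unfolding \<psi>_def n_def by simp
  ultimately have le: "2 * c * n \<le> lam * \<phi> x0" by linarith
  have "\<phi> x0 = \<psi> x0 + c * (1 - (norm x0)\<^sup>2)"
    by (simp add: \<psi>_def power2_norm_eq_inner algebra_simps)
  moreover have "c * (1 - (norm x0)\<^sup>2) \<ge> 0" using c0 x0(1) by (simp add: power_le_one)
  ultimately have ph: "\<phi> x0 > 0" using p0 by linarith
  have "\<phi> x0 \<le> m" using x1(2)[OF x0(1)] by (simp add: m_def)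
  then have "lam * \<phi> x0 \<le> max lam 0 * m"
    by (intro mult_mono) (use ph in auto)
  also have "\<dots> < c * (2 * n)" using c(1) n by (simp add: field_simps)
  finally show False using le by (simp add: algebra_simps)
qed

lemma dirichlet_eigenvalue_ge:
  assumes "dirichlet_eigenvalue (ball (0::'a::euclidean_space) 1) lam"
  shows "2 * real DIM('a) \<le> lam"
proof -
  obtain \<phi> :: "'a \<Rightarrow> real" and y where cd: "classical_dirichlet (ball 0 1) \<phi>"
    and y: "y \<in> ball 0 1" "\<phi> y \<noteq> 0"
    and eq: "\<And>x. x \<in> ball 0 1 \<Longrightarrow> - laplacian \<phi> x = lam * \<phi> x"
    using assms unfolding dirichlet_eigenvalue_def by blast
  show ?thesis
  proof (cases "\<phi> y > 0")
    case True
    then show ?thesis using eigenfunction_positive_lower_bound[OF cd eq y(1)] by blast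
  next
    case False
    have C2: "Ck_on 2 (ball 0 1) \<phi>" using cd by (simp add: classical_dirichlet_def)
    have l: "laplacian (\<lambda>x. - \<phi> x) x = - laplacian \<phi> x" if "x \<in> ball 0 1" for x
    proof -
      have "((\<lambda>t. - t) has_real_derivative - 1) (at s)" for s :: real
        by (auto intro!: derivative_eq_intros)
      then show ?thesis using laplacian_comp[OF open_ball that C2, of uminus "\<lambda>_. -1" 0] by simp
    qed
    have "classical_dirichlet (ball 0 1) (\<lambda>x. - \<phi> x)"
      using cd Ck_on_uminus[OF open_ball C2] by (auto simp: classical_dirichlet_def intro: continuous_intros)
    then show ?thesis
      by (rule eigenfunction_positive_lower_bound[OF _ _ y(1)]) (use False y l eq in auto)
  qed
qed

text \<open>The entire function \<open>bessel_deriv n 0\<close> is, up to scaling, a Bessel function of \<open>sqrt t\<close>; radial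
  eigenfunctions have the form \<open>x \<mapsto> bessel_deriv n 0 (\<mu> |x|\<^sup>2)\<close>.\<close>

definition bessel_coeff :: "nat \<Rightarrow> nat \<Rightarrow> real" where
  "bessel_coeff n k = (-1) ^ k / (\<Prod>i<k. 2 * (real i + 1) * (2 * real i + real n))"

definition bessel_deriv :: "nat \<Rightarrow> nat \<Rightarrow> real \<Rightarrow> real" where
  "bessel_deriv n j t = (\<Sum>k. (diffs ^^ j) (bessel_coeff n) k * t ^ k)"

lemma bessel_coeff_Suc:
  "n > 0 \<Longrightarrow> 2 * (real k + 1) * (2 * real k + real n) * bessel_coeff n (Suc k) = - bessel_coeff n k"
proof -
  assume n: "n > 0"
  define d where "d = 2 * (real k + 1) * (2 * real k + real n)"
  have "d > 0" using n by (simp add: d_def add_nonneg_pos)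
  then show ?thesis unfolding bessel_coeff_def prod.lessThan_Suc d_def[symmetric] by simp
qed

lemma summable_bessel:
  assumes "n > 0"
  shows "summable (\<lambda>k. (diffs ^^ j) (bessel_coeff n) k * t ^ k)"
proof (induction j arbitrary: t)
  case 0
  have "\<bar>bessel_coeff n k\<bar> \<le> 1 / fact k" for k
  proof -
    have "(fact k :: real) = (\<Prod>i<k. real i + 1)"
      by (induction k) (auto simp: algebra_simps)
    also have "\<dots> \<le> (\<Prod>i<k. 2 * (real i + 1) * (2 * real i + real n))"
    proof (rule prod_mono)
      fix i
      have "(real i + 1) * 1 \<le> (real i + 1) * (2 * (2 * real i + real n))"
        by (rule mult_left_mono) (use assms in auto)
      then show "0 \<le> real i + 1 \<and> real i + 1 \<le> 2 * (real i + 1) * (2 * real i + real n)"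
        by (simp add: algebra_simps)
    qed
    finally have *: "(fact k :: real) \<le> (\<Prod>i<k. 2 * (real i + 1) * (2 * real i + real n))" .
    then have "0 < (\<Prod>i<k. 2 * (real i + 1) * (2 * real i + real n))"
      by (rule less_le_trans[rotated]) simp
    with * show ?thesis unfolding bessel_coeff_def
      by (simp add: power_abs abs_divide) (simp add: frac_le)
  qed
  then have b: "norm (bessel_coeff n k * t ^ k) \<le> \<bar>t\<bar> ^ k / fact k" for k
    using mult_right_mono[of "\<bar>bessel_coeff n k\<bar>" "1 / fact k" "\<bar>t\<bar> ^ k"] by (simp add: abs_mult power_abs)
  have "summable (\<lambda>k. \<bar>t\<bar> ^ k / fact k)" using summable_exp[of "\<bar>t\<bar>"] by (simp add: divide_inverse mult.commute)
  then show ?case by (rule summable_comparison_test') (use b in simp)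
next
  case (Suc j)
  then show ?case using termdiff_converges_all[of "(diffs ^^ j) (bessel_coeff n)" t] by simp
qed

lemma bessel_deriv_DERIV:
  assumes "n > 0"
  shows "(bessel_deriv n j has_real_derivative bessel_deriv n (Suc j) t) (at t)"
  using termdiffs_strong_converges_everywhere[of "(diffs ^^ j) (bessel_coeff n)" t, OF summable_bessel[OF assms]]
  unfolding bessel_deriv_def[abs_def] by simp

lemma bessel_deriv_0: "bessel_deriv n 0 0 = 1"
  using powser_zero[of "bessel_coeff n"] by (simp add: bessel_deriv_def bessel_coeff_def)

text \<open>In t = r^2 the radial Laplacian reads 4 t d^2/dt^2 + 2 n d/dt, so this is the equation
  psi'' + (n-1) psi'/r = -psi. Compared coefficient by coefficient it is the recursion
  \<open>bessel_coeff_Suc\<close>.\<close>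

lemma bessel_ode:
  assumes n: "n > 0"
  shows "4 * t * bessel_deriv n 2 t + 2 * real n * bessel_deriv n 1 t = - bessel_deriv n 0 t"
proof -
  define a where "a = bessel_coeff n"
  have s0: "(\<lambda>k. a k * t ^ k) sums bessel_deriv n 0 t"
    using summable_sums[OF summable_bessel[OF n, of 0 t]] by (simp add: bessel_deriv_def a_def)
  have s1: "(\<lambda>k. (real k + 1) * a (Suc k) * t ^ k) sums bessel_deriv n 1 t"
    using summable_sums[OF summable_bessel[OF n, of 1 t]] by (simp add: bessel_deriv_def a_def diffs_def add.commute)
  have "(\<lambda>k. (real k + 1) * ((real k + 2) * a (Suc (Suc k))) * t ^ k) sums bessel_deriv n 2 t"
    using summable_sums[OF summable_bessel[OF n, of 2 t]]
    by (simp add: bessel_deriv_def a_def diffs_def numeral_2_eq_2 add.commute)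
  from sums_mult[OF this, of t]
  have "(\<lambda>k. real (Suc k) * (real (Suc k) + 1) * a (Suc (Suc k)) * t ^ (Suc k)) sums (t * bessel_deriv n 2 t)"
    by (simp add: mult_ac add.commute)
  then have "(\<lambda>k. real k * (real k + 1) * a (Suc k) * t ^ k) sums (t * bessel_deriv n 2 t)"
    by (subst (asm) sums_Suc_iff[where f="\<lambda>k. real k * (real k + 1) * a (Suc k) * t ^ k"]) simp
  from sums_add[OF sums_mult[OF this, of 4] sums_mult[OF s1, of "2 * real n"]]
  have "(\<lambda>k. 2 * (real k + 1) * (2 * real k + real n) * a (Suc k) * t ^ k) sums
      (4 * (t * bessel_deriv n 2 t) + 2 * real n * bessel_deriv n 1 t)"
    by (simp add: algebra_simps)
  then have "(\<lambda>k. - (a k * t ^ k)) sums (4 * (t * bessel_deriv n 2 t) + 2 * real n * bessel_deriv n 1 t)"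
    using bessel_coeff_Suc[OF n] by (simp add: a_def)
  from sums_unique2[OF this sums_minus[OF s0]] show ?thesis by simp
qed

text \<open>A solution without zeros would be positive and would decay at two incompatible rates.
  Its flux stays below -c from radius 1 on, so it is at least of order r^(2-n); but positivity also
  makes r^n psi bounded. Multiplying by r^n shows that r^2 would be bounded.\<close>

lemma bessel_root:
  assumes n: "n \<ge> 3"
  obtains t where "t > 0" "bessel_deriv n 0 t = 0"
proof -
  have "\<exists>t>0. bessel_deriv n 0 t = 0"
  proof (rule ccontr)
  assume "\<not> (\<exists>t>0. bessel_deriv n 0 t = 0)"
  then have nz: "bessel_deriv n 0 t \<noteq> 0" if "t > 0" for t using that by blast
  have n0: "n > 0" using n by simp
  define \<psi> where "\<psi> r = bessel_deriv n 0 (r\<^sup>2)" for r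
  define \<psi>' where "\<psi>' r = 2 * r * bessel_deriv n 1 (r\<^sup>2)" for r
  define g where "g r = r ^ (n - 1) * \<psi>' r" for r
  have bd: "(bessel_deriv n 0 has_real_derivative bessel_deriv n 1 t) (at t)"
    "(bessel_deriv n 1 has_real_derivative bessel_deriv n 2 t) (at t)" for t
    using bessel_deriv_DERIV[OF n0, of 0 t] bessel_deriv_DERIV[OF n0, of 1 t] by (simp_all add: numeral_2_eq_2)
  have d: "(\<psi> has_real_derivative \<psi>' r) (at r)" for r
    unfolding \<psi>_def[abs_def] \<psi>'_def
    by (auto intro!: derivative_eq_intros bd[THEN DERIV_chain2, THEN DERIV_cong] simp del: One_nat_def)
  have cont: "continuous_on S \<psi>" for S
    by (intro continuous_at_imp_continuous_on ballI DERIV_isCont[OF d])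
  have pos: "\<psi> r > 0" if "r \<ge> 0" for r
  proof (rule ccontr)
    assume "\<not> \<psi> r > 0"
    moreover have "\<psi> 0 = 1" by (simp add: \<psi>_def bessel_deriv_0)
    ultimately obtain x where "0 \<le> x" "x \<le> r" "\<psi> x = 0"
      using IVT2'[of \<psi> r 0 0] \<open>r \<ge> 0\<close> cont by auto
    then show False using nz[of "x\<^sup>2"] \<open>\<psi> 0 = 1\<close> by (cases "x = 0") (auto simp: \<psi>_def)
  qed
  have dg: "(g has_real_derivative - (r ^ (n - 1) * \<psi> r)) (at r)" for r
  proof -
    have "(g has_real_derivative real (n - 1) * r ^ (n - 1 - 1) * (2 * r * bessel_deriv n 1 (r\<^sup>2))
       + r ^ (n - 1) * (2 * bessel_deriv n 1 (r\<^sup>2) + 2 * r * (2 * r * bessel_deriv n 2 (r\<^sup>2)))) (at r)"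
      unfolding g_def[abs_def] \<psi>'_def
      by (auto intro!: derivative_eq_intros bd[THEN DERIV_chain2, THEN DERIV_cong] simp del: One_nat_def)
    moreover have "r ^ (n - 1) = r ^ (n - 1 - 1) * r" using n by (cases "n - 1") auto
    moreover have "real (n - 1) = real n - 1" using n by simp
    ultimately have "(g has_real_derivative r ^ (n - 1) * (4 * r\<^sup>2 * bessel_deriv n 2 (r\<^sup>2) + 2 * real n * bessel_deriv n 1 (r\<^sup>2))) (at r)"
      by (simp add: algebra_simps power2_eq_square)
    then show ?thesis using bessel_ode[OF n0, of "r\<^sup>2"] by (simp add: \<psi>_def)
  qed
  have g0: "g 0 = 0" using n by (simp add: g_def)
  have dgneg: "\<exists>y. (g has_real_derivative y) (at r) \<and> y \<le> 0" if "r \<ge> 0" for r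
    using dg[of r] pos[OF that] that by (intro exI[of _ "- (r ^ (n - 1) * \<psi> r)"]) simp
  have gneg: "g r \<le> g 1" if "r \<ge> 1" for r
    by (rule DERIV_nonpos_imp_nonincreasing[OF that])
       (use dgneg that in auto)
  have "\<exists>z>0. z < 1 \<and> g 1 - g 0 = (1 - 0) * - (z ^ (n - 1) * \<psi> z)"
    by (rule MVT2) (use dg in auto)
  then obtain z where z: "z > 0" "z < 1" "g 1 = - (z ^ (n - 1) * \<psi> z)" using g0 by auto
  define c where "c = - g 1"
  have c: "c > 0" using z pos[of z] by (simp add: c_def)
  have gneg0: "g r \<le> 0" if "r \<ge> 0" for r
  proof -
    have "g r \<le> g 0"
      by (rule DERIV_nonpos_imp_nonincreasing[OF that])
         (use dgneg that in auto)
    then show ?thesis using g0 by simp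
  qed
  have psi': "\<psi>' r \<le> 0" if "r > 0" for r
    using gneg0[of r] that mult_pos_pos[OF zero_less_power[OF that, of "n - 1"], of "\<psi>' r"]
    unfolding g_def by linarith
  \<comment> \<open>As \<open>\<psi>\<close> is decreasing, its mean over the ball of radius r is at
    least \<open>\<psi> r\<close>, so the flux is at most - r^n \<open>\<psi> r\<close> / n.\<close>
  have dec: "\<psi>' r \<le> - (r * \<psi> r / n)" if "r > 0" for r
  proof -
    have "g r + r ^ n * \<psi> r / n \<le> g 0 + 0 ^ n * \<psi> 0 / n"
    proof (rule DERIV_nonpos_imp_nonincreasing[of 0 r "\<lambda>r. g r + r ^ n * \<psi> r / n"])
      fix x assume x: "0 \<le> x" "x \<le> r"
      have "((\<lambda>r. g r + r ^ n * \<psi> r / n) has_real_derivative x ^ n * \<psi>' x / n) (at x)"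
        using n by (auto intro!: derivative_eq_intros dg d simp: field_simps)
      moreover have "x ^ n * \<psi>' x / n \<le> 0"
        using psi'[of x] x n by (cases "x = 0") (auto simp: divide_le_0_iff mult_le_0_iff zero_power)
      ultimately show "\<exists>y. ((\<lambda>r. g r + r ^ n * \<psi> r / n) has_real_derivative y) (at x) \<and> y \<le> 0" by blast
    qed (use that in simp)
    then have "g r + r ^ n * \<psi> r / n \<le> 0" using n g0 by (simp add: zero_power)
    then have "r ^ (n - 1) * \<psi>' r + r ^ n * \<psi> r / n \<le> 0" unfolding g_def .
    moreover have "r ^ n = r ^ (n - 1) * r" using n by (cases n) auto
    ultimately have "r ^ (n - 1) * (\<psi>' r + r * \<psi> r / n) \<le> 0" by (simp add: algebra_simps)
    then show ?thesis
      using mult_pos_pos[OF zero_less_power[OF that, of "n - 1"], of "\<psi>' r + r * \<psi> r / n"] by linarith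
  qed
  \<comment> \<open>Comparison with the decaying harmonic function of flux -c; the difference is
    nonincreasing and bounded below by a quantity that vanishes at infinity.\<close>
  have low: "\<psi> r \<ge> c / (n - 2) * (1 / r ^ (n - 2))" if "r \<ge> 1" for r
  proof -
    define k where "k r = \<psi> r - c / (n - 2) * (1 / r ^ (n - 2))" for r
    obtain j where j: "n = j + 3" using n by (metis add.commute le_Suc_ex)
    have dk: "\<exists>y. (k has_real_derivative y) (at x) \<and> y \<le> 0" if "x \<ge> 1" for x
    proof -
      have "(k has_real_derivative \<psi>' x + c / x ^ (n - 1)) (at x)"
      proof -
        have "((\<lambda>r. 1 / r ^ Suc j) has_real_derivative - (real (Suc j) / x ^ (j + 2))) (at x)"
          by (rule DERIV_cong[OF DERIV_divide[OF DERIV_const DERIV_pow]]) (use that in \<open>simp_all add: field_simps\<close>)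
        from DERIV_diff[OF d[of x] DERIV_cmult[OF this, of "c / real (Suc j)"]]
        show ?thesis unfolding k_def[abs_def] j by (simp add: eval_nat_numeral)
      qed
      moreover have "x ^ (n - 1) * \<psi>' x \<le> - c" using gneg[OF that] by (simp add: g_def c_def)
      then have "\<psi>' x + c / x ^ (n - 1) \<le> 0" using that by (simp add: field_simps)
      ultimately show ?thesis by blast
    qed
    have kk: "k s \<le> k r" if "s \<ge> r" for s
      by (rule DERIV_nonpos_imp_nonincreasing[OF that]) (use dk \<open>r \<ge> 1\<close> in auto)
    have lim: "((\<lambda>s. - (c / (n - 2) * (1 / s ^ (n - 2)))) \<longlongrightarrow> - (c / (n - 2) * 0)) at_top"
      using n by (intro tendsto_intros tendsto_divide_0[OF tendsto_const] filterlim_at_top_imp_at_infinity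
          filterlim_pow_at_top filterlim_ident) auto
    have "- (c / (n - 2) * 0) \<le> k r"
    proof (rule tendsto_upperbound[OF lim])
      show "\<forall>\<^sub>F s in at_top. - (c / (n - 2) * (1 / s ^ (n - 2))) \<le> k r"
        using eventually_ge_at_top[of r]
      proof eventually_elim
        case (elim s)
        have "- (c / (n - 2) * (1 / s ^ (n - 2))) \<le> k s"
          using pos[of s] elim that by (simp add: k_def)
        then show ?case using kk[OF elim] by (rule order_trans)
      qed
    qed simp
    then show ?thesis by (simp add: k_def)
  qed
  \<comment> \<open>From r = n on, r^2 / n is at least n, so the logarithmic decay in
    \<open>dec\<close> outweighs the growth of r^n.\<close>
  have up: "r ^ n * \<psi> r \<le> real n ^ n * \<psi> n" if "real n \<le> r" for r :: real
  proof (rule DERIV_nonpos_imp_nonincreasing[OF that, of "\<lambda>r. r ^ n * \<psi> r"])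
    fix x assume x: "real n \<le> x" "x \<le> r"
    have x0: "x > 0" using x n by linarith
    have "((\<lambda>r. r ^ n * \<psi> r) has_real_derivative n * x ^ (n - 1) * \<psi> x + x ^ n * \<psi>' x) (at x)"
      by (auto intro!: derivative_eq_intros d)
    moreover have "n * x ^ (n - 1) * \<psi> x + x ^ n * \<psi>' x \<le> 0"
    proof -
      have "x * \<psi>' x \<le> x * (- (x * \<psi> x / n))" by (rule mult_left_mono[OF dec[OF x0]]) (use x0 in simp)
      also have "\<dots> = - ((x * x / n) * \<psi> x)" by simp
      also have "\<dots> \<le> - (n * \<psi> x)"
      proof -
        have "real n * n \<le> x * x" by (rule mult_mono) (use x in auto)
        then have "n \<le> x * x / n" using n by (simp add: field_simps)
        then show ?thesis using mult_right_mono[of "real n" "x * x / n" "\<psi> x"] pos[of x] x0 by simp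
      qed
      finally have "n * \<psi> x + x * \<psi>' x \<le> 0" by simp
      then have "x ^ (n - 1) * (n * \<psi> x + x * \<psi>' x) \<le> 0" using x0 by (simp add: mult_le_0_iff)
      moreover have "x ^ n = x ^ (n - 1) * x" using n by (cases n) auto
      ultimately show ?thesis by (simp add: algebra_simps)
    qed
    ultimately show "\<exists>y. ((\<lambda>r. r ^ n * \<psi> r) has_real_derivative y) (at x) \<and> y \<le> 0" by blast
  qed
  define K where "K = real n ^ n * \<psi> n * (n - 2) / c"
  define r where "r = max (real n) (K + 1)"
  have r: "real n \<le> r" unfolding r_def by (rule max.cobounded1)
  have r2: "r > K"
    unfolding r_def by (rule less_le_trans[OF _ max.cobounded2]) simp
  have r3: "r \<ge> 1" using r n by linarith
  have "r ^ n = r ^ (n - 2) * r\<^sup>2" proof -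
    have "n = (n - 2) + 2" using n by simp
    then show ?thesis by (metis power_add)
  qed
  moreover have "r ^ (n - 2) > 0" using r r2 r3 by simp
  ultimately have "c / (n - 2) * r\<^sup>2 = r ^ n * (c / (n - 2) * (1 / r ^ (n - 2)))" by simp
  also have "\<dots> \<le> r ^ n * \<psi> r" by (rule mult_left_mono[OF low]) (use r3 in auto)
  also have "\<dots> \<le> real n ^ n * \<psi> n" by (rule up[OF r])
  finally have "r\<^sup>2 \<le> K" using c n by (simp add: K_def field_simps)
  moreover have "r * 1 \<le> r\<^sup>2" unfolding power2_eq_square by (rule mult_left_mono) (use r3 in auto)
  ultimately show False using r2 by simp
  qed
  then show thesis using that by blast
qed

lemma dirichlet_eigenvalue_exists:
  assumes "DIM('a::euclidean_space) \<ge> 3"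
  shows "\<exists>lam. dirichlet_eigenvalue (ball (0::'a) 1) lam"
proof -
  define n where "n = DIM('a)"
  have n: "n \<ge> 3" "n > 0" using assms by (auto simp: n_def)
  obtain \<mu> where \<mu>: "\<mu> > 0" "bessel_deriv n 0 \<mu> = 0" using bessel_root[OF n(1)] by blast
  define q where "q x = 0 + x \<bullet> 0 + \<mu> * (x \<bullet> x)" for x :: 'a
  define \<phi> where "\<phi> x = bessel_deriv n 0 (q x)" for x
  have q2: "Ck_on k UNIV q" for k unfolding q_def[abs_def] by (rule Ck_on_quadratic) simp
  have "Ck_on k UNIV (bessel_deriv n 0)" for k
    by (rule Ck_on_derivative_sequence) (auto intro: bessel_deriv_DERIV[OF n(2)])
  then have C: "Ck_on k UNIV \<phi>" for k unfolding \<phi>_def[abs_def] by (rule Ck_on_compose[OF open_UNIV open_UNIV _ q2]) simp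
  have bd: "(bessel_deriv n 0 has_real_derivative bessel_deriv n 1 t) (at t)"
    "(bessel_deriv n 1 has_real_derivative bessel_deriv n 2 t) (at t)" for t
    using bessel_deriv_DERIV[OF n(2), of 0 t] bessel_deriv_DERIV[OF n(2), of 1 t] by (simp_all add: numeral_2_eq_2)
  have l: "- laplacian \<phi> x = \<mu> * \<phi> x" for x
  proof -
    have "laplacian \<phi> x = bessel_deriv n 1 (q x) * laplacian q x + bessel_deriv n 2 (q x) * (\<Sum>b\<in>Basis. (partial b q x)\<^sup>2)"
      unfolding \<phi>_def[abs_def]
      by (rule laplacian_comp[where h="bessel_deriv n 0" and h'="bessel_deriv n 1" and u=q,
            OF open_UNIV UNIV_I q2]) (rule bd)+
    also have "laplacian q x = 2 * \<mu> * n" unfolding q_def[abs_def] n_def using laplacian_quadratic[of 0 0 \<mu> x] by blast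
    also have "(\<Sum>b\<in>Basis. (partial b q x)\<^sup>2) = (\<Sum>b\<in>Basis. 4 * \<mu>\<^sup>2 * (x \<bullet> b)\<^sup>2)"
      unfolding q_def[abs_def] partial_quadratic by (simp add: power2_eq_square algebra_simps)
    also have "\<dots> = 4 * \<mu>\<^sup>2 * (x \<bullet> x)"
      unfolding euclidean_inner[of x x] sum_distrib_left by (simp add: power2_eq_square)
    finally have "laplacian \<phi> x = \<mu> * (4 * q x * bessel_deriv n 2 (q x) + 2 * n * bessel_deriv n 1 (q x))"
      by (simp add: q_def power2_eq_square algebra_simps)
    then show ?thesis using bessel_ode[OF n(2), of "q x"] by (simp add: \<phi>_def)
  qed
  have "classical_dirichlet (ball 0 1) \<phi>"
    unfolding classical_dirichlet_def
  proof (intro conjI ballI)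
    show "Ck_on 2 (ball 0 1) \<phi>" using Ck_on_subset[OF C] by blast
    show "continuous_on (closure (ball 0 1)) \<phi>" using C[of 0] by (auto intro: continuous_on_subset)
    fix x :: 'a assume "x \<in> frontier (ball 0 1)"
    then have "x \<bullet> x = 1" by (simp add: power2_norm_eq_inner[symmetric])
    then show "\<phi> x = 0" using \<mu> by (simp add: \<phi>_def q_def)
  qed
  moreover have "\<phi> 0 \<noteq> 0" by (simp add: \<phi>_def q_def bessel_deriv_0)
  ultimately have "dirichlet_eigenvalue (ball (0::'a) 1) \<mu>"
    unfolding dirichlet_eigenvalue_def using l by (intro exI[of _ \<phi>] conjI bexI[of _ 0]) auto
  then show ?thesis by blast
qed

text \<open>Existence matters as much as the bound, since the infimum of an empty set of reals has
  no usable value. The result places all parameters in (0, 1) below the first eigenvalue.\<close>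

lemma first_dirichlet_eigenvalue_ge:
  assumes "DIM('a::euclidean_space) \<ge> 3"
  shows "2 * real DIM('a) \<le> first_dirichlet_eigenvalue (ball (0::'a) 1)"
  unfolding first_dirichlet_eigenvalue_def
  by (rule cInf_greatest) (use dirichlet_eigenvalue_exists[OF assms] dirichlet_eigenvalue_ge in auto)

section \<open>Two integration lemmas\<close>

text \<open>By translation invariance the difference quotients in direction \<open>b\<close> have
  integral 0 for every step, and dominated convergence passes to the derivative. The ball
  \<open>S\<close> is enlarged by \<open>norm b\<close> because steps up to 1 reach that far outside
  the support.\<close>

lemma integral_partial_eq_0:
  fixes \<psi> :: "'a::euclidean_space \<Rightarrow> real"
  assumes diff: "\<And>x. \<psi> differentiable (at x)" and cont: "continuous_on UNIV (partial b \<psi>)"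
    and supp: "\<And>x. norm x > R \<Longrightarrow> \<psi> x = 0"
  shows "integrable lborel (partial b \<psi>)" "(\<integral>x. partial b \<psi> x \<partial>lborel) = 0"
proof -
  define S where "S = cball (0::'a) (R + norm b)"
  have c\<psi>: "continuous_on UNIV \<psi>"
    using diff by (intro continuous_at_imp_continuous_on ballI differentiable_imp_continuous_within)
  have d0: "partial b \<psi> x = 0" if "norm x > R" for x
  proof -
    have "open {x::'a. norm x > R}" by (intro open_Collect_less continuous_intros)
    then have "partial b \<psi> x = partial b (\<lambda>_. 0) x"
      by (rule partial_cong) (use that supp in auto)
    also have "\<dots> = 0" by (rule partial_eqI[of _ "\<lambda>_. 0"]) simp
    finally show ?thesis .
  qed
  have "bounded (partial b \<psi> ` cball 0 R)"
    by (intro compact_imp_bounded compact_continuous_image continuous_on_subset[OF cont]) auto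
  then obtain B0 where B0: "\<And>x. x \<in> cball 0 R \<Longrightarrow> \<bar>partial b \<psi> x\<bar> \<le> B0"
    unfolding bounded_iff real_norm_def by blast
  define B where "B = max B0 0"
  have B: "\<bar>partial b \<psi> x\<bar> \<le> B" for x
  proof (cases "norm x > R")
    case True
    then show ?thesis using d0 by (simp add: B_def)
  next
    case False
    then have "\<bar>partial b \<psi> x\<bar> \<le> B0" by (intro B0) simp
    then show ?thesis by (simp add: B_def)
  qed
  have int_S: "integrable lborel (\<lambda>x. indicator S x *\<^sub>R h x)" if "continuous_on UNIV h" for h :: "'a \<Rightarrow> real"
    by (rule borel_integrable_compact) (use continuous_on_subset[OF that] in \<open>auto simp: S_def\<close>)
  have outS: "norm x > R" "norm (x + s *\<^sub>R b) > R" if "x \<notin> S" "0 \<le> s" "s \<le> 1" for x s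
  proof -
    have x: "norm x > R + norm b" using that(1) by (simp add: S_def)
    then show "norm x > R" using norm_ge_zero[of b] by linarith
    have "norm (s *\<^sub>R b) \<le> 1 * norm b" using that(2,3) by (simp add: mult_left_le_one_le)
    moreover have "norm x \<le> norm (x + s *\<^sub>R b) + norm (s *\<^sub>R b)"
      using norm_triangle_ineq4[of "x + s *\<^sub>R b" "s *\<^sub>R b"] by simp
    ultimately show "norm (x + s *\<^sub>R b) > R" using x by simp
  qed
  have i\<psi>: "integrable lborel \<psi>"
  proof -
    have "(\<lambda>x. indicator S x *\<^sub>R \<psi> x) = \<psi>"
    proof
      fix x show "indicator S x *\<^sub>R \<psi> x = \<psi> x"
        using supp outS(1)[of x 0] by (cases "x \<in> S") auto
    qed
    then show ?thesis using int_S[OF c\<psi>] by simp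
  qed
  have id: "integrable lborel (partial b \<psi>)"
  proof -
    have "(\<lambda>x. indicator S x *\<^sub>R partial b \<psi> x) = partial b \<psi>"
    proof
      fix x show "indicator S x *\<^sub>R partial b \<psi> x = partial b \<psi> x"
        using d0 outS(1)[of x 0] by (cases "x \<in> S") auto
    qed
    then show ?thesis using int_S[OF cont] by simp
  qed
  show "integrable lborel (partial b \<psi>)" by (rule id)
  define h where "h k = 1 / (real k + 1)" for k :: nat
  have h: "0 < h k" "h k \<le> 1" for k by (auto simp: h_def)
  define D where "D k x = (\<psi> (x + h k *\<^sub>R b) - \<psi> x) / h k" for k x
  have shift: "integrable lborel (\<lambda>x. \<psi> (x + c))" "(\<integral>x. \<psi> (x + c) \<partial>lborel) = (\<integral>x. \<psi> x \<partial>lborel)" for c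
  proof -
    have m: "(+) c \<in> measurable lborel borel" by simp
    have bm: "\<psi> \<in> borel_measurable borel" using i\<psi> by (simp add: borel_measurable_integrable)
    have "integrable (distr lborel borel ((+) c)) \<psi>" using i\<psi> unfolding lborel_distr_plus .
    then show "integrable lborel (\<lambda>x. \<psi> (x + c))"
      using integrable_distr_eq[OF m bm] by (simp add: add.commute)
    have "(\<integral>x. \<psi> x \<partial>lborel) = (\<integral>x. \<psi> x \<partial>distr lborel borel ((+) c))" unfolding lborel_distr_plus ..
    also have "\<dots> = (\<integral>x. \<psi> (c + x) \<partial>lborel)" by (rule integral_distr[OF m bm])
    finally show "(\<integral>x. \<psi> (x + c) \<partial>lborel) = (\<integral>x. \<psi> x \<partial>lborel)" by (simp add: add.commute)
  qed
  have D0: "(\<integral>x. D k x \<partial>lborel) = 0" for k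
    unfolding D_def using shift[of "h k *\<^sub>R b"] i\<psi> by simp
  have h0: "h \<longlonglongrightarrow> 0" unfolding h_def using LIMSEQ_inverse_real_of_nat by (simp add: inverse_eq_divide add.commute)
  have lim: "(\<lambda>k. D k x) \<longlonglongrightarrow> partial b \<psi> x" for x
  proof -
    have "((\<lambda>s. \<psi> (x + s *\<^sub>R b)) has_real_derivative partial b \<psi> x) (at 0)"
      using DERIV_along_line[of \<psi> x 0 b] diff by simp
    then have "((\<lambda>s. (\<psi> (x + s *\<^sub>R b) - \<psi> x) / s) \<longlongrightarrow> partial b \<psi> x) (at 0)"
      by (simp add: has_field_derivative_iff)
    moreover have "filterlim h (at 0) sequentially"
      unfolding filterlim_at using h0 h(1) by (auto simp: less_imp_neq[symmetric])
    ultimately show ?thesis unfolding D_def by (rule filterlim_compose)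
  qed
  have bound: "norm (D k x) \<le> B * indicator S x" for k x
  proof (cases "x \<in> S")
    case False
    then have "\<psi> (x + h k *\<^sub>R b) = 0" "\<psi> x = 0" using outS[of x "h k"] h[of k] supp by auto
    then show ?thesis using False by (simp add: D_def)
  next
    case True
    have "\<exists>z>0. z < h k \<and> \<psi> (x + h k *\<^sub>R b) - \<psi> (x + 0 *\<^sub>R b) = (h k - 0) * partial b \<psi> (x + z *\<^sub>R b)"
      by (rule MVT2[where f="\<lambda>s. \<psi> (x + s *\<^sub>R b)", OF h(1)[of k]]) (rule DERIV_along_line[OF diff])
    then obtain z where "\<psi> (x + h k *\<^sub>R b) - \<psi> x = h k * partial b \<psi> (x + z *\<^sub>R b)" by auto
    then have "D k x = partial b \<psi> (x + z *\<^sub>R b)" using h(1)[of k] by (simp add: D_def)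
    then show ?thesis using B True by simp
  qed
  have Dm: "D k \<in> borel_measurable lborel" for k
  proof -
    have "integrable lborel (D k)" unfolding D_def[abs_def] using shift(1)[of "h k *\<^sub>R b"] i\<psi> by simp
    then show ?thesis by (rule borel_measurable_integrable)
  qed
  have "integrable lborel (\<lambda>x. B * indicator S x)"
    using int_S[of "\<lambda>_. B"] by (simp add: mult.commute)
  then have "(\<lambda>k. \<integral>x. D k x \<partial>lborel) \<longlonglongrightarrow> (\<integral>x. partial b \<psi> x \<partial>lborel)"
    by (intro integral_dominated_convergence[where w="\<lambda>x. B * indicator S x"])
       (use borel_measurable_integrable[OF id] Dm lim bound in auto)
  then show "(\<integral>x. partial b \<psi> x \<partial>lborel) = 0" unfolding D0 by (simp add: LIMSEQ_const_iff)
qed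

lemma integral_laplacian_eq_0:
  fixes \<phi> :: "'a::euclidean_space \<Rightarrow> real"
  assumes C2: "Ck_on 2 UNIV \<phi>" and supp: "\<And>x. norm x > R \<Longrightarrow> \<phi> x = 0"
  shows "integrable lborel (laplacian \<phi>)" "(\<integral>x. laplacian \<phi> x \<partial>lborel) = 0"
proof -
  have "open {x::'a. norm x > R}" by (intro open_Collect_less continuous_intros)
  then have s: "partial b \<phi> x = 0" if "norm x > R" for b x
  proof -
    have "partial b \<phi> x = partial b (\<lambda>_. 0) x"
      by (rule partial_cong[OF \<open>open _\<close>]) (use that supp in auto)
    also have "\<dots> = 0" by (rule partial_eqI[of _ "\<lambda>_. 0"]) simp
    finally show ?thesis .
  qed
  have i: "integrable lborel (partial b (partial b \<phi>))" "(\<integral>x. partial b (partial b \<phi>) x \<partial>lborel) = 0"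
    if "b \<in> Basis" for b
    by (rule integral_partial_eq_0[where R=R]; use C2 that s in \<open>auto simp: numeral_2_eq_2\<close>)+
  show "integrable lborel (laplacian \<phi>)" unfolding laplacian_def[abs_def] using i by simp
  show "(\<integral>x. laplacian \<phi> x \<partial>lborel) = 0" unfolding laplacian_def using i by simp
qed

text \<open>Polar coordinates without surface measure: the image under the norm of Lebesgue measure
  on the ball and the measure with density \<open>sphere_area n * r ^ (n - 1)\<close> give the same
  mass to all half-lines, by the volume formula for balls, and are therefore equal.\<close>

lemma integral_radial:
  fixes k :: "real \<Rightarrow> real"
  assumes R: "R \<ge> 0" and k: "k \<in> borel_measurable borel"
  defines "n \<equiv> DIM('a::euclidean_space)"
  shows "(\<integral>x. indicator (cball (0::'a) R) x * k (norm x) \<partial>lborel)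
     = (\<integral>r. indicator {0..R} r * (sphere_area n * r ^ (n - 1) * k r) \<partial>lborel)"
proof -
  define V where "V = unit_ball_vol (real n)"
  have V: "V \<ge> 0" by (simp add: V_def)
  have n: "n > 0" by (simp add: n_def)
  define M0 where "M0 = density lborel (\<lambda>x::'a. ennreal (indicator (cball 0 R) x))"
  define M where "M = distr M0 borel norm"
  define N where "N = density lborel (\<lambda>r. ennreal (indicator {0..R} r * (sphere_area n * r ^ (n - 1))))"
  have mI: "indicat_real (cball (0::'a) R) \<in> borel_measurable borel"
    by (intro borel_measurable_indicator borel_closed closed_cball)
  have EM: "emeasure M {x<..} = emeasure lborel (cball (0::'a) R \<inter> {y. x < norm y})" for x
  proof -
    have "emeasure M {x<..} = emeasure M0 (norm -` {x<..} \<inter> space M0)"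
      unfolding M_def by (rule emeasure_distr) (simp_all add: M0_def)
    also have "norm -` {x<..} \<inter> space M0 = {y::'a. x < norm y}" by (auto simp: M0_def)
    also have "emeasure M0 {y::'a. x < norm y} = (\<integral>\<^sup>+y. ennreal (indicator (cball 0 R) y) * indicator {y::'a. x < norm y} y \<partial>lborel)"
      unfolding M0_def by (rule emeasure_density) (simp_all add: mI)
    also have "\<dots> = (\<integral>\<^sup>+y. indicator (cball (0::'a) R \<inter> {y. x < norm y}) y \<partial>lborel)"
      by (intro nn_integral_cong) (simp split: split_indicator)
    finally show ?thesis by simp
  qed
  have EN: "emeasure N {x<..} = ennreal (if x > R then 0 else V * R ^ n - V * max x 0 ^ n)" for x
  proof -
    have "emeasure N {x<..} = (\<integral>\<^sup>+r. ennreal (indicator {0..R} r * (sphere_area n * r ^ (n - 1))) * indicator {x<..} r \<partial>lborel)"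
      unfolding N_def by (rule emeasure_density) simp_all
    also have "\<dots> = (\<integral>\<^sup>+r. ennreal (sphere_area n * r ^ (n - 1)) * indicator {max x 0..R} r \<partial>lborel)"
    proof (rule nn_integral_cong_AE)
      show "AE r in lborel. ennreal (indicator {0..R} r * (sphere_area n * r ^ (n - 1))) * indicator {x<..} r
          = ennreal (sphere_area n * r ^ (n - 1)) * indicator {max x 0..R} r"
        using AE_lborel_singleton[of x] by eventually_elim (auto split: split_indicator)
    qed
    also have "\<dots> = ennreal (if x > R then 0 else V * R ^ n - V * max x 0 ^ n)"
    proof (cases "x > R")
      case True
      then have "{max x 0..R} = {}" by auto
      then show ?thesis using True by simp
    next
      case False
      have "(\<integral>\<^sup>+r. ennreal (sphere_area n * r ^ (n - 1)) * indicator {max x 0..R} r \<partial>lborel) = V * R ^ n - V * max x 0 ^ n"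
      proof (rule nn_integral_FTC_Icc)
        show "((\<lambda>r. V * r ^ n) has_real_derivative sphere_area n * r ^ (n - 1)) (at r)" for r
          by (auto intro!: derivative_eq_intros simp: sphere_area_def V_def)
        show "0 \<le> sphere_area n * r ^ (n - 1)" if "r \<in> {max x 0..R}" for r
          using that by (simp add: sphere_area_def)
      qed (use False R in auto)
      then show ?thesis using False by simp
    qed
    finally show ?thesis .
  qed
  have "M = N"
  proof (rule measure_eqI_lessThan)
    show "sets M = sets borel" "sets N = sets borel" by (simp_all add: M_def N_def)
    have fin: "emeasure lborel (cball (0::'a) R) < \<infinity>" using emeasure_bounded_finite bounded_cball by blast
    show "emeasure M {x<..} < \<infinity>" for x
      unfolding EM by (rule le_less_trans[OF emeasure_mono fin]) auto
    show "emeasure M {x<..} = emeasure N {x<..}" for x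
    proof (cases "x > R")
      case True
      then have "cball (0::'a) R \<inter> {y. x < norm y} = {}" by auto
      then show ?thesis unfolding EM EN using True by simp
    next
      case False
      have ball_R: "emeasure lborel (cball (0::'a) R) = ennreal (V * R ^ n)"
        using emeasure_cball[of R "0::'a"] R by (simp add: V_def n_def)
      show ?thesis
      proof (cases "x < 0")
        case True
        then have "cball (0::'a) R \<inter> {y. x < norm y} = cball 0 R" by (auto intro: less_le_trans[OF True])
        then show ?thesis unfolding EM EN using False True n ball_R by (simp add: max_def zero_power)
      next
        case x0: False
        have eq: "cball (0::'a) R \<inter> {y. x < norm y} = cball 0 R - cball 0 x" by auto
        have "emeasure lborel (cball (0::'a) x) < \<infinity>" using emeasure_bounded_finite bounded_cball by blast
        then have ne: "emeasure lborel (cball (0::'a) x) \<noteq> \<infinity>" by simp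
        have "emeasure M {x<..} = emeasure lborel (cball (0::'a) R) - emeasure lborel (cball (0::'a) x)"
          unfolding EM eq by (rule emeasure_Diff[OF ne]) (use False in auto)
        also have "\<dots> = ennreal (V * R ^ n) - ennreal (V * x ^ n)"
          using emeasure_cball[of x "0::'a"] x0 ball_R by (simp add: V_def n_def)
        also have "\<dots> = ennreal (V * R ^ n - V * x ^ n)" using V x0 by (intro ennreal_minus) simp
        finally show ?thesis unfolding EN using False x0 by (simp add: max_def)
      qed
    qed
  qed
  have "(\<integral>x. indicator (cball (0::'a) R) x * k (norm x) \<partial>lborel) = (\<integral>x. k (norm x) \<partial>M0)"
    unfolding M0_def using k by (subst integral_density) (auto simp: mI)
  also have "\<dots> = (\<integral>r. k r \<partial>M)"
    unfolding M_def using k by (subst integral_distr) (auto simp: M0_def)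
  also have "\<dots> = (\<integral>r. k r \<partial>N)" unfolding \<open>M = N\<close> ..
  also have "\<dots> = (\<integral>r. indicator {0..R} r * (sphere_area n * r ^ (n - 1)) * k r \<partial>lborel)"
    unfolding N_def using k
    by (subst integral_density) (auto simp: sphere_area_def split: split_indicator)
  finally show ?thesis by (simp add: mult.assoc)
qed

section \<open>The Green function with pole at the origin\<close>

lemma compact_superlevel_set:
  fixes h :: "'a::euclidean_space \<Rightarrow> real"
  assumes A: "compact A" and h: "continuous_on A h"
  shows "compact {x \<in> A. c \<le> h x}"
proof -
  have "closed (A \<inter> h -` {c..})"
    by (rule continuous_closed_preimage[OF h compact_imp_closed[OF A] closed_atLeast])
  then have "compact (A \<inter> (A \<inter> h -` {c..}))" by (rule compact_Int_closed[OF A])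
  moreover have "A \<inter> (A \<inter> h -` {c..}) = {x \<in> A. c \<le> h x}" by auto
  ultimately show ?thesis by simp
qed

lemma Ck_on_scale: "open S \<Longrightarrow> Ck_on k S u \<Longrightarrow> Ck_on k S (\<lambda>x. c * u x)"
  using Ck_on_mult[of S k "\<lambda>_. c" u] by simp

lemma antiderivative_exists:
  fixes h :: "real \<Rightarrow> real"
  assumes "\<And>t. isCont h t"
  obtains A where "\<And>t. (A has_real_derivative h t) (at t)" "A c = d"
proof -
  obtain A where A: "\<And>t. (A has_real_derivative h t) (at t)"
    using einterval_antiderivative[of "-\<infinity>" "\<infinity>" h] assms
    by (auto simp: has_real_derivative_iff_has_vector_derivative)
  have "((\<lambda>t. A t + (d - A c)) has_real_derivative h t) (at t)" for t
    using DERIV_add[OF A[of t] DERIV_const[of "d - A c"]] by simp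
  then show thesis using that[of "\<lambda>t. A t + (d - A c)"] by simp
qed

lemma Ck_on_isCont: "Ck_on 0 UNIV h \<Longrightarrow> isCont h t"
  using continuous_on_eq_continuous_at[OF open_UNIV, of h] by simp

lemma Ck_on_dilation:
  assumes "\<And>k. Ck_on k UNIV (h :: real \<Rightarrow> real)"
  shows "Ck_on k UNIV (\<lambda>t. h (t / c))"
proof -
  have "Ck_on k UNIV (\<lambda>t::real. t / c)"
    using Ck_on_inner_right[of k UNIV "1 / c"] unfolding inner_real_def times_divide_eq_right mult_1_right .
  then show ?thesis by (rule Ck_on_compose[OF open_UNIV open_UNIV assms]) simp
qed

text \<open>A mollified fundamental solution: as a function of \<open>t = |x|\<^sup>2\<close> it agrees with \<open>|x|\<^sup>2\<^sup>-\<^sup>n\<close> for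
  \<open>t \<ge> s\<close>, and its Laplacian \<open>4 t F'' + 2 n F'\<close> is concentrated in \<open>s / 2 \<le> t \<le> s\<close>.\<close>

lemma mollified_power_exists:
  fixes s a :: real
  assumes s: "s > 0" and a: "a > 0"
    and \<sigma>: "\<And>k. Ck_on k UNIV \<sigma>" "\<And>t. (\<sigma> has_real_derivative \<sigma>' t) (at t)"
      "\<And>t. 0 \<le> \<sigma> t" "\<And>t. t \<le> 1/2 \<Longrightarrow> \<sigma> t = 0" "\<And>t. t \<ge> 1 \<Longrightarrow> \<sigma> t = 1" "\<And>t. t \<le> 1/2 \<Longrightarrow> \<sigma>' t = 0"
  shows "\<exists>F p p'. (\<forall>k. Ck_on k UNIV F) \<and> (\<forall>t. (F has_real_derivative p t) (at t)) \<and>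
    (\<forall>t. (p has_real_derivative p' t) (at t)) \<and>
    (\<forall>t\<ge>s. F t = t powr (- a)) \<and> (\<forall>t\<le>s. s powr (- a) \<le> F t) \<and>
    (\<forall>t\<ge>0. 4 * t * p' t + 4 * (a + 1) * p t = - (4 * a * t powr (- a) * (\<sigma>' (t / s) / s)))"
proof -
  \<comment> \<open>The derivative of t^(-a), switched off smoothly below s. The operator 4 t d/dt +
    4 (a + 1) annihilates t^(-a-1), so only the term containing \<open>\<sigma>'\<close> survives in
    the last claim.\<close>
  define p where "p t = - a * (t powr (- a - 1) * \<sigma> (t / s))" for t
  define p' where "p' t = - a * ((- a - 1) * t powr (- a - 2) * \<sigma> (t / s) + t powr (- a - 1) * (\<sigma>' (t / s) / s))" for t
  have z: "\<sigma> (t / s) = 0" "\<sigma>' (t / s) = 0" if "t < s / 2" for t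
    using \<sigma>(4,6)[of "t / s"] that s by (simp_all add: field_simps)
  have dp: "(p has_real_derivative p' t) (at t)" for t
  proof (cases "t > 0")
    case True
    have "((\<lambda>t. \<sigma> (t / s)) has_real_derivative \<sigma>' (t / s) * (1 / s)) (at t)"
      by (rule DERIV_chain2[OF \<sigma>(2)]) (use s in \<open>auto intro!: derivative_eq_intros\<close>)
    from DERIV_mult[OF has_real_derivative_powr[OF True, of "- a - 1"] this]
    have "((\<lambda>t. t powr (- a - 1) * \<sigma> (t / s)) has_real_derivative
        (- a - 1) * t powr (- a - 2) * \<sigma> (t / s) + t powr (- a - 1) * (\<sigma>' (t / s) / s)) (at t)"
      by (rule DERIV_cong) (simp add: algebra_simps)
    from DERIV_cmult[OF this, of "- a"] show ?thesis unfolding p_def[abs_def] p'_def .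
  next
    case False
    \<comment> \<open>Near a nonpositive t the factor \<open>\<sigma>\<close> vanishes, so the
      values of \<open>powr\<close> at nonpositive arguments do not enter.\<close>
    have "((\<lambda>_. 0) has_real_derivative 0) (at t)" by simp
    then have "(p has_real_derivative 0) (at t)"
      by (rule has_field_derivative_transform_within_open[where S="{..<s/2}"])
         (use z False s in \<open>auto simp: p_def\<close>)
    moreover have "p' t = 0" using z[of t] False s by (simp add: p'_def)
    ultimately show ?thesis by simp
  qed
  have Cp: "Ck_on k UNIV p" for k
  proof -
    have "Ck_on k {0<..} p"
    proof -
      have "Ck_on k UNIV (\<lambda>t. \<sigma> (t / s))" by (rule Ck_on_dilation[OF \<sigma>(1)])
      then have "Ck_on k {0<..} (\<lambda>t. \<sigma> (t / s))" by (rule Ck_on_subset) simp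
      then show ?thesis unfolding p_def[abs_def]
        by (intro Ck_on_scale Ck_on_mult Ck_on_powr) auto
    qed
    moreover have "Ck_on k {..<s/2} p"
      by (rule Ck_on_cong[of _ "\<lambda>_. 0"]) (use z in \<open>auto simp: p_def\<close>)
    ultimately have "Ck_on k ({0<..} \<union> {..<s/2}) p" by (intro Ck_on_Un) auto
    moreover have "{0<..} \<union> {..<s/2} = UNIV" using s by auto
    ultimately show ?thesis by simp
  qed
  obtain F where F: "\<And>t. (F has_real_derivative p t) (at t)" "F s = s powr (- a)"
    using antiderivative_exists[of p s "s powr (- a)"] Ck_on_isCont[OF Cp] by blast
  show ?thesis
  proof (rule exI[of _ F], rule exI[of _ p], rule exI[of _ p'], intro conjI allI impI)
    show "Ck_on k UNIV F" for k
      by (rule Ck_on_Suc_imp, rule Ck_on_antiderivative[OF open_UNIV F(1) Cp])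
    show "(F has_real_derivative p t) (at t)" for t by (rule F(1))
    show "(p has_real_derivative p' t) (at t)" for t by (rule dp)
    show "F t = t powr (- a)" if t: "t \<ge> s" for t
    proof -
      define D where "D t = F t - t powr (- a)" for t
      have d: "(D has_real_derivative 0) (at x)" if "x \<ge> s" for x
      proof -
        have "x > 0" using that s by simp
        from DERIV_diff[OF F(1) has_real_derivative_powr[OF this, of "- a"]]
        show ?thesis unfolding D_def[abs_def]
          by (rule DERIV_cong) (use \<sigma>(5)[of "x / s"] that s in \<open>simp add: p_def\<close>)
      qed
      have "D t \<le> D s" by (rule DERIV_nonpos_imp_nonincreasing[OF t]) (use d in blast)
      moreover have "D s \<le> D t" by (rule DERIV_nonneg_imp_nondecreasing[OF t]) (use d in blast)
      ultimately show ?thesis using F(2) by (simp add: D_def)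
    qed
    show "s powr (- a) \<le> F t" if "t \<le> s" for t
    proof -
      have "p x \<le> 0" for x using a \<sigma>(3)[of "x / s"] by (simp add: p_def)
      then have "F s \<le> F t" by (intro DERIV_nonpos_imp_nonincreasing[OF that]) (use F(1) in blast)
      then show ?thesis using F(2) by simp
    qed
    show "4 * t * p' t + 4 * (a + 1) * p t = - (4 * a * t powr (- a) * (\<sigma>' (t / s) / s))" if "t \<ge> 0" for t
    proof (cases "t = 0")
      case True
      then show ?thesis using a by (simp add: p_def)
    next
      case False
      then have t: "t > 0" using that by simp
      have e: "t powr (- a - 2) * t = t powr (- a - 1)" "t powr (- a - 1) * t = t powr (- a)"
        using t by (simp_all add: powr_diff power2_eq_square)
      have "4 * t * p' t + 4 * (a + 1) * p t
          = - a * (4 * (- a - 1) * (t powr (- a - 2) * t) * \<sigma> (t / s) + 4 * (t powr (- a - 1) * t) * (\<sigma>' (t / s) / s))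
            - 4 * (a + 1) * (a * (t powr (- a - 1) * \<sigma> (t / s)))"
        by (simp add: p_def p'_def algebra_simps)
      also have "\<dots> = - (4 * a * t powr (- a) * (\<sigma>' (t / s) / s))" unfolding e by (simp add: algebra_simps)
      finally show ?thesis .
    qed
  qed
qed

text \<open>The test function is \<open>H \<circ> \<Gamma>\<close>, where \<open>\<Gamma>\<close> is the Green function with pole \<open>x0\<close> obtained by Kelvin
  reflection, mollified near \<open>x0\<close>, and \<open>H\<close> is a convex cut-off that vanishes near \<open>0\<close>. Its Laplacian
  is \<open>\<eta> + B\<close>, where \<open>\<eta> \<le> 0\<close> lives near \<open>x0\<close>, \<open>B \<ge> 0\<close> lives near the boundary, and the two have opposite
  integrals.\<close>

lemma green_function_value:
  fixes G :: "'a::euclidean_space \<Rightarrow> 'a \<Rightarrow> real"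
  assumes green: "green_function (ball 0 1) G" and dim: "DIM('a) \<ge> 3"
    and x0: "x0 \<noteq> 0" "norm x0 < 1"
  shows "(real DIM('a) - 2) * sphere_area DIM('a) * G x0 0 = 1 - 1 / norm x0 ^ (DIM('a) - 2)"
proof -
  define n where "n = DIM('a)"
  define a where "a = (real n - 2) / 2"
  define m where "m = (real n - 2) * sphere_area n"
  define g where "g x = G x 0" for x
  have n3: "n \<ge> 3" and a: "a > 0" "4 * (a + 1) = 2 * real n" using dim by (auto simp: n_def a_def field_simps)
  have m: "m > 0" using n3 by (simp add: m_def sphere_area_def)
  have g: "continuous_on (cball 0 1 - {0}) g" "\<And>x. norm x = 1 \<Longrightarrow> g x = 0"
    "set_integrable lborel (ball 0 1) g"
    "\<And>\<phi>. test_function (ball 0 1) \<phi> \<Longrightarrow> (LINT x:ball 0 1|lborel. g x * laplacian \<phi> x) = \<phi> 0"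
    using green unfolding green_function_def g_def by auto
  obtain \<sigma> \<sigma>' :: "real \<Rightarrow> real" where \<sigma>: "\<And>k. Ck_on k UNIV \<sigma>" "\<And>k. Ck_on k UNIV \<sigma>'"
    "\<And>t. (\<sigma> has_real_derivative \<sigma>' t) (at t)"
    "\<And>t. \<sigma>' t \<ge> 0" "\<And>t. t \<le> 1/2 \<Longrightarrow> \<sigma> t = 0" "\<And>t. t \<ge> 1 \<Longrightarrow> \<sigma> t = 1"
    "\<And>t. t \<le> 1/2 \<Longrightarrow> \<sigma>' t = 0" "\<And>t. t \<ge> 1 \<Longrightarrow> \<sigma>' t = 0" "\<And>t. 0 \<le> \<sigma> t" "\<And>t. \<sigma> t \<le> 1"
    by (fact smooth_step_exists)
  define Gam0 where "Gam0 = 1 / norm x0 ^ (n - 2) - 1"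
  \<comment> \<open>Testing with \<open>\<phi>\<close> gives \<open>\<phi> 0\<close> up to the
    following errors: g is within e of \<open>g x0\<close> on the support of \<open>\<eta>\<close>,
    and |g| < e on the support of \<open>B\<close>. Each of the two has total mass m in absolute
    value, whence 2 e m; the cut-off changes the value at 0 by at most e.\<close>
  have main: "\<bar>Gam0 + m * g x0\<bar> \<le> e + 2 * e * m" if e: "e > 0" for e
  proof -
    define r where "r = (1 - norm x0)"
    have r0: "r > 0" using x0 by (simp add: r_def)
    have opn: "open (ball (0::'a) 1 - {0})" by auto
    have "continuous_on (ball 0 1 - {0}) g" by (rule continuous_on_subset[OF g(1)]) auto
    then have "\<forall>x\<in>ball 0 1 - {0}. isCont g x" using continuous_on_eq_continuous_at[OF opn] by blast
    then have "isCont g x0" using x0 by auto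
    then obtain d0 where d0: "d0 > 0" "\<And>x. dist x x0 < d0 \<Longrightarrow> \<bar>g x - g x0\<bar> < e"
      using e unfolding continuous_at_eps_delta dist_real_def by blast
    \<comment> \<open>The mollified ball about \<open>x0\<close> must lie where g is within e of
      \<open>g x0\<close>, inside the unit ball, and away from the origin, so that the value of the
      test function at 0 is unaffected by the mollification.\<close>
    define \<epsilon> where "\<epsilon> = min d0 (min r (norm x0)) / 2"
    have eps: "\<epsilon> > 0" "\<epsilon> < d0" "\<epsilon> < r" "\<epsilon> < norm x0" using d0(1) r0 zero_less_norm_iff[of x0] x0
      unfolding \<epsilon>_def min_def by auto
    define s where "s = \<epsilon>\<^sup>2"
    have s: "s > 0" using eps by (simp add: s_def)
    have EX: "\<exists>F p p'. (\<forall>k. Ck_on k UNIV F) \<and> (\<forall>t. (F has_real_derivative p t) (at t)) \<and>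
        (\<forall>t. (p has_real_derivative p' t) (at t)) \<and>
        (\<forall>t\<ge>s. F t = t powr (- a)) \<and> (\<forall>t\<le>s. s powr (- a) \<le> F t) \<and>
        (\<forall>t\<ge>0. 4 * t * p' t + 4 * (a + 1) * p t = - (4 * a * t powr (- a) * (\<sigma>' (t / s) / s)))"
      by (rule mollified_power_exists[OF s a(1), where \<sigma>=\<sigma>]) (simp_all add: \<sigma>)
    obtain F p p' where FF: "(\<forall>k. Ck_on k UNIV F) \<and> (\<forall>t. (F has_real_derivative p t) (at t)) \<and>
        (\<forall>t. (p has_real_derivative p' t) (at t)) \<and>
        (\<forall>t\<ge>s. F t = t powr (- a)) \<and> (\<forall>t\<le>s. s powr (- a) \<le> F t) \<and>
        (\<forall>t\<ge>0. 4 * t * p' t + 4 * (a + 1) * p t = - (4 * a * t powr (- a) * (\<sigma>' (t / s) / s)))"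
      using EX by (elim exE)
    have F: "Ck_on k UNIV F" "(F has_real_derivative p t) (at t)" "(p has_real_derivative p' t) (at t)"
      "t \<ge> s \<Longrightarrow> F t = t powr (- a)" "t \<le> s \<Longrightarrow> s powr (- a) \<le> F t"
      "t \<ge> 0 \<Longrightarrow> 4 * t * p' t + 4 * (a + 1) * p t = - (4 * a * t powr (- a) * (\<sigma>' (t / s) / s))" for k t
      using FF by blast+
    \<comment> \<open>\<open>d\<close> is |x - x0|^2, and \<open>Q\<close> is | |x0| x - x0/|x0|
      |^2, the reflected counterpart. The two agree on the unit sphere, as \<open>Qd\<close> shows,
      so the difference of their powers vanishes there.\<close>
    define d where "d x = x0 \<bullet> x0 + x \<bullet> (- 2 *\<^sub>R x0) + 1 * (x \<bullet> x)" for x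
    define Q where "Q x = 1 + x \<bullet> (- 2 *\<^sub>R x0) + (x0 \<bullet> x0) * (x \<bullet> x)" for x
    have d_eq: "d x = (norm (x - x0))\<^sup>2" for x
      by (simp add: d_def power2_norm_eq_inner inner_diff algebra_simps inner_commute)
    have d_nonneg: "d x \<ge> 0" for x by (simp add: d_eq)
    have Qd: "Q x - d x = (1 - (norm x)\<^sup>2) * (1 - (norm x0)\<^sup>2)" for x
      by (simp add: Q_def d_def power2_norm_eq_inner algebra_simps)
    have Q_ge: "Q x \<ge> r\<^sup>2" if "norm x \<le> 1" for x
    proof -
      have "x \<bullet> x0 \<le> norm x * norm x0" by (rule norm_cauchy_schwarz)
      then have "(1 - norm x * norm x0)\<^sup>2 \<le> Q x"
        by (simp add: Q_def power2_norm_eq_inner[symmetric] power2_diff power_mult_distrib mult.commute)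
      moreover have "norm x * norm x0 \<le> 1 * norm x0" using that by (intro mult_right_mono) auto
      then have "r\<^sup>2 \<le> (1 - norm x * norm x0)\<^sup>2" using r0 by (intro power_mono) (auto simp: r_def)
      ultimately show ?thesis by simp
    qed
    have s_r: "s < r\<^sup>2" using eps by (simp add: s_def power_strict_mono)
    have Q_pos: "Q x > 0" "Q x > s" if "norm x \<le> 1" for x using Q_ge[OF that] s_r s by auto
    define Gam where "Gam x = F (d x) + - 1 * (Q x powr (- a))" for x
    have Gam_pos: "Gam x > 0" if x: "norm x < 1" for x
    proof (cases "d x \<ge> s")
      case True
      have "0 < (1 - (norm x)\<^sup>2) * (1 - (norm x0)\<^sup>2)"
        using x x0 by (intro mult_pos_pos) (auto simp: power_less_one_iff abs_square_less_1)
      then have "d x < Q x" using Qd[of x] by simp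
      then have "Q x powr (- a) < d x powr (- a)" using True s a by (intro powr_less_mono2_neg) auto
      then show ?thesis using F(4)[OF True] by (simp add: Gam_def)
    next
      case False
      have "Q x powr (- a) < s powr (- a)" using Q_pos(2)[of x] x s a by (intro powr_less_mono2_neg) auto
      also have "\<dots> \<le> F (d x)" using False by (intro F(5)) simp
      finally show ?thesis by (simp add: Gam_def)
    qed
    have Gam_bdry: "Gam x = 0" if x: "norm x = 1" for x
    proof -
      have "r \<le> norm (x - x0)" using norm_triangle_ineq2[of x x0] x by (simp add: r_def)
      then have "\<epsilon>\<^sup>2 \<le> (norm (x - x0))\<^sup>2" using eps by (intro power_mono) auto
      then have "d x \<ge> s" by (simp add: d_eq s_def)
      then show ?thesis using F(4) Qd[of x] x by (simp add: Gam_def)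
    qed
    have Gam_0: "Gam 0 = Gam0"
    proof -
      have "d 0 = (norm x0)\<^sup>2" by (simp add: d_eq)
      moreover have "s \<le> (norm x0)\<^sup>2" using eps by (simp add: s_def power_mono)
      moreover have "((norm x0)\<^sup>2) powr (- a) = 1 / norm x0 ^ (n - 2)"
      proof -
        have "((norm x0)\<^sup>2) powr (- a) = (norm x0 powr 2) powr (- a)" using x0 by simp
        also have "\<dots> = norm x0 powr (2 * - a)" by (rule powr_powr)
        also have "2 * - a = - real (n - 2)" using n3 by (simp add: a_def of_nat_diff field_simps)
        also have "norm x0 powr (- real (n - 2)) = 1 / norm x0 ^ (n - 2)" using x0 by (simp add: powr_minus powr_realpow divide_inverse)
        finally show ?thesis .
      qed
      ultimately show ?thesis using F(4) by (simp add: Gam_def Gam0_def Q_def)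
    qed
    have Cd: "Ck_on k S d" "Ck_on k S Q" if "open S" for k S
      unfolding d_def[abs_def] Q_def[abs_def] by (rule Ck_on_quadratic[OF that])+
    have CF: "Ck_on k S (\<lambda>x. F (d x))" if "open S" for k S
      by (rule Ck_on_compose[OF that open_UNIV F(1) Cd(1)[OF that]]) simp
    have CQ: "Ck_on k (ball 0 1) (\<lambda>x. - 1 * (Q x powr (- a)))" for k
    proof (rule Ck_on_scale)
      show "Ck_on k (ball 0 1) (\<lambda>x. Q x powr (- a))"
        by (rule Ck_on_compose[OF open_ball _ Ck_on_powr[of k "- a"] Cd(2)[OF open_ball]]) (use Q_pos in auto)
    qed simp
    have CG: "Ck_on k (ball 0 1) Gam" for k
      unfolding Gam_def[abs_def] by (intro Ck_on_add CF CQ open_ball)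
    have contG: "continuous_on (cball 0 1) Gam"
    proof -
      have cF: "continuous_on (cball 0 1) (\<lambda>x. F (d x))"
        using CF[OF open_UNIV, of 0] by (auto intro: continuous_on_subset)
      have "continuous_on (cball 0 1) Q"
        using Cd(2)[OF open_UNIV, of 0] by (auto intro: continuous_on_subset)
      then have cQ: "continuous_on (cball 0 1) (\<lambda>x. Q x powr (- a))"
        by (rule continuous_on_powr[OF _ continuous_on_const]) (use Q_pos(1) in force)
      show ?thesis unfolding Gam_def[abs_def]
        by (rule continuous_on_add[OF cF continuous_on_mult[OF continuous_on_const cQ]])
    qed
    define \<eta> where "\<eta> x = - (4 * a * d x powr (- a) * (\<sigma>' (d x / s) / s))" for x
    have \<eta>_nonpos: "\<eta> x \<le> 0" for x using a s \<sigma>(4)[of "d x / s"] by (simp add: \<eta>_def)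
    have \<eta>_supp: "dist x x0 < \<epsilon>" if "\<eta> x \<noteq> 0" for x
    proof (rule ccontr)
      assume "\<not> dist x x0 < \<epsilon>"
      then have "\<epsilon>\<^sup>2 \<le> (norm (x - x0))\<^sup>2" using eps by (intro power_mono) (auto simp: dist_norm)
      then have "1 \<le> d x / s" using s by (simp add: d_eq s_def)
      then show False using \<sigma>(8) that by (simp add: \<eta>_def)
    qed
    have lap_F: "laplacian (\<lambda>x. F (d x)) x = \<eta> x" for x
    proof -
      have "laplacian (\<lambda>x. F (d x)) x = p (d x) * laplacian d x + p' (d x) * (\<Sum>b\<in>Basis. (partial b d x)\<^sup>2)"
        by (rule laplacian_comp[OF open_UNIV UNIV_I Cd(1)[OF open_UNIV], where h=F and h'=p]) (rule F)+
      also have "laplacian d x = 2 * real n"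
        unfolding d_def[abs_def] n_def using laplacian_quadratic[of "x0 \<bullet> x0" "- 2 *\<^sub>R x0" 1 x] by simp
      also have "(\<Sum>b\<in>Basis. (partial b d x)\<^sup>2) = (\<Sum>b\<in>Basis. 4 * ((x - x0) \<bullet> b)\<^sup>2)"
      proof (rule sum.cong[OF refl])
        fix b :: 'a assume "b \<in> Basis"
        have "partial b d x = 2 * ((x - x0) \<bullet> b)"
          unfolding d_def[abs_def] partial_quadratic by (simp add: inner_diff_left inner_commute[of b])
        then show "(partial b d x)\<^sup>2 = 4 * ((x - x0) \<bullet> b)\<^sup>2" by (simp add: power_mult_distrib)
      qed
      also have "\<dots> = 4 * d x"
        unfolding d_eq power2_norm_eq_inner euclidean_inner[of "x - x0" "x - x0"] sum_distrib_left
        by (simp add: power2_eq_square)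
      finally have "laplacian (\<lambda>x. F (d x)) x = 4 * d x * p' (d x) + 4 * (a + 1) * p (d x)"
        unfolding a(2) by simp
      then show ?thesis using F(6)[OF d_nonneg] by (simp add: \<eta>_def)
    qed
    \<comment> \<open>\<open>Q\<close> satisfies |grad Q|^2 = 4 |x0|^2 Q and has Laplacian 2 n
      |x0|^2; with 4 (a + 1) = 2 n the two contributions to the Laplacian of Q^(-a) cancel.\<close>
    have lap_Q: "laplacian (\<lambda>x. - 1 * (Q x powr (- a))) x = 0" if x: "x \<in> ball 0 1" for x
    proof -
      have q: "Q x > 0" using Q_pos(1)[of x] x by simp
      have "laplacian (\<lambda>x. - 1 * (Q x powr (- a))) x = (a * Q x powr (- a - 1)) * laplacian Q x
          + (a * ((- a - 1) * Q x powr (- a - 1 - 1))) * (\<Sum>b\<in>Basis. (partial b Q x)\<^sup>2)"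
      proof (rule laplacian_comp[OF open_ball x Cd(2)[OF open_ball], where h="\<lambda>t. - 1 * t powr (- a)" and h'="\<lambda>t. a * t powr (- a - 1)"])
        show "((\<lambda>t. - 1 * t powr (- a)) has_real_derivative a * Q y powr (- a - 1)) (at (Q y))" if "y \<in> ball 0 1" for y
          using DERIV_cmult[OF has_real_derivative_powr[of "Q y" "- a"], of "- 1"] Q_pos(1)[of y] that by simp
        show "((\<lambda>t. a * t powr (- a - 1)) has_real_derivative a * ((- a - 1) * Q x powr (- a - 1 - 1))) (at (Q x))"
          by (rule DERIV_cmult[OF has_real_derivative_powr[OF q]])
      qed
      also have "laplacian Q x = 2 * (x0 \<bullet> x0) * n"
        unfolding Q_def[abs_def] n_def using laplacian_quadratic[of 1 "- 2 *\<^sub>R x0" "x0 \<bullet> x0" x] by simp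
      also have "(\<Sum>b\<in>Basis. (partial b Q x)\<^sup>2) = 4 * (x0 \<bullet> x0) * Q x"
      proof -
        define w where "w = (x0 \<bullet> x0) *\<^sub>R x - x0"
        have "(\<Sum>b\<in>Basis. (partial b Q x)\<^sup>2) = (\<Sum>b\<in>Basis. 4 * (w \<bullet> b)\<^sup>2)"
        proof (rule sum.cong[OF refl])
          fix b :: 'a assume "b \<in> Basis"
          have "partial b Q x = 2 * (w \<bullet> b)"
            unfolding Q_def[abs_def] partial_quadratic w_def by (simp add: inner_diff_left inner_commute[of b])
          then show "(partial b Q x)\<^sup>2 = 4 * (w \<bullet> b)\<^sup>2" by (simp add: power_mult_distrib)
        qed
        also have "\<dots> = 4 * (w \<bullet> w)"
          unfolding euclidean_inner[of w w] sum_distrib_left by (simp add: power2_eq_square)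
        also have "w \<bullet> w = (x0 \<bullet> x0) * Q x"
          by (simp add: w_def Q_def inner_diff algebra_simps inner_commute)
        finally show ?thesis by simp
      qed
      also have "(a * Q x powr (- a - 1)) * (2 * (x0 \<bullet> x0) * n)
          + (a * ((- a - 1) * Q x powr (- a - 1 - 1))) * (4 * (x0 \<bullet> x0) * Q x) = 0"
      proof -
        have "Q x powr (- a - 1 - 1) * Q x powr 1 = Q x powr (- a - 1 - 1 + 1)" by (rule powr_add[symmetric])
        moreover have "Q x powr 1 = Q x" using q by simp
        ultimately have e: "Q x powr (- a - 1 - 1) * Q x = Q x powr (- a - 1)" by (simp only: diff_add_cancel)
        have "(a * ((- a - 1) * Q x powr (- a - 1 - 1))) * (4 * (x0 \<bullet> x0) * Q x)
            = a * (- a - 1) * 4 * (x0 \<bullet> x0) * (Q x powr (- a - 1 - 1) * Q x)" by (simp only: mult_ac)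
        also have "\<dots> = - (a * (4 * (a + 1)) * (x0 \<bullet> x0) * Q x powr (- a - 1))"
          unfolding e by (simp add: algebra_simps)
        finally have "(a * ((- a - 1) * Q x powr (- a - 1 - 1))) * (4 * (x0 \<bullet> x0) * Q x)
            = - (a * (4 * (a + 1)) * (x0 \<bullet> x0) * Q x powr (- a - 1))" .
        then have e2: "(a * ((- a - 1) * Q x powr (- a - 1 - 1))) * (4 * (x0 \<bullet> x0) * Q x)
            = - (a * (2 * real n) * (x0 \<bullet> x0) * Q x powr (- a - 1))" unfolding a(2) .
        show ?thesis unfolding e2 by (simp only: mult_ac add.right_inverse)
      qed
      finally show ?thesis .
    qed
    have lap_G: "laplacian Gam x = \<eta> x" if x: "x \<in> ball 0 1" for x
      using laplacian_add[OF open_ball x CF[OF open_ball] CQ] lap_F[of x] lap_Q[OF x]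
      unfolding Gam_def[abs_def] by simp
    \<comment> \<open>Continuity up to the sphere and zero boundary values make |g| < e in a thin
      shell: the compact set where |g| \<ge> e, restricted to |x| \<ge> 1/2, attains its largest
      norm, which is below 1.\<close>
    obtain r1 where r1: "0 \<le> r1" "r1 < 1" "\<And>x::'a. r1 < norm x \<Longrightarrow> norm x < 1 \<Longrightarrow> \<bar>g x\<bar> < e"
    proof -
      define S where "S = {x \<in> cball 0 1 - ball 0 (1/2). e \<le> \<bar>g x\<bar>}"
      have cS: "compact (cball (0::'a) 1 - ball 0 (1/2))" by (intro compact_diff) auto
      have "continuous_on (cball 0 1 - ball 0 (1/2)) g" by (rule continuous_on_subset[OF g(1)]) auto
      then have "compact S" unfolding S_def by (intro compact_superlevel_set[OF cS] continuous_on_rabs)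
      show thesis
      proof (cases "S = {}")
        case True
        show thesis
        proof (rule that[of "1/2"])
          fix x :: 'a assume "1/2 < norm x" "norm x < 1"
          moreover have "x \<notin> S" using True by simp
          ultimately show "\<bar>g x\<bar> < e" by (simp add: S_def)
        qed simp_all
      next
        case False
        obtain z where z: "z \<in> S" "\<And>x. x \<in> S \<Longrightarrow> norm x \<le> norm z"
          using continuous_attains_sup[OF \<open>compact S\<close> False continuous_on_norm[OF continuous_on_id]] by blast
        have "norm z \<noteq> 1" using g(2)[of z] z(1) e by (auto simp: S_def)
        then have nz: "norm z < 1" "norm z \<ge> 1/2" using z(1) by (auto simp: S_def)
        show thesis
        proof (rule that[of "norm z"])
          fix x :: 'a assume x: "norm z < norm x" "norm x < 1"
          then have "x \<notin> S" using z(2)[of x] by auto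
          then show "\<bar>g x\<bar> < e" using x nz by (auto simp: S_def)
        qed (use nz in auto)
      qed
    qed
    \<comment> \<open>A compact set containing the support of \<open>\<eta>\<close> and everything
      inside the thin shell.\<close>
    define Cs where "Cs = cball x0 \<epsilon> \<union> cball 0 r1"
    have Cs_ball: "Cs \<subseteq> ball 0 1"
    proof
      fix x assume "x \<in> Cs"
      then consider "dist x0 x \<le> \<epsilon>" | "norm x \<le> r1" by (auto simp: Cs_def)
      then show "x \<in> ball 0 1"
      proof cases
        case 1
        have "norm x \<le> norm x0 + norm (x - x0)" using norm_triangle_sub[of x x0] by simp
        also have "\<dots> < 1" using 1 eps by (simp add: dist_norm norm_minus_commute r_def)
        finally show ?thesis by simp
      qed (use r1 in auto)
    qed
    have cCs: "continuous_on Cs Gam" by (rule continuous_on_subset[OF contG]) (use Cs_ball in auto)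
    have "compact Cs" "Cs \<noteq> {}" using r1(1) by (auto simp: Cs_def)
    then obtain xm where xm: "xm \<in> Cs" "\<And>x. x \<in> Cs \<Longrightarrow> Gam xm \<le> Gam x"
      using continuous_attains_inf[OF _ _ cCs] by blast
    have m0: "Gam xm > 0" using Gam_pos[of xm] Cs_ball xm(1) by auto
    \<comment> \<open>Below the minimum of \<open>Gam\<close> on \<open>Cs\<close>, so that the
      cut-off acts only inside the thin shell; at most e, so that it costs at most e at the
      origin.\<close>
    define \<delta> where "\<delta> = min e (Gam xm / 2)"
    have \<delta>: "\<delta> > 0" "\<delta> \<le> e" "\<And>x. x \<in> Cs \<Longrightarrow> \<delta> < Gam x"
    proof -
      show "\<delta> > 0" "\<delta> \<le> e" using e m0 by (simp_all add: \<delta>_def)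
      have "\<delta> < Gam xm" using m0 by (simp add: \<delta>_def min_def)
      then show "\<delta> < Gam x" if "x \<in> Cs" for x using xm(2)[OF that] by simp
    qed
    have ic: "isCont (\<lambda>t. \<sigma> (t / \<delta>)) t" for t by (rule Ck_on_isCont[OF Ck_on_dilation[OF \<sigma>(1)]])
    obtain H where H: "\<And>t. (H has_real_derivative \<sigma> (t / \<delta>)) (at t)" "H 0 = 0"
      using antiderivative_exists[OF ic, of 0 0] by blast
    have CH: "Ck_on k UNIV H" for k
      by (rule Ck_on_Suc_imp, rule Ck_on_antiderivative[OF open_UNIV H(1) Ck_on_dilation[OF \<sigma>(1)]])
    have H_zero: "H t = 0" if t: "0 \<le> t" "t \<le> \<delta> / 2" for t
    proof -
      have d: "(H has_real_derivative 0) (at x)" if "0 \<le> x" "x \<le> t" for x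
        using H(1)[of x] \<sigma>(5)[of "x / \<delta>"] that t \<delta>(1) by (simp add: field_simps)
      have "H t \<le> H 0" by (rule DERIV_nonpos_imp_nonincreasing[OF t(1)]) (use d in blast)
      moreover have "H 0 \<le> H t" by (rule DERIV_nonneg_imp_nondecreasing[OF t(1)]) (use d in blast)
      ultimately show ?thesis using H(2) by simp
    qed
    have H_near: "\<bar>H t - t\<bar> \<le> \<delta>" if t: "0 \<le> t" for t
    proof -
      have "H t - t \<le> H 0 - 0"
      proof (rule DERIV_nonpos_imp_nonincreasing[OF t, of "\<lambda>t. H t - t"])
        show "\<exists>y. ((\<lambda>t. H t - t) has_real_derivative y) (at x) \<and> y \<le> 0" for x
          using DERIV_diff[OF H(1)[of x] DERIV_ident] \<sigma>(10)[of "x / \<delta>"] by (intro exI[of _ "\<sigma> (x / \<delta>) - 1"]) simp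
      qed
      moreover have "H t - t \<ge> - \<delta>"
      proof (cases "t \<le> \<delta>")
        case True
        have "H 0 \<le> H t"
          by (rule DERIV_nonneg_imp_nondecreasing[OF t]) (use H(1) \<sigma>(9) in blast)
        then show ?thesis using True H(2) by simp
      next
        case False
        have "H \<delta> - \<delta> \<le> H t - t"
        proof (rule DERIV_nonneg_imp_nondecreasing[of \<delta> t "\<lambda>t. H t - t"])
          fix x assume "\<delta> \<le> x" "x \<le> t"
          then have "\<sigma> (x / \<delta>) = 1" using \<delta>(1) by (intro \<sigma>(6)) simp
          then show "\<exists>y. ((\<lambda>t. H t - t) has_real_derivative y) (at x) \<and> y \<ge> 0"
            using DERIV_diff[OF H(1)[of x] DERIV_ident] by (intro exI[of _ "\<sigma> (x / \<delta>) - 1"]) simp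
        qed (use False in simp)
        moreover have "H 0 \<le> H \<delta>"
          by (rule DERIV_nonneg_imp_nondecreasing) (use \<delta>(1) H(1) \<sigma>(9) in \<open>auto intro: less_imp_le\<close>)
        ultimately show ?thesis using H(2) by simp
      qed
      ultimately show ?thesis using H(2) by simp
    qed
    \<comment> \<open>\<open>H\<close> sends values of \<open>Gam\<close> in [0, \<delta>/2] to 0
      and \<open>Gam\<close> tends to 0 at the sphere, so \<open>\<phi>\<close> is supported in the
      compact set \<open>K\<close> and its extension by 0 is smooth.\<close>
    define \<phi> where "\<phi> x = (if x \<in> ball 0 1 then H (Gam x) else 0)" for x
    define K where "K = {x \<in> cball 0 1. \<delta> / 2 \<le> Gam x}"
    have cK: "compact K" unfolding K_def by (rule compact_superlevel_set[OF compact_cball contG])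
    have K_ball: "K \<subseteq> ball 0 1"
    proof
      fix x assume "x \<in> K"
      then have "norm x \<le> 1" "norm x \<noteq> 1" using Gam_bdry[of x] \<delta>(1) by (auto simp: K_def)
      then show "x \<in> ball 0 1" by simp
    qed
    have \<phi>_out: "\<phi> x = 0" if "x \<notin> K" for x
    proof (cases "x \<in> ball 0 1")
      case True
      then have "H (Gam x) = 0" using that Gam_pos[of x] by (intro H_zero) (auto simp: K_def)
      then show ?thesis by (simp add: \<phi>_def)
    qed (simp add: \<phi>_def)
    have oK: "open (- K)" using cK compact_imp_closed by blast
    have C\<phi>: "Ck_on k UNIV \<phi>" for k
    proof -
      have "Ck_on k (ball 0 1) \<phi>"
        by (rule Ck_on_cong[OF open_ball _ Ck_on_compose[OF open_ball open_UNIV CH CG]]) (auto simp: \<phi>_def)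
      moreover have "Ck_on k (- K) \<phi>"
        by (rule Ck_on_cong[OF oK, of "\<lambda>_. 0"]) (use \<phi>_out in auto)
      ultimately have "Ck_on k (ball 0 1 \<union> - K) \<phi>" using oK by (intro Ck_on_Un) auto
      moreover have "ball 0 1 \<union> - K = UNIV" using K_ball by auto
      ultimately show ?thesis by simp
    qed
    have test: "test_function (ball 0 1) \<phi>"
      unfolding test_function_def using C\<phi> cK K_ball \<phi>_out by blast
    define B where "B x = \<sigma>' (Gam x / \<delta>) / \<delta> * (\<Sum>b\<in>Basis. (partial b Gam x)\<^sup>2)" for x
    have B_nonneg: "B x \<ge> 0" for x unfolding B_def using \<sigma>(4) \<delta>(1) by (intro mult_nonneg_nonneg sum_nonneg) auto
    have B_supp: "\<bar>g x\<bar> < e" if "x \<in> ball 0 1" "B x \<noteq> 0" for x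
    proof -
      have "\<sigma>' (Gam x / \<delta>) \<noteq> 0" using that by (auto simp: B_def)
      then have "Gam x / \<delta> < 1" using \<sigma>(8) not_le by blast
      then have "Gam x < \<delta>" using \<delta>(1) by simp
      then have "x \<notin> Cs" using \<delta>(3)[of x] by auto
      then show ?thesis using r1(3)[of x] that by (simp add: Cs_def)
    qed
    have lap_in: "laplacian \<phi> x = \<eta> x + B x" if x: "x \<in> ball 0 1" for x
    proof -
      have "laplacian \<phi> x = laplacian (\<lambda>x. H (Gam x)) x"
        by (rule laplacian_cong[OF open_ball x]) (simp add: \<phi>_def)
      also have "\<dots> = \<sigma> (Gam x / \<delta>) * laplacian Gam x + \<sigma>' (Gam x / \<delta>) / \<delta> * (\<Sum>b\<in>Basis. (partial b Gam x)\<^sup>2)"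
      proof (rule laplacian_comp[OF open_ball x CG, where h=H and h'="\<lambda>t. \<sigma> (t / \<delta>)"])
        show "((\<lambda>t. \<sigma> (t / \<delta>)) has_real_derivative \<sigma>' (Gam x / \<delta>) / \<delta>) (at (Gam x))"
        proof -
          have "((\<lambda>t. t / \<delta>) has_real_derivative 1 / \<delta>) (at (Gam x))"
            by (rule DERIV_cdivide[OF DERIV_ident])
          from DERIV_chain2[OF \<sigma>(3) this] show ?thesis by simp
        qed
      qed (rule H(1))
      also have "\<sigma> (Gam x / \<delta>) * laplacian Gam x = \<eta> x"
      proof (cases "\<eta> x = 0")
        case False
        then have "x \<in> Cs" using \<eta>_supp[OF False] by (simp add: Cs_def dist_commute)
        then have "\<sigma> (Gam x / \<delta>) = 1" using \<delta>(1) \<delta>(3)[of x] by (intro \<sigma>(6)) simp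
        then show ?thesis using lap_G[OF x] by simp
      qed (use lap_G[OF x] in simp)
      finally show ?thesis by (simp add: B_def)
    qed
    have lap_out: "laplacian \<phi> x = 0" if "x \<notin> ball 0 1" for x
    proof -
      have "laplacian \<phi> x = laplacian (\<lambda>x. 0 + x \<bullet> 0 + 0 * (x \<bullet> x)) x"
        by (rule laplacian_cong[OF oK]) (use that K_ball \<phi>_out in auto)
      also have "\<dots> = 0" using laplacian_quadratic[of 0 0 0 x] by simp
      finally show ?thesis .
    qed
    have lap_int: "integrable lborel (laplacian \<phi>)" "(\<integral>x. laplacian \<phi> x \<partial>lborel) = 0"
      by (rule integral_laplacian_eq_0[where R=1]; use C\<phi> \<phi>_out K_ball in force)+
    \<comment> \<open>Radial profile of \<open>\<eta>\<close> about \<open>x0\<close>. In polar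
      coordinates t^(n-1) t^(-2a) = t, so the integrand is exactly the derivative of - m
      \<open>\<sigma>\<close> (t^2 / s), and the mass is - m however small \<open>\<epsilon>\<close>
      is.\<close>
    define k where "k t = - (4 * a * t powr (- (2 * a)) * (\<sigma>' (t\<^sup>2 / s) / s))" for t
    have \<sigma>'_meas: "\<sigma>' \<in> borel_measurable borel"
      using \<sigma>(2)[of 0] by (intro borel_measurable_continuous_onI) simp
    have k_meas: "k \<in> borel_measurable borel"
      unfolding k_def[abs_def] using \<sigma>'_meas by measurable
    have \<eta>k: "\<eta> x = indicator (cball 0 \<epsilon>) (x - x0) * k (norm (x - x0))" for x
    proof (cases "x - x0 \<in> cball 0 \<epsilon>")
      case True
      have "d x powr (- a) = norm (x - x0) powr (- (2 * a))"
      proof (cases "x = x0")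
        case False
        then have "d x = norm (x - x0) powr 2" by (simp add: d_eq)
        then have "d x powr (- a) = norm (x - x0) powr (2 * - a)" by (simp only: powr_powr)
        then show ?thesis by simp
      qed (simp add: d_eq)
      then show ?thesis using True by (simp add: \<eta>_def k_def d_eq)
    next
      case False
      then have "\<not> dist x x0 < \<epsilon>" by (simp add: dist_norm norm_minus_commute)
      then have "\<eta> x = 0" using \<eta>_supp[of x] by blast
      then show ?thesis using False by simp
    qed
    have \<eta>_int: "integrable lborel \<eta>" "(\<integral>x. \<eta> x \<partial>lborel) = - m"
    proof -
      have c\<eta>: "continuous_on UNIV \<eta>"
      proof -
        have C2: "Ck_on 2 UNIV (\<lambda>x. F (d x))" by (rule CF) simp
        have "continuous_on UNIV (laplacian (\<lambda>x. F (d x)))"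
          unfolding laplacian_def[abs_def] using C2 by (intro continuous_on_sum) (auto simp: numeral_2_eq_2)
        moreover have "laplacian (\<lambda>x. F (d x)) = \<eta>" using lap_F by auto
        ultimately show ?thesis by simp
      qed
      have "(\<lambda>x. indicator (cball x0 \<epsilon>) x *\<^sub>R \<eta> x) = \<eta>"
      proof
        show "indicator (cball x0 \<epsilon>) x *\<^sub>R \<eta> x = \<eta> x" for x
          using \<eta>_supp[of x] by (cases "\<eta> x = 0") (auto simp: dist_commute)
      qed
      moreover have "integrable lborel (\<lambda>x. indicator (cball x0 \<epsilon>) x *\<^sub>R \<eta> x)"
        by (rule borel_integrable_compact) (use continuous_on_subset[OF c\<eta>] in auto)
      ultimately show "integrable lborel \<eta>" by simp
      define w where "w y = indicator (cball (0::'a) \<epsilon>) y * k (norm y)" for y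
      have bw: "w \<in> borel_measurable borel"
        unfolding w_def[abs_def] using k_meas
        by (intro borel_measurable_times borel_measurable_indicator borel_closed closed_cball measurable_compose[OF _ k_meas]) simp
      have "(\<integral>x. \<eta> x \<partial>lborel) = (\<integral>x. w (- x0 + x) \<partial>lborel)" unfolding \<eta>k w_def by simp
      also have "\<dots> = (\<integral>x. w x \<partial>distr lborel borel ((+) (- x0)))"
        by (rule integral_distr[symmetric]) (use bw in auto)
      also have "\<dots> = (\<integral>x. w x \<partial>lborel)" unfolding lborel_distr_plus ..
      also have "\<dots> = (\<integral>t. indicator {0..\<epsilon>} t * (sphere_area n * t ^ (n - 1) * k t) \<partial>lborel)"
        unfolding w_def n_def using eps(1) by (intro integral_radial k_meas) simp
      also have "\<dots> = (\<integral>t. indicator {0..\<epsilon>} t *\<^sub>R (- (m * (\<sigma>' (t\<^sup>2 / s) * (2 * t / s)))) \<partial>lborel)"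
      proof (rule Bochner_Integration.integral_cong[OF refl])
        fix t :: real
        show "indicator {0..\<epsilon>} t * (sphere_area n * t ^ (n - 1) * k t) = indicator {0..\<epsilon>} t *\<^sub>R (- (m * (\<sigma>' (t\<^sup>2 / s) * (2 * t / s))))"
        proof (cases "t > 0")
          case True
          have "t ^ (n - 1) * t powr (- (2 * a)) = t powr (real (n - 1)) * t powr (- (2 * a))"
            using True by (simp add: powr_realpow)
          also have "\<dots> = t powr (real (n - 1) + - (2 * a))" by (rule powr_add[symmetric])
          also have "real (n - 1) + - (2 * a) = 1" using n3 by (simp add: a_def of_nat_diff field_simps)
          finally have "t ^ (n - 1) * t powr (- (2 * a)) = t" using True by simp
          then have "sphere_area n * t ^ (n - 1) * k t = - (sphere_area n * (4 * a) * t * (\<sigma>' (t\<^sup>2 / s) / s))"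
            by (simp add: k_def mult_ac)
          also have "\<dots> = - (m * (\<sigma>' (t\<^sup>2 / s) * (2 * t / s)))" using s by (simp add: m_def a_def field_simps)
          finally show ?thesis by simp
        next
          case False
          then show ?thesis using n3 by (cases "t = 0") auto
        qed
      qed
      also have "\<dots> = - (m * \<sigma> (\<epsilon>\<^sup>2 / s)) - - (m * \<sigma> (0\<^sup>2 / s))"
      proof (rule integral_FTC_Icc)
        show "((\<lambda>t. - (m * \<sigma> (t\<^sup>2 / s))) has_vector_derivative - (m * (\<sigma>' (t\<^sup>2 / s) * (2 * t / s)))) (at t within {0..\<epsilon>})" for t
          unfolding has_real_derivative_iff_has_vector_derivative[symmetric]
          by (rule has_field_derivative_at_within, intro DERIV_minus DERIV_cmult DERIV_chain2[OF \<sigma>(3)])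
             (use s in \<open>auto intro!: derivative_eq_intros\<close>)
        have c\<sigma>': "continuous_on UNIV \<sigma>'" using \<sigma>(2)[of 0] by simp
        have "continuous_on {0..\<epsilon>} (\<lambda>t. \<sigma>' (t\<^sup>2 / s))"
          by (rule continuous_on_compose2[OF c\<sigma>']) (use s in \<open>auto intro!: continuous_intros\<close>)
        then show "continuous_on {0..\<epsilon>} (\<lambda>t. - (m * (\<sigma>' (t\<^sup>2 / s) * (2 * t / s))))"
          using s by (intro continuous_intros) auto
      qed (use eps in simp)
      also have "\<dots> = - m" using \<sigma>(5)[of 0] \<sigma>(6)[of 1] s by (simp add: s_def)
      finally show "(\<integral>x. \<eta> x \<partial>lborel) = - m" .
    qed
    define I where "I = indicat_real (ball (0::'a) 1)"
    have \<eta>_in: "\<eta> x = 0" if "x \<notin> ball 0 1" for x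
    proof (rule ccontr)
      assume "\<eta> x \<noteq> 0"
      then have "x \<in> Cs" using \<eta>_supp[of x] by (simp add: Cs_def dist_commute)
      then show False using Cs_ball that by auto
    qed
    have lap_eq: "laplacian \<phi> x = \<eta> x + I x * B x" for x
      using lap_in[of x] lap_out[of x] \<eta>_in[of x] by (cases "x \<in> ball 0 1") (auto simp: I_def)
    \<comment> \<open>The mass of \<open>B\<close> is never computed directly: the Laplacian of a
      compactly supported function integrates to 0, so \<open>B\<close> must balance
      \<open>\<eta>\<close>.\<close>
    have B_int: "integrable lborel (\<lambda>x. I x * B x)" "(\<integral>x. I x * B x \<partial>lborel) = m"
    proof -
      have e: "(\<lambda>x. I x * B x) = (\<lambda>x. laplacian \<phi> x - \<eta> x)" using lap_eq by auto
      show "integrable lborel (\<lambda>x. I x * B x)" unfolding e using lap_int \<eta>_int by simp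
      show "(\<integral>x. I x * B x \<partial>lborel) = m" unfolding e using lap_int \<eta>_int by simp
    qed
    define J where "J x = I x * g x * laplacian \<phi> x - g x0 * \<eta> x" for x
    have J_bound: "\<bar>J x\<bar> \<le> e * (- \<eta> x) + e * (I x * B x)" for x
    proof (cases "x \<in> ball 0 1")
      case True
      have "J x = (g x - g x0) * \<eta> x + g x * B x"
        using True by (simp add: J_def I_def lap_in algebra_simps)
      then have "\<bar>J x\<bar> \<le> \<bar>g x - g x0\<bar> * \<bar>\<eta> x\<bar> + \<bar>g x\<bar> * \<bar>B x\<bar>"
        by (metis abs_mult abs_triangle_ineq)
      also have "\<bar>g x - g x0\<bar> * \<bar>\<eta> x\<bar> \<le> e * \<bar>\<eta> x\<bar>"
        using d0(2)[of x] \<eta>_supp[of x] eps(2) by (cases "\<eta> x = 0") (auto intro!: mult_right_mono)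
      also have "\<bar>g x\<bar> * \<bar>B x\<bar> \<le> e * \<bar>B x\<bar>"
        using B_supp[OF True] by (cases "B x = 0") (auto intro!: mult_right_mono)
      finally show ?thesis using True \<eta>_nonpos[of x] B_nonneg[of x] by (simp add: I_def)
    next
      case False
      then show ?thesis using \<eta>_in[OF False] by (simp add: J_def I_def)
    qed
    have w_int: "integrable lborel (\<lambda>x. e * (- \<eta> x) + e * (I x * B x))"
      using \<eta>_int B_int by simp
    have w_val: "(\<integral>x. e * (- \<eta> x) + e * (I x * B x) \<partial>lborel) = 2 * e * m"
      using \<eta>_int B_int by simp
    have J_meas: "J \<in> borel_measurable lborel"
    proof -
      have "integrable lborel (\<lambda>x. I x * g x)" using g(3) unfolding set_integrable_def I_def by simp
      then have mIg: "(\<lambda>x. I x * g x) \<in> borel_measurable lborel" by (rule borel_measurable_integrable)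
      show ?thesis unfolding J_def[abs_def]
        by (intro borel_measurable_diff borel_measurable_times[OF mIg] borel_measurable_times[OF borel_measurable_const]
            borel_measurable_integrable[OF lap_int(1)] borel_measurable_integrable[OF \<eta>_int(1)])
    qed
    have J_int: "integrable lborel J"
      by (rule Bochner_Integration.integrable_bound[OF w_int J_meas])
         (use J_bound in \<open>auto intro: order_trans[OF _ abs_ge_self]\<close>)
    have "(\<integral>x. I x * g x * laplacian \<phi> x \<partial>lborel) = (\<integral>x. J x + g x0 * \<eta> x \<partial>lborel)" by (simp add: J_def)
    also have "\<dots> = (\<integral>x. J x \<partial>lborel) - g x0 * m" using J_int \<eta>_int by simp
    finally have "\<phi> 0 = (\<integral>x. J x \<partial>lborel) - g x0 * m"
      using g(4)[OF test] unfolding set_lebesgue_integral_def I_def by (simp add: mult.assoc)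
    moreover have "\<bar>\<integral>x. J x \<partial>lborel\<bar> \<le> 2 * e * m"
    proof -
      have "\<bar>\<integral>x. J x \<partial>lborel\<bar> \<le> (\<integral>x. \<bar>J x\<bar> \<partial>lborel)" by (rule integral_abs_bound)
      also have "\<dots> \<le> (\<integral>x. e * (- \<eta> x) + e * (I x * B x) \<partial>lborel)"
        by (rule integral_mono[OF integrable_abs[OF J_int] w_int J_bound])
      finally show ?thesis unfolding w_val .
    qed
    moreover have "\<bar>\<phi> 0 - Gam0\<bar> \<le> e"
      using H_near[of "Gam 0"] Gam_pos[of 0] \<delta>(2) by (simp add: \<phi>_def Gam_0[symmetric])
    ultimately show ?thesis by (simp add: mult.commute)
  qed
  have "Gam0 + m * g x0 = 0"
  proof (rule ccontr)
    assume "Gam0 + m * g x0 \<noteq> 0"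
    then have p: "\<bar>Gam0 + m * g x0\<bar> > 0" by simp
    define c where "c = 1 + 2 * m"
    have c: "c > 0" using m by (simp add: c_def)
    define e where "e = \<bar>Gam0 + m * g x0\<bar> / (2 * c)"
    have "e > 0" using p c by (simp add: e_def)
    from main[OF this] have "\<bar>Gam0 + m * g x0\<bar> \<le> e * c" by (simp add: c_def algebra_simps)
    also have "\<dots> = \<bar>Gam0 + m * g x0\<bar> / 2" using c by (simp add: e_def)
    finally show False using p by simp
  qed
  then show ?thesis by (simp add: m_def g_def n_def Gam0_def algebra_simps)
qed

section \<open>Radial solutions\<close>

text \<open>The energy has to be differentiated also at the node, where the profile vanishes. There
  the exponent above 1 gives derivative 0, and the trailing factor \<open>x\<close> makes the single
  formula correct.\<close>

lemma DERIV_abs_powr: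
  fixes x s :: real
  assumes s: "s > 1"
  shows "((\<lambda>x. \<bar>x\<bar> powr s) has_real_derivative s * \<bar>x\<bar> powr (s - 2) * x) (at x)"
proof (cases x "0::real" rule: linorder_cases)
  case greater
  have "((\<lambda>x. x powr s) has_real_derivative s * \<bar>x\<bar> powr (s - 2) * x) (at x)"
    using greater by (auto intro!: derivative_eq_intros simp: powr_diff power2_eq_square)
  then show ?thesis
    by (rule has_field_derivative_transform_within_open[where S="{0<..}"]) (use greater in auto)
next
  case less
  have "((\<lambda>x. (- x) powr s) has_real_derivative s * \<bar>x\<bar> powr (s - 2) * x) (at x)"
    using less by (auto intro!: derivative_eq_intros simp: powr_diff power2_eq_square)
  then show ?thesis
    by (rule has_field_derivative_transform_within_open[where S="{..<0}"]) (use less in auto)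
next
  case equal
  have lim: "((\<lambda>h::real. \<bar>h\<bar> powr (s - 1)) \<longlongrightarrow> 0) (at 0)"
    using tendsto_powr'[OF tendsto_rabs[OF tendsto_ident_at[of 0 UNIV]] tendsto_const, of "s - 1"] s by simp
  have "((\<lambda>h. \<bar>h\<bar> powr s / h) \<longlongrightarrow> 0) (at 0)"
  proof (rule Lim_null_comparison[OF _ lim])
    show "\<forall>\<^sub>F h in at 0. norm (\<bar>h\<bar> powr s / h) \<le> \<bar>h\<bar> powr (s - 1)"
      by (auto simp: eventually_at_filter powr_diff intro!: always_eventually)
  qed
  then show ?thesis using equal s by (simp add: has_field_derivative_iff)
qed

text \<open>Workhorse of all comparison and Gronwall arguments below: the profiles are only
  continuous at the end points of their intervals.\<close>

lemma nondecreasing_interior: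
  fixes g :: "real \<Rightarrow> real"
  assumes "a \<le> b" "continuous_on {a..b} g"
    and "\<And>x. a < x \<Longrightarrow> x < b \<Longrightarrow> \<exists>y. (g has_real_derivative y) (at x) \<and> y \<ge> 0"
  shows "g a \<le> g b"
proof (cases "a = b")
  case False
  then have "a < b" using assms by simp
  then obtain l z where z: "a < z" "z < b" "(g has_real_derivative l) (at z)" "g b - g a = (b - a) * l"
    using MVT[of a b g] assms real_differentiable_def by metis
  then have "l \<ge> 0" using assms(3)[of z] DERIV_unique by blast
  then show ?thesis using z(4) \<open>a < b\<close> by (smt (verit) mult_nonneg_nonneg)
qed simp

lemma nonincreasing_interior:
  fixes g :: "real \<Rightarrow> real"
  assumes "a \<le> b" "continuous_on {a..b} g"
    and "\<And>x. a < x \<Longrightarrow> x < b \<Longrightarrow> \<exists>y. (g has_real_derivative y) (at x) \<and> y \<le> 0"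
  shows "g b \<le> g a"
proof -
  have "- g a \<le> - g b"
  proof (rule nondecreasing_interior[of a b "\<lambda>x. - g x"])
    show "continuous_on {a..b} (\<lambda>x. - g x)" using assms by (intro continuous_intros)
    show "\<exists>y. ((\<lambda>x. - g x) has_real_derivative y) (at x) \<and> y \<ge> 0" if "a < x" "x < b" for x
    proof -
      obtain y where "(g has_real_derivative y) (at x)" "y \<le> 0" using assms(3) \<open>a < x\<close> \<open>x < b\<close> by blast
      then show ?thesis by (intro exI[of _ "- y"]) (auto intro: DERIV_minus)
    qed
  qed (rule assms)
  then show ?thesis by simp
qed

text \<open>First-order form of the radial equation, with \<open>f\<close> standing for r^(n-1) v'
  and \<open>\<rho>\<close> for the node. Only continuity is required at 0 and 1: the origin is
  singular for the equation, and a classical solution is merely continuous up to the sphere.\<close>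

locale radial_profile =
  fixes n :: nat and lam \<rho> :: real and v f :: "real \<Rightarrow> real"
  assumes n7: "n \<ge> 7"
    and lam: "0 < lam" "lam \<le> 1"
    and cont_v: "continuous_on {0..1} v" and cont_f: "continuous_on {0..1} f"
    and f0: "f 0 = 0"
    and dv: "\<And>r. 0 < r \<Longrightarrow> r < 1 \<Longrightarrow> (v has_real_derivative f r / r ^ (n - 1)) (at r)"
    and df: "\<And>r. 0 < r \<Longrightarrow> r < 1 \<Longrightarrow>
      (f has_real_derivative - (r ^ (n - 1) * (lam * v r + \<bar>v r\<bar> powr (4 / (real n - 2)) * v r))) (at r)"
    and \<rho>: "0 < \<rho>" "\<rho> < 1"
    and neg: "\<And>r. \<rho> < r \<Longrightarrow> r < 1 \<Longrightarrow> v r < 0"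
    and v\<rho>: "v \<rho> = 0" and v1: "v 1 = 0"

text \<open>The first term is r^n v'^2 / 2 expressed through the flux. The linear coefficient
  \<open>k\<close> is a parameter so that the same functional serves the original equation
  (\<open>k = lam\<close>) and the rescaled one (\<open>k = lam * eps^2\<close>).\<close>

definition profile_energy :: "nat \<Rightarrow> real \<Rightarrow> (real \<Rightarrow> real) \<Rightarrow> (real \<Rightarrow> real) \<Rightarrow> real \<Rightarrow> real" where
  "profile_energy n k v f r =
     (f r)\<^sup>2 / (2 * r ^ (n - 2)) + (real n - 2) / 2 * f r * v r + k * r ^ n * (v r)\<^sup>2 / 2
     + r ^ n * \<bar>v r\<bar> powr (2 * real n / (real n - 2)) / (2 * real n / (real n - 2))"

text \<open>At the critical exponent s = 2n/(n-2) one has n/s = (n-2)/2, so all power terms cancel;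
  of the linear terms n/2 - (n-2)/2 = 1 times \<open>k\<close> remains.\<close>

lemma DERIV_profile_energy:
  assumes n: "n \<ge> 3" and r: "r > 0"
    and dv: "(v has_real_derivative f r / r ^ (n - 1)) (at r)"
    and df: "(f has_real_derivative - (r ^ (n - 1) * (k * v r + \<bar>v r\<bar> powr (4 / (real n - 2)) * v r))) (at r)"
  shows "(profile_energy n k v f has_real_derivative k * r ^ (n - 1) * (v r)\<^sup>2) (at r)"
proof -
  obtain j where j: "n = j + 3" using n by (metis add.commute le_Suc_ex)
  define s where "s = 2 * real n / (real n - 2)"
  have s: "s > 1" "s - 2 = 4 / (real n - 2)" using n by (auto simp: s_def field_simps)
  define m where "m = \<bar>v r\<bar> powr (4 / (real n - 2))"
  define D where "D = - (r ^ (n - 1) * (k * v r + m * v r))"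
  have e: "\<bar>v r\<bar> powr s = m * (v r)\<^sup>2"
  proof (cases "v r = 0")
    case False
    then have "\<bar>v r\<bar> powr s = m * \<bar>v r\<bar> powr 2"
      unfolding m_def s(2)[symmetric] by (subst powr_add[symmetric]) simp
    then show ?thesis using False by simp
  qed (use s in auto)
  have d4: "((\<lambda>r. \<bar>v r\<bar> powr s) has_real_derivative s * m * v r * (f r / r ^ (n - 1))) (at r)"
    using DERIV_chain2[OF DERIV_abs_powr[OF s(1)] dv] unfolding m_def s(2) .
  define V where "V = f r / r ^ (n - 1)"
  note df' = df[folded m_def, folded D_def] and dv' = dv[folded V_def]
  have Q: "r ^ (n - 2) = r * r ^ j" "r ^ (n - 1) = r * r * r ^ j" "r ^ j > 0" using r by (auto simp: j eval_nat_numeral)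
  have d1: "((\<lambda>r. (f r)\<^sup>2 / (2 * r ^ (n - 2))) has_real_derivative
      2 * f r * D / (2 * r ^ (n - 2)) - (real n - 2) * (f r)\<^sup>2 / (2 * r ^ (n - 1))) (at r)"
  proof (rule DERIV_cong[OF DERIV_divide[OF DERIV_power[OF df'] DERIV_cmult[OF DERIV_pow]]])
    have "n - 2 - Suc 0 = j" "real (n - 2) = real n - 2" by (auto simp: j)
    then show "(real 2 * (D * f r ^ (2 - Suc 0)) * (2 * r ^ (n - 2)) - (f r)\<^sup>2 * (2 * (real (n - 2) * r ^ (n - 2 - Suc 0)))) /
        (2 * r ^ (n - 2) * (2 * r ^ (n - 2))) =
        2 * f r * D / (2 * r ^ (n - 2)) - (real n - 2) * (f r)\<^sup>2 / (2 * r ^ (n - 1))"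
      using r Q(3) by (simp only: Q) (simp add: field_simps power2_eq_square)
  qed (use r in auto)
  have d2: "((\<lambda>r. (real n - 2) / 2 * f r * v r) has_real_derivative (real n - 2) / 2 * (D * v r + f r * V)) (at r)"
    by (rule DERIV_cong[OF DERIV_mult[OF DERIV_cmult[OF df'] dv']]) (simp add: field_simps)
  have d3: "((\<lambda>r. k * r ^ n * (v r)\<^sup>2 / 2) has_real_derivative
      k / 2 * (n * r ^ (n - 1) * (v r)\<^sup>2 + r ^ n * (2 * v r * V))) (at r)"
    by (auto intro!: derivative_eq_intros dv' simp: algebra_simps)
  have d5: "((\<lambda>r. r ^ n * \<bar>v r\<bar> powr s / s) has_real_derivative
      (n * r ^ (n - 1) * (\<bar>v r\<bar> powr s) + r ^ n * (s * m * v r * V)) / s) (at r)"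
    by (rule DERIV_cdivide, rule DERIV_cong[OF DERIV_mult[OF DERIV_pow d4[folded V_def]]]) (simp add: algebra_simps)
  have "(profile_energy n k v f has_real_derivative
      (2 * f r * D / (2 * r ^ (n - 2)) - (real n - 2) * (f r)\<^sup>2 / (2 * r ^ (n - 1)))
      + (real n - 2) / 2 * (D * v r + f r * (f r / r ^ (n - 1)))
      + k / 2 * (n * r ^ (n - 1) * (v r)\<^sup>2 + r ^ n * (2 * v r * (f r / r ^ (n - 1))))
      + (n * r ^ (n - 1) * (\<bar>v r\<bar> powr s) + r ^ n * (s * m * v r * (f r / r ^ (n - 1)))) / s) (at r)"
    unfolding profile_energy_def[abs_def] s_def[symmetric] V_def[symmetric]
    by (intro DERIV_add d1 d2 d3 d5)
  also have "(2 * f r * D / (2 * r ^ (n - 2)) - (real n - 2) * (f r)\<^sup>2 / (2 * r ^ (n - 1)))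
      + (real n - 2) / 2 * (D * v r + f r * (f r / r ^ (n - 1)))
      + k / 2 * (n * r ^ (n - 1) * (v r)\<^sup>2 + r ^ n * (2 * v r * (f r / r ^ (n - 1))))
      + (n * r ^ (n - 1) * (\<bar>v r\<bar> powr s) + r ^ n * (s * m * v r * (f r / r ^ (n - 1)))) / s
      = k * r ^ (n - 1) * (v r)\<^sup>2"
  proof -
    have p: "r ^ (n - 1) = r * r ^ (n - 2)" "r ^ n = r * r * r ^ (n - 2)" by (auto simp: j eval_nat_numeral)
    define R where "R = r ^ (n - 2)"
    have R: "R > 0" using r by (simp add: R_def)
    have a1: "2 * f r * D / (2 * R) = - (r * f r * (k * v r + m * v r))"
      using R unfolding D_def p R_def[symmetric] by (simp add: field_simps)
    have a2: "r * r * R * (2 * v r * (f r / (r * R))) = 2 * r * v r * f r"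
      using R r by (simp add: field_simps)
    have a3: "r * r * R * (s * m * v r * (f r / (r * R))) = s * (r * m * v r * f r)"
      using R r by (simp add: field_simps)
    have a4: "(n * (r * R) * (m * (v r)\<^sup>2) + s * (r * m * v r * f r)) / s
        = (real n - 2) / 2 * (r * R) * m * (v r)\<^sup>2 + r * m * v r * f r"
      using n by (simp add: s_def field_simps)
    show ?thesis unfolding e p R_def[symmetric] a1 a2 a3 a4 D_def
      using r R by (simp add: field_simps power2_eq_square)
  qed
  finally show ?thesis .
qed

context radial_profile
begin

abbreviation "H \<equiv> profile_energy n lam v f"

text \<open>Threshold solving W0^(2/(n-2)) = a^2 s with a = (n-2)/2 and s the critical exponent.
  Above it the power term W^(s/2) / s is at least a^2 W, twice what completing the square
  costs.\<close>

definition "W0 = (((real n - 2) / 2)\<^sup>2 * (2 * real n / (real n - 2))) powr ((real n - 2) / 2)"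

lemma W0_pos: "W0 > 0" unfolding W0_def using n7 by auto

text \<open>Makes f^2 / r^(n-2) tend to 0 at the origin, which is what continuity of
  \<open>H\<close> at 0 requires.\<close>

lemma f_bound: "\<exists>K\<ge>0. \<forall>r\<in>{0..1}. \<bar>f r\<bar> \<le> K * r ^ n"
proof -
  obtain B where "\<forall>r\<in>{0..1}. \<bar>v r\<bar> \<le> B"
    using compact_imp_bounded[OF compact_continuous_image[OF cont_v]] unfolding bounded_iff by auto
  then have B: "\<bar>v r\<bar> \<le> B" if "r \<in> {0..1}" for r using that by blast
  define K where "K = lam * B + B powr (4 / (real n - 2)) * B"
  have B0: "B \<ge> 0" using B[of 0] by simp
  have K0: "K \<ge> 0" using B0 lam by (simp add: K_def)
  have "\<bar>f r\<bar> \<le> K * r ^ n" if r: "r \<in> {0..1}" for r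
  proof (cases "r = 0")
    case False
    have "\<exists>l z. 0 < z \<and> z < r \<and> (f has_real_derivative l) (at z) \<and> f r - f 0 = (r - 0) * l"
    proof (rule MVT)
      show "continuous_on {0..r} f" using r by (auto intro: continuous_on_subset[OF cont_f])
      show "f differentiable (at x)" if "0 < x" "x < r" for x
        using df[of x] that r real_differentiable_def by auto
    qed (use r False in auto)
    then obtain z l where z: "0 < z" "z < r" and l: "(f has_real_derivative l) (at z)" and fl: "f r = r * l"
      using f0 by auto
    have le: "l = - (z ^ (n - 1) * (lam * v z + \<bar>v z\<bar> powr (4 / (real n - 2)) * v z))"
      using DERIV_unique[OF l df[of z]] z r by auto
    have vz: "\<bar>v z\<bar> \<le> B" using B z r by auto
    have "\<bar>lam * v z + \<bar>v z\<bar> powr (4 / (real n - 2)) * v z\<bar> \<le> lam * \<bar>v z\<bar> + \<bar>v z\<bar> powr (4 / (real n - 2)) * \<bar>v z\<bar>"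
      using lam by (intro order_trans[OF abs_triangle_ineq]) (auto simp: abs_mult)
    also have "\<dots> \<le> K" unfolding K_def
      by (intro add_mono mult_mono powr_mono2) (use vz lam n7 B0 in auto)
    finally have b: "\<bar>lam * v z + \<bar>v z\<bar> powr (4 / (real n - 2)) * v z\<bar> \<le> K" .
    have "\<bar>l\<bar> = z ^ (n - 1) * \<bar>lam * v z + \<bar>v z\<bar> powr (4 / (real n - 2)) * v z\<bar>"
      unfolding le using z by (simp add: abs_mult)
    also have "\<dots> \<le> r ^ (n - 1) * K"
      by (intro mult_mono power_mono b) (use z r in auto)
    finally have "r * \<bar>l\<bar> \<le> r * (r ^ (n - 1) * K)" using r by (intro mult_left_mono) auto
    moreover have "r * r ^ (n - 1) = r ^ n" using n7 by (cases n) auto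
    ultimately show ?thesis using fl r by (simp add: abs_mult mult_ac)
  qed (use f0 n7 in \<open>simp add: zero_power\<close>)
  then show ?thesis using K0 by blast
qed

lemma cont_H: "continuous_on {0..1} H"
proof -
  obtain K where K: "K \<ge> 0" "\<And>r. r \<in> {0..1} \<Longrightarrow> \<bar>f r\<bar> \<le> K * r ^ n" using f_bound by blast
  have "continuous_on {0..1} (\<lambda>r. (f r)\<^sup>2 / (2 * r ^ (n - 2)))"
    unfolding continuous_on_eq_continuous_within
  proof
    fix x :: real assume x: "x \<in> {0..1}"
    show "continuous (at x within {0..1}) (\<lambda>r. (f r)\<^sup>2 / (2 * r ^ (n - 2)))"
    proof (cases "x = 0")
      case False
      have "continuous (at x within {0..1}) f" using cont_f x continuous_on_eq_continuous_within by blast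
      then show ?thesis using False by (intro continuous_intros) auto
    next
      case True
      have b: "\<bar>(f r)\<^sup>2 / (2 * r ^ (n - 2))\<bar> \<le> K\<^sup>2 * r" if r: "r \<in> {0..1}" for r
      proof (cases "r = 0")
        case False
        then have r0: "r > 0" using r by auto
        have "(f r)\<^sup>2 \<le> (K * r ^ n)\<^sup>2"
          using K(2)[OF r] by (metis abs_ge_zero power2_abs power_mono)
        also have "\<dots> = K\<^sup>2 * r ^ (2 * n)" by (simp add: power_mult_distrib power_mult[symmetric] mult.commute)
        also have "\<dots> \<le> K\<^sup>2 * r ^ (1 + (n - 2))"
          by (intro mult_left_mono power_decreasing) (use r n7 in auto)
        also have "\<dots> = K\<^sup>2 * r * r ^ (n - 2)" by simp
        also have "\<dots> \<le> K\<^sup>2 * r * (2 * r ^ (n - 2))" using r0 by (intro mult_left_mono) auto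
        finally have "(f r)\<^sup>2 / (2 * r ^ (n - 2)) \<le> K\<^sup>2 * r" using r0 by (simp add: pos_divide_le_eq)
        then show ?thesis using r0 by simp
      qed (simp add: f0)
      have "((\<lambda>r. K\<^sup>2 * r) \<longlongrightarrow> K\<^sup>2 * 0) (at 0 within {0..1})" by (intro tendsto_intros)
      then have lim0: "((\<lambda>r. K\<^sup>2 * r) \<longlongrightarrow> 0) (at 0 within {0..1})" by simp
      have "((\<lambda>r. (f r)\<^sup>2 / (2 * r ^ (n - 2))) \<longlongrightarrow> 0) (at 0 within {0..1})"
      proof (rule Lim_null_comparison[of _ "\<lambda>r. K\<^sup>2 * r"])
        show "\<forall>\<^sub>F r in at 0 within {0..1}. norm ((f r)\<^sup>2 / (2 * r ^ (n - 2))) \<le> K\<^sup>2 * r"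
          unfolding eventually_at real_norm_def by (intro exI[of _ 1] conjI ballI impI b) simp_all
      qed (rule lim0)
      then show ?thesis using True f0 by (simp add: continuous_within)
    qed
  qed
  moreover have "continuous_on {0..1} (\<lambda>r. (real n - 2) / 2 * f r * v r)"
    "continuous_on {0..1} (\<lambda>r. lam * r ^ n * (v r)\<^sup>2 / 2)"
    by (intro continuous_intros cont_f cont_v; simp)+
  moreover have "continuous_on {0..1} (\<lambda>r. r ^ n * \<bar>v r\<bar> powr (2 * real n / (real n - 2)) / (2 * real n / (real n - 2)))"
    using n7 by (intro continuous_on_divide continuous_on_mult continuous_on_power continuous_on_id continuous_on_const
        continuous_on_powr'[OF continuous_on_rabs[OF cont_v]]) auto
  ultimately show ?thesis unfolding profile_energy_def[abs_def]
    by (intro continuous_on_add)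
qed

lemma H0: "H 0 = 0" using n7 by (simp add: profile_energy_def f0 zero_power)

lemma DERIV_H: "0 < r \<Longrightarrow> r < 1 \<Longrightarrow> (H has_real_derivative lam * r ^ (n - 1) * (v r)\<^sup>2) (at r)"
  by (rule DERIV_profile_energy) (use n7 dv df in auto)

lemma H_nonneg: "0 \<le> r \<Longrightarrow> r \<le> 1 \<Longrightarrow> H r \<ge> 0"
proof -
  assume r: "0 \<le> r" "r \<le> 1"
  have "H 0 \<le> H r"
  proof (rule nondecreasing_interior[OF r(1)])
    show "continuous_on {0..r} H" using r by (intro continuous_on_subset[OF cont_H]) auto
    show "\<exists>y. (H has_real_derivative y) (at x) \<and> y \<ge> 0" if "0 < x" "x < r" for x
      using DERIV_H[of x] that r lam by (intro exI[of _ "lam * x ^ (n - 1) * (v x)\<^sup>2"]) auto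
  qed
  then show ?thesis using H0 by simp
qed

text \<open>Completing the square in the energy bounds the Emden--Fowler variable \<open>r\<^sup>(\<^sup>n\<^sup>-\<^sup>2\<^sup>)\<^sup>/\<^sup>2 v\<close>.\<close>

lemma W_le_energy:
  assumes r: "0 < r" "r \<le> 1"
  shows "r ^ (n - 2) * (v r)\<^sup>2 \<le> W0 + H r"
proof -
  define a where "a = (real n - 2) / 2"
  define s where "s = 2 * real n / (real n - 2)"
  define R where "R = r ^ (n - 2)"
  define W where "W = R * (v r)\<^sup>2"
  have a: "a \<ge> 5/2" and s: "s > 0" "s / 2 = 1 + 2 / (real n - 2)" using n7 by (auto simp: a_def s_def field_simps)
  have s_half: "s / 2 = real n / (real n - 2)" using n7 by (simp add: s_def field_simps)
  have R: "R > 0" using r by (simp add: R_def)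
  have W: "W \<ge> 0" using R by (simp add: W_def)
  have "r ^ n = R powr (real n / (real n - 2))"
    using r n7 by (simp add: R_def powr_powr powr_realpow[symmetric] of_nat_diff)
  moreover have "\<bar>v r\<bar> powr s = ((v r)\<^sup>2) powr (real n / (real n - 2))"
  proof (cases "v r = 0")
    case False
    have "(v r)\<^sup>2 = \<bar>v r\<bar> powr 2" using False by simp
    show ?thesis unfolding \<open>(v r)\<^sup>2 = \<bar>v r\<bar> powr 2\<close> powr_powr s_def by simp
  qed (use s in auto)
  ultimately have e: "r ^ n * \<bar>v r\<bar> powr s = W powr (s / 2)"
    unfolding s_half using R by (simp add: W_def powr_mult)
  have Heq: "H r = (f r)\<^sup>2 / (2 * R) + a * f r * v r + lam * r ^ n * (v r)\<^sup>2 / 2 + W powr (s / 2) / s"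
    unfolding profile_energy_def a_def[symmetric] s_def[symmetric] R_def[symmetric] e ..
  have "(f r)\<^sup>2 / (2 * R) + a * f r * v r = (f r + a * R * v r)\<^sup>2 / (2 * R) - a\<^sup>2 * W / 2"
    using R by (simp add: W_def field_simps power2_eq_square)
  moreover have "(f r + a * R * v r)\<^sup>2 / (2 * R) \<ge> 0" using R by simp
  moreover have "lam * r ^ n * (v r)\<^sup>2 / 2 \<ge> 0" using lam r by simp
  ultimately have Hge: "H r \<ge> W powr (s / 2) / s - a\<^sup>2 * W / 2" using Heq by linarith
  show ?thesis
  proof (cases "W \<le> W0")
    case True
    then show ?thesis using H_nonneg[of r] r by (simp add: W_def R_def)
  next
    case False
    then have W0W: "W > W0" "W > 0" using W0_pos by auto
    have "W0 powr (2 / (real n - 2)) = a\<^sup>2 * s"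
    proof -
      have "(real n - 2) / 2 * (2 / (real n - 2)) = 1" using n7 by simp
      then show ?thesis unfolding W0_def a_def[symmetric] s_def[symmetric] powr_powr using a s(1) by simp
    qed
    moreover have "W0 powr (2 / (real n - 2)) \<le> W powr (2 / (real n - 2))"
      by (rule powr_mono2) (use W0W W0_pos n7 in auto)
    ultimately have "W * (a\<^sup>2 * s) \<le> W * W powr (2 / (real n - 2))"
      using W0W by (intro mult_left_mono) auto
    also have "\<dots> = W powr (s / 2)" unfolding s(2) using W0W by (simp add: powr_add)
    finally have "a\<^sup>2 * W \<le> W powr (s / 2) / s" using s(1) by (simp only: pos_le_divide_eq) (simp add: mult_ac)
    then have "a\<^sup>2 * W / 2 \<le> H r" using Hge by linarith
    moreover have "2 \<le> a\<^sup>2" using mult_mono[of "5/2" a "5/2" a] a by (simp add: power2_eq_square)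
    then have "2 * W \<le> a\<^sup>2 * W" using W by (rule mult_right_mono)
    ultimately have "W \<le> H r" by linarith
    then show ?thesis using W0_pos by (simp add: W_def R_def)
  qed
qed

text \<open>Gronwall: H' = lam r (r^(n-2) v^2) is at most lam (W0 + H), so exp(- lam r) H grows at
  rate at most lam W0. The factor 3 bounds exp(lam).\<close>

lemma H_le:
  assumes r: "0 \<le> r" "r \<le> 1"
  shows "H r \<le> 3 * W0 * lam"
proof -
  have "exp (- lam * r) * H r - lam * W0 * r \<le> exp (- lam * 0) * H 0 - lam * W0 * 0"
  proof (rule nonincreasing_interior[OF r(1), of "\<lambda>r. exp (- lam * r) * H r - lam * W0 * r"])
    show "continuous_on {0..r} (\<lambda>r. exp (- lam * r) * H r - lam * W0 * r)"
      using r by (intro continuous_intros continuous_on_subset[OF cont_H]) auto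
    fix x assume x: "0 < x" "x < r"
    have xp: "x ^ (n - 1) = x * x ^ (n - 2)" proof -
      have "n - 1 = Suc (n - 2)" using n7 by simp
      then show ?thesis by (simp only: power_Suc)
    qed
    have "x ^ (n - 1) * (v x)\<^sup>2 = x * (x ^ (n - 2) * (v x)\<^sup>2)" using xp by simp
    also have "\<dots> \<le> 1 * (x ^ (n - 2) * (v x)\<^sup>2)" by (rule mult_right_mono) (use x r in auto)
    also have "\<dots> \<le> W0 + H x" using W_le_energy[of x] x r by auto
    finally have "lam * (x ^ (n - 1) * (v x)\<^sup>2 - H x) \<le> lam * W0" using lam by simp
    then have "exp (- lam * x) * (lam * (x ^ (n - 1) * (v x)\<^sup>2 - H x)) \<le> exp (- lam * x) * (lam * W0)"
      by (rule mult_left_mono) simp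
    also have "\<dots> \<le> 1 * (lam * W0)" by (rule mult_right_mono) (use x lam W0_pos in auto)
    finally have "exp (- lam * x) * (lam * (x ^ (n - 1) * (v x)\<^sup>2 - H x)) - lam * W0 \<le> 0" by simp
    moreover have "((\<lambda>r. exp (- lam * r) * H r - lam * W0 * r) has_real_derivative
       exp (- lam * x) * (lam * (x ^ (n - 1) * (v x)\<^sup>2 - H x)) - lam * W0) (at x)"
      using x r by (auto intro!: derivative_eq_intros DERIV_H simp: algebra_simps)
    ultimately show "\<exists>y. ((\<lambda>r. exp (- lam * r) * H r - lam * W0 * r) has_real_derivative y) (at x) \<and> y \<le> 0" by blast
  qed
  then have "exp (- lam * r) * H r \<le> lam * W0 * r" using H0 by simp
  also have "\<dots> \<le> lam * W0 * 1" using r lam W0_pos by (intro mult_left_mono) auto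
  finally have "exp (lam * r) * (exp (- lam * r) * H r) \<le> exp (lam * r) * (lam * W0)" by simp
  then have "H r \<le> exp (lam * r) * (lam * W0)" by (simp add: mult.assoc[symmetric] exp_add[symmetric])
  also have "\<dots> \<le> 3 * (lam * W0)"
  proof (rule mult_right_mono)
    have "lam * r \<le> 1 * 1" using lam r by (intro mult_mono) auto
    then show "exp (lam * r) \<le> 3" using exp_le by (smt (verit) exp_le_cancel_iff)
  qed (use lam W0_pos in auto)
  finally show ?thesis by (simp add: mult_ac)
qed

lemma W_le:
  assumes r: "0 < r" "r \<le> 1"
  shows "r ^ (n - 2) * (v r)\<^sup>2 \<le> 4 * W0"
proof -
  have "3 * W0 * lam \<le> 3 * W0 * 1" using lam W0_pos by (intro mult_left_mono) auto
  then show ?thesis using W_le_energy[OF r] H_le[of r] r by simp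
qed

text \<open>A second integration, now with r^(n-2) v^2 \<le> 4 W0 known, so that H' \<le> 4 W0 lam
  r. The gained r^2 makes the energy at \<open>rm\<close> negligible against
  \<open>lam * eps^2\<close>.\<close>

lemma H_le_square:
  assumes r: "0 \<le> r" "r \<le> 1"
  shows "H r \<le> 2 * W0 * lam * r\<^sup>2"
proof -
  have "H r - 2 * W0 * lam * r\<^sup>2 \<le> H 0 - 2 * W0 * lam * 0\<^sup>2"
  proof (rule nonincreasing_interior[OF r(1), of "\<lambda>r. H r - 2 * W0 * lam * r\<^sup>2"])
    show "continuous_on {0..r} (\<lambda>r. H r - 2 * W0 * lam * r\<^sup>2)"
      using r by (intro continuous_intros continuous_on_subset[OF cont_H]) auto
    fix x assume x: "0 < x" "x < r"
    have xp: "x ^ (n - 1) = x * x ^ (n - 2)" proof -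
      have "n - 1 = Suc (n - 2)" using n7 by simp
      then show ?thesis by (simp only: power_Suc)
    qed
    have "lam * x * (x ^ (n - 2) * (v x)\<^sup>2) \<le> lam * x * (4 * W0)"
      using x r lam by (intro mult_left_mono W_le) auto
    then have "lam * x ^ (n - 1) * (v x)\<^sup>2 - 2 * W0 * lam * (2 * x) \<le> 0" unfolding xp by (simp add: mult_ac)
    moreover have "((\<lambda>r. H r - 2 * W0 * lam * r\<^sup>2) has_real_derivative
       lam * x ^ (n - 1) * (v x)\<^sup>2 - 2 * W0 * lam * (2 * x)) (at x)"
      using x r by (auto intro!: derivative_eq_intros DERIV_H)
    ultimately show "\<exists>y. ((\<lambda>r. H r - 2 * W0 * lam * r\<^sup>2) has_real_derivative y) (at x) \<and> y \<le> 0" by blast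
  qed
  then show ?thesis using H0 by simp
qed

end

section \<open>The profile beyond its negative minimum\<close>

locale radial_profile_min = radial_profile +
  fixes rm :: real
  assumes rm: "\<rho> < rm" "rm < 1" and v_rm: "v rm < 0" and f_rm: "f rm = 0"

lemma (in radial_profile) nodal_min_exists: "\<exists>r. radial_profile_min n lam \<rho> v f r"
proof -
  have cont: "continuous_on {\<rho>..1} v" by (rule continuous_on_subset[OF cont_v]) (use \<rho> in simp)
  have "{\<rho>..1} \<noteq> {}" using \<rho> by simp
  then obtain r where r: "r \<in> {\<rho>..1}" "\<And>x. x \<in> {\<rho>..1} \<Longrightarrow> v r \<le> v x"
    using continuous_attains_inf[OF compact_Icc _ cont] by blast
  have "v ((\<rho> + 1) / 2) < 0" by (rule neg) (use \<rho> in simp_all)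
  moreover have "v r \<le> v ((\<rho> + 1) / 2)" by (rule r(2)) (use \<rho> in simp)
  ultimately have vr: "v r < 0" by simp
  then have "r \<noteq> \<rho>" "r \<noteq> 1" using v\<rho> v1 by auto
  then have r': "\<rho> < r" "r < 1" using r(1) by auto
  have d: "(v has_real_derivative f r / r ^ (n - 1)) (at r)" by (rule dv) (use r' \<rho> in auto)
  have "f r / r ^ (n - 1) = 0"
  proof (rule DERIV_local_min[OF d])
    show "0 < min (r - \<rho>) (1 - r)" using r' by simp
    show "\<forall>y. \<bar>r - y\<bar> < min (r - \<rho>) (1 - r) \<longrightarrow> v r \<le> v y"
    proof (intro allI impI r(2))
      fix y assume "\<bar>r - y\<bar> < min (r - \<rho>) (1 - r)"
      then show "y \<in> {\<rho>..1}" unfolding min_less_iff_conj abs_less_iff by simp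
    qed
  qed
  then have "f r = 0" using r' \<rho> by simp
  then show ?thesis
    by (intro exI[of _ r] radial_profile_min.intro radial_profile_axioms radial_profile_min_axioms.intro r' vr)
qed

context radial_profile_min
begin

definition "M = - v rm"
definition "q = 4 / (real n - 2)"

lemma rm0: "0 < rm" using rm \<rho> by simp
lemma M0: "M > 0" using v_rm by (simp add: M_def)
lemma q0: "q > 0" using n7 by (simp add: q_def)

lemma v_neg: "rm \<le> r \<Longrightarrow> r < 1 \<Longrightarrow> v r < 0" using neg rm by simp

lemma v_nonpos: "rm \<le> r \<Longrightarrow> r \<le> 1 \<Longrightarrow> v r \<le> 0" using v_neg[of r] v1 by (cases "r = 1") auto

lemma df':
  assumes "rm \<le> r" "r < 1"
  shows "(f has_real_derivative r ^ (n - 1) * (lam * (- v r) + (- v r) powr q * (- v r))) (at r)"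
  using df[of r] v_neg[OF assms] rm0 assms by (simp add: q_def algebra_simps)

lemma f_mono:
  assumes "rm \<le> r" "r \<le> s" "s \<le> 1"
  shows "f r \<le> f s"
proof (rule nondecreasing_interior[OF assms(2)])
  show "continuous_on {r..s} f" by (rule continuous_on_subset[OF cont_f]) (use assms rm0 in simp)
  fix x assume x: "r < x" "x < s"
  have x': "rm \<le> x" "x < 1" using x assms by auto
  have "0 \<le> x ^ (n - 1) * (lam * (- v x) + (- v x) powr q * (- v x))"
    using v_neg[OF x'] lam rm0 x' by (intro mult_nonneg_nonneg add_nonneg_nonneg zero_le_power) simp_all
  then show "\<exists>y. (f has_real_derivative y) (at x) \<and> y \<ge> 0" using df'[OF x'] by blast
qed

lemma f_nonneg: "rm \<le> r \<Longrightarrow> r \<le> 1 \<Longrightarrow> f r \<ge> 0" using f_mono[of rm r] f_rm by simp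

lemma v_mono:
  assumes "rm \<le> r" "r \<le> s" "s \<le> 1"
  shows "v r \<le> v s"
proof (rule nondecreasing_interior[OF assms(2)])
  show "continuous_on {r..s} v" by (rule continuous_on_subset[OF cont_v]) (use assms rm0 in simp)
  fix x assume x: "r < x" "x < s"
  then have "rm \<le> x" "x < 1" "0 < x" using assms rm0 by auto
  then show "\<exists>y. (v has_real_derivative y) (at x) \<and> y \<ge> 0"
    by (intro exI[of _ "f x / x ^ (n - 1)"] conjI dv divide_nonneg_nonneg f_nonneg zero_le_power) simp_all
qed

lemma v_le_M: "rm \<le> r \<Longrightarrow> r \<le> 1 \<Longrightarrow> - v r \<le> M" using v_mono[of rm r] by (simp add: M_def)

lemma flux_pos: "f 1 > 0"
proof (rule ccontr)
  assume "\<not> f 1 > 0"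
  have "v 1 \<le> v rm"
  proof (rule nonincreasing_interior[of rm 1 v])
    show "continuous_on {rm..1} v" by (rule continuous_on_subset[OF cont_v]) (use rm0 in simp)
    fix x assume x: "rm < x" "x < 1"
    have "f x \<le> 0" using f_mono[of x 1] x \<open>\<not> f 1 > 0\<close> by simp
    then show "\<exists>y. (v has_real_derivative y) (at x) \<and> y \<le> 0"
      using x rm0 by (intro exI[of _ "f x / x ^ (n - 1)"] conjI dv divide_nonpos_nonneg zero_le_power) simp_all
  qed (use rm in simp)
  then show False using v1 v_rm by simp
qed

lemma npow: "x ^ (n - 1) = x * x ^ (n - 2)" "x ^ n = x * x * x ^ (n - 2)" for x :: real
proof -
  have "n - 1 = Suc (n - 2)" "n = Suc (Suc (n - 2))" using n7 by simp_all
  then show "x ^ (n - 1) = x * x ^ (n - 2)" "x ^ n = x * x * x ^ (n - 2)"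
    by (metis power_Suc, metis power_Suc mult.assoc)
qed

lemma DERIV_fund:
  assumes "x > 0"
  shows "((\<lambda>r. 1 / r ^ (n - 2)) has_real_derivative - ((real n - 2) / x ^ (n - 1))) (at x)"
proof -
  define Q where "Q = x ^ (n - 2 - Suc 0)"
  have Q: "Q > 0" using assms by (simp add: Q_def)
  have e: "x ^ (n - 2) = x * Q" proof -
    have "n - 2 = Suc (n - 2 - Suc 0)" using n7 by simp
    then show ?thesis unfolding Q_def by (metis power_Suc)
  qed
  moreover have "real (n - 2) = real n - 2" using n7 by simp
  ultimately have "(0 * x ^ (n - 2) - 1 * (real (n - 2) * Q)) / (x ^ (n - 2) * x ^ (n - 2)) = - ((real n - 2) / x ^ (n - 1))"
    unfolding npow e using assms Q by (simp add: field_simps)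
  then show ?thesis
    using DERIV_divide[OF DERIV_const[of 1] DERIV_pow[of "n - 2" x]] assms by (simp add: Q_def)
qed

text \<open>Climbing from -M to 0 within a radius below 1 takes a strong source: two integrations
  with -v \<le> M give M \<le> (lam M + M^(1+q)) / (2n). This yields M \<ge> 1, hence eps \<le>
  1.\<close>

lemma M_large: "M powr q \<ge> 2 * real n - 1"
proof -
  define K where "K = lam * M + M powr q * M"
  have fK: "f r \<le> K * r ^ n / n" if r: "rm \<le> r" "r \<le> 1" for r
  proof -
    have "f r - K * r ^ n / n \<le> f rm - K * rm ^ n / n"
    proof (rule nonincreasing_interior[OF r(1), of "\<lambda>r. f r - K * r ^ n / n"])
      show "continuous_on {rm..r} (\<lambda>r. f r - K * r ^ n / n)"
        using n7 by (intro continuous_intros continuous_on_subset[OF cont_f]) (use r rm0 in auto)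
      fix x assume x: "rm < x" "x < r"
      have vx: "0 < - v x" "- v x \<le> M" using v_neg[of x] v_le_M[of x] x r by simp_all
      have "lam * (- v x) + (- v x) powr q * (- v x) \<le> K"
        unfolding K_def by (intro add_mono mult_mono powr_mono2) (use vx lam q0 in simp_all)
      then have "x ^ (n - 1) * (lam * (- v x) + (- v x) powr q * (- v x)) \<le> x ^ (n - 1) * K"
        by (rule mult_left_mono) (use x rm0 in simp)
      moreover have "((\<lambda>r. f r - K * r ^ n / n) has_real_derivative
          x ^ (n - 1) * (lam * (- v x) + (- v x) powr q * (- v x)) - x ^ (n - 1) * K) (at x)"
        by (rule DERIV_diff[OF df']) (use x r n7 in \<open>auto intro!: derivative_eq_intros\<close>)
      ultimately show "\<exists>y. ((\<lambda>r. f r - K * r ^ n / n) has_real_derivative y) (at x) \<and> y \<le> 0"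
        using diff_le_0_iff_le by blast
    qed
    moreover have "K * rm ^ n / n \<ge> 0" using M0 lam rm0 by (simp add: K_def)
    ultimately show ?thesis using f_rm by simp
  qed
  have "v 1 - K * 1\<^sup>2 / (2 * n) \<le> v rm - K * rm\<^sup>2 / (2 * n)"
  proof (rule nonincreasing_interior[of rm 1 "\<lambda>r. v r - K * r\<^sup>2 / (2 * n)"])
    show "continuous_on {rm..1} (\<lambda>r. v r - K * r\<^sup>2 / (2 * n))"
      using n7 by (intro continuous_intros continuous_on_subset[OF cont_v]) (use rm0 in auto)
    fix x assume x: "rm < x" "x < 1"
    have x0: "x > 0" using x rm0 by simp
    have "f x / x ^ (n - 1) \<le> K * x / n"
      using fK[of x] x x0 n7 unfolding npow by (simp add: field_simps)
    moreover have "((\<lambda>r. v r - K * r\<^sup>2 / (2 * n)) has_real_derivative f x / x ^ (n - 1) - K * x / n) (at x)"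
      using n7 by (intro DERIV_diff dv x0 x) (auto intro!: derivative_eq_intros)
    ultimately show "\<exists>y. ((\<lambda>r. v r - K * r\<^sup>2 / (2 * n)) has_real_derivative y) (at x) \<and> y \<le> 0"
      using diff_le_0_iff_le by blast
  qed (use rm in simp)
  moreover have "K * rm\<^sup>2 / (2 * n) \<ge> 0" using M0 lam by (simp add: K_def)
  ultimately have "M \<le> K / (2 * n)" using v1 by (simp add: M_def)
  then have "M * (2 * real n) \<le> M * (lam + M powr q)" using n7 by (simp add: K_def field_simps)
  then show ?thesis using M0 lam by simp
qed

lemma M_ge_1: "M \<ge> 1"
proof (rule ccontr)
  assume "\<not> M \<ge> 1"
  then have "M powr q \<le> 1" using M0 q0 powr_mono2[of q M 1] by simp
  then show False using M_large n7 by simp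
qed

text \<open>The flux increases up to \<open>f 1\<close>, so -v stays below the harmonic function
  with flux \<open>f 1\<close> and the same zero at 1.\<close>

lemma flux_upper:
  assumes r: "rm \<le> r" "r \<le> 1"
  shows "- v r \<le> f 1 * (1 / r ^ (n - 2) - 1) / (real n - 2)"
proof -
  have "v 1 + f 1 / (real n - 2) * (1 / 1 ^ (n - 2) - 1) \<le> v r + f 1 / (real n - 2) * (1 / r ^ (n - 2) - 1)"
  proof (rule nonincreasing_interior[OF r(2), of "\<lambda>r. v r + f 1 / (real n - 2) * (1 / r ^ (n - 2) - 1)"])
    show "continuous_on {r..1} (\<lambda>r. v r + f 1 / (real n - 2) * (1 / r ^ (n - 2) - 1))"
      by (intro continuous_intros continuous_on_subset[OF cont_v]) (use r rm0 in auto)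
    fix x assume x: "r < x" "x < 1"
    have x0: "x > 0" using x r rm0 by simp
    have "((\<lambda>r. v r + f 1 / (real n - 2) * (1 / r ^ (n - 2) - 1)) has_real_derivative
        f x / x ^ (n - 1) + f 1 / (real n - 2) * (- ((real n - 2) / x ^ (n - 1)) - 0)) (at x)"
      by (intro DERIV_add DERIV_cmult DERIV_diff DERIV_fund DERIV_const dv x0 x)
    moreover have "f x / x ^ (n - 1) \<le> f 1 / x ^ (n - 1)"
      using f_mono[of x 1] x r x0 by (intro divide_right_mono) simp_all
    then have "f x / x ^ (n - 1) + f 1 / (real n - 2) * (- ((real n - 2) / x ^ (n - 1)) - 0) \<le> 0"
      using n7 by simp
    ultimately show "\<exists>y. ((\<lambda>r. v r + f 1 / (real n - 2) * (1 / r ^ (n - 2) - 1)) has_real_derivative y) (at x) \<and> y \<le> 0"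
      by blast
  qed
  then show ?thesis using v1 by simp
qed

text \<open>Since \<open>v 1 = 0\<close>, the first term is all that is left of the energy at 1. The
  flux thus tends to 0 with \<open>lam\<close>, which makes \<open>\<delta>\<close> in
  \<open>outer_bounds\<close> small.\<close>

lemma flux_le: "(f 1)\<^sup>2 \<le> 6 * W0 * lam"
proof -
  have "H 1 = (f 1)\<^sup>2 / 2" using n7 by (simp add: profile_energy_def v1)
  then show ?thesis using H_le[of 1] by simp
qed

text \<open>\<open>\<delta>\<close> is the relative loss of flux on [\<alpha>, 1]. There -v \<le>
  \<open>f 1 * B\<close>, which bounds f' by \<open>f 1 * \<delta>\<close>; comparison with the
  harmonic functions of flux \<open>f 1\<close> and \<open>f 1 * (1 - \<delta>)\<close> then
  encloses -v. For fixed \<alpha>, \<open>\<delta>\<close> vanishes as \<open>lam\<close> and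
  \<open>f 1\<close> do.\<close>

lemma outer_bounds:
  assumes \<alpha>: "0 < \<alpha>" "rm \<le> \<alpha>" and r: "\<alpha> \<le> r" "r \<le> 1"
  defines "B \<equiv> 1 / \<alpha> ^ (n - 2)"
  defines "\<delta> \<equiv> lam * B + (f 1 * B) powr q * B"
  shows "f 1 * (1 - \<delta>) \<le> f r" "f r \<le> f 1"
    "f 1 * (1 - \<delta>) * (1 / r ^ (n - 2) - 1) / (real n - 2) \<le> - v r"
    "- v r \<le> f 1 * (1 / r ^ (n - 2) - 1) / (real n - 2)"
proof -
  have B: "B \<ge> 0" using \<alpha> by (simp add: B_def)
  have \<delta>: "\<delta> \<ge> 0" unfolding \<delta>_def using B lam by simp
  have vB: "- v s \<le> f 1 * B" if s: "\<alpha> \<le> s" "s \<le> 1" for s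
  proof -
    have s0: "s > 0" using s \<alpha> by simp
    have "\<alpha> ^ (n - 2) \<le> s ^ (n - 2)" by (rule power_mono) (use s \<alpha> in auto)
    then have "1 / s ^ (n - 2) \<le> B" unfolding B_def using s0 \<alpha> by (intro divide_left_mono) simp_all
    then have "1 / s ^ (n - 2) - 1 \<le> B" by simp
    have "- v s \<le> f 1 * (1 / s ^ (n - 2) - 1) / (real n - 2)"
      by (rule flux_upper) (use s \<alpha> in auto)
    also have "\<dots> \<le> f 1 * B / (real n - 2)"
      using flux_pos n7 \<open>1 / s ^ (n - 2) - 1 \<le> B\<close> by (intro divide_right_mono mult_left_mono) simp_all
    also have "\<dots> \<le> f 1 * B / 1" using flux_pos n7 B by (intro divide_left_mono) simp_all
    finally show ?thesis by simp
  qed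
  have low: "f 1 * (1 - \<delta>) \<le> f s" if s: "\<alpha> \<le> s" "s \<le> 1" for s
  proof -
    have "f 1 - f 1 * \<delta> * 1 \<le> f s - f 1 * \<delta> * s"
    proof (rule nonincreasing_interior[OF s(2), of "\<lambda>s. f s - f 1 * \<delta> * s"])
      show "continuous_on {s..1} (\<lambda>s. f s - f 1 * \<delta> * s)"
        by (intro continuous_intros continuous_on_subset[OF cont_f]) (use s \<alpha> in auto)
      fix x assume x: "s < x" "x < 1"
      have vx: "0 < - v x" "- v x \<le> f 1 * B" using v_neg[of x] vB[of x] x s \<alpha> by simp_all
      define z where "z = - v x"
      have z: "0 < z" "z \<le> f 1 * B" using vx by (simp_all add: z_def)
      have "lam * z + z powr q * z \<le> lam * (f 1 * B) + (f 1 * B) powr q * (f 1 * B)"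
        by (intro add_mono mult_mono powr_mono2) (use z lam q0 in simp_all)
      moreover have "x ^ (n - 1) * (lam * z + z powr q * z) \<le> 1 * (lam * z + z powr q * z)"
        by (intro mult_right_mono power_le_one) (use x s \<alpha> z lam in simp_all)
      ultimately have "x ^ (n - 1) * (lam * (- v x) + (- v x) powr q * (- v x)) \<le> lam * (f 1 * B) + (f 1 * B) powr q * (f 1 * B)"
        by (simp add: z_def)
      also have "\<dots> = f 1 * \<delta>" by (simp add: \<delta>_def algebra_simps)
      finally have "x ^ (n - 1) * (lam * (- v x) + (- v x) powr q * (- v x)) - f 1 * \<delta> \<le> 0" by simp
      moreover have "((\<lambda>s. f s - f 1 * \<delta> * s) has_real_derivative
          x ^ (n - 1) * (lam * (- v x) + (- v x) powr q * (- v x)) - f 1 * \<delta>) (at x)"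
        by (rule DERIV_diff[OF df' DERIV_cmult_Id]) (use x s \<alpha> in simp_all)
      ultimately show "\<exists>y. ((\<lambda>s. f s - f 1 * \<delta> * s) has_real_derivative y) (at x) \<and> y \<le> 0" by blast
    qed
    moreover have "f 1 * \<delta> * s \<ge> 0" using flux_pos \<delta> s \<alpha> by simp
    ultimately show ?thesis by (simp add: algebra_simps)
  qed
  show "f 1 * (1 - \<delta>) \<le> f r" by (rule low[OF r])
  show "f r \<le> f 1" by (rule f_mono) (use r \<alpha> in auto)
  show "- v r \<le> f 1 * (1 / r ^ (n - 2) - 1) / (real n - 2)" by (rule flux_upper) (use r \<alpha> in auto)
  define c where "c = f 1 * (1 - \<delta>)"
  have "v r + c / (real n - 2) * (1 / r ^ (n - 2) - 1) \<le> v 1 + c / (real n - 2) * (1 / 1 ^ (n - 2) - 1)"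
  proof (rule nondecreasing_interior[OF r(2), of "\<lambda>r. v r + c / (real n - 2) * (1 / r ^ (n - 2) - 1)"])
    show "continuous_on {r..1} (\<lambda>r. v r + c / (real n - 2) * (1 / r ^ (n - 2) - 1))"
      by (intro continuous_intros continuous_on_subset[OF cont_v]) (use r \<alpha> in auto)
    fix x assume x: "r < x" "x < 1"
    have x0: "x > 0" using x r \<alpha> by simp
    have "((\<lambda>r. v r + c / (real n - 2) * (1 / r ^ (n - 2) - 1)) has_real_derivative
        f x / x ^ (n - 1) + c / (real n - 2) * (- ((real n - 2) / x ^ (n - 1)) - 0)) (at x)"
      by (intro DERIV_add DERIV_cmult DERIV_diff DERIV_fund DERIV_const dv x0 x)
    moreover have "c / x ^ (n - 1) \<le> f x / x ^ (n - 1)"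
      using low[of x] x r x0 unfolding c_def by (intro divide_right_mono) simp_all
    then have "f x / x ^ (n - 1) + c / (real n - 2) * (- ((real n - 2) / x ^ (n - 1)) - 0) \<ge> 0"
      using n7 by simp
    ultimately show "\<exists>y. ((\<lambda>r. v r + c / (real n - 2) * (1 / r ^ (n - 2) - 1)) has_real_derivative y) (at x) \<and> y \<ge> 0"
      by blast
  qed
  then show "f 1 * (1 - \<delta>) * (1 / r ^ (n - 2) - 1) / (real n - 2) \<le> - v r" using v1 by (simp add: c_def)
qed

end

section \<open>Rescaling\<close>

text \<open>The negative part turned upside down and rescaled: Z t = - v (eps t) / M, T = 1 / eps, k
  = lam eps^2 and F = - t^(n-1) Z', which is why the energy is taken with \<open>- F\<close>. The
  last two assumptions are all that is kept of the solution inside \<open>tm\<close>;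
  \<open>C\<close> will depend on the dimension only, hence be common to a whole family.\<close>

locale scaled_profile =
  fixes n :: nat and k tm T C :: real and Z F :: "real \<Rightarrow> real"
  assumes n7: "n \<ge> 7" and k: "k > 0" and tm: "0 < tm" "tm < T" and T1: "T \<ge> 1"
    and cont_Z: "continuous_on {tm..T} Z" and cont_F: "continuous_on {tm..T} F"
    and dZ: "\<And>t. tm < t \<Longrightarrow> t < T \<Longrightarrow> (Z has_real_derivative - (F t / t ^ (n - 1))) (at t)"
    and dF: "\<And>t. tm < t \<Longrightarrow> t < T \<Longrightarrow>
      (F has_real_derivative t ^ (n - 1) * (k * Z t + Z t powr (4 / (real n - 2)) * Z t)) (at t)"
    and Z_tm: "Z tm = 1" and F_tm: "F tm = 0" and Z_T: "Z T = 0"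
    and Z_pos: "\<And>t. tm \<le> t \<Longrightarrow> t < T \<Longrightarrow> Z t > 0"
    and energy_nonneg: "\<And>t. tm \<le> t \<Longrightarrow> t \<le> T \<Longrightarrow> profile_energy n k Z (\<lambda>t. - F t) t \<ge> 0"
    and energy_tm: "profile_energy n k Z (\<lambda>t. - F t) tm \<le> C * k * tm\<^sup>2"
    and tm_small: "tm ^ n \<le> C * (k * T\<^sup>2)"

context radial_profile_min
begin

definition "eps = M powr (- (2 / (real n - 2)))"

lemma eps: "eps > 0" "eps \<le> 1" "eps ^ (n - 2) = 1 / M\<^sup>2" "M powr q = 1 / eps\<^sup>2"
  "M\<^sup>2 * eps ^ n = eps\<^sup>2"
proof -
  show e: "eps > 0" using M0 by (simp add: eps_def)
  have "M powr (- (2 / (real n - 2))) \<le> M powr 0" by (rule powr_mono) (use M_ge_1 n7 in simp_all)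
  then show "eps \<le> 1" using M0 by (simp add: eps_def)
  have "eps ^ (n - 2) = M powr (- (2 / (real n - 2)) * real (n - 2))"
    unfolding powr_realpow[OF e, symmetric] by (simp add: eps_def powr_powr)
  also have "- (2 / (real n - 2)) * real (n - 2) = - 2" using n7 by (simp add: field_simps)
  also have "M powr (- 2) = 1 / M\<^sup>2" using M0 by (simp add: powr_minus divide_inverse)
  finally show e2: "eps ^ (n - 2) = 1 / M\<^sup>2" .
  have "eps\<^sup>2 = M powr (- (2 / (real n - 2)) * real 2)"
    using powr_realpow[OF e, of 2, symmetric] by (simp add: eps_def powr_powr)
  also have "- (2 / (real n - 2)) * real 2 = - q" by (simp add: q_def)
  finally show "M powr q = 1 / eps\<^sup>2" using M0 by (simp add: powr_minus divide_inverse)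
  show "M\<^sup>2 * eps ^ n = eps\<^sup>2" unfolding npow e2 using M0 by (simp add: power2_eq_square)
qed

text \<open>\<open>M powr q\<close> = 1 / eps^2 normalises the power term and turns
  \<open>lam\<close> into \<open>lam * eps^2\<close>. The constant \<open>10 * W0\<close> covers
  both uses: 2 W0 for the energy at the minimum and 9 W0 for its position.\<close>

lemma scaled:
  "scaled_profile n (lam * eps\<^sup>2) (rm / eps) (1 / eps) (10 * W0) (\<lambda>t. - v (eps * t) / M) (\<lambda>t. M * f (eps * t))"
proof -
  define Z where "Z t = - v (eps * t) / M" for t
  define F where "F t = M * f (eps * t)" for t
  define s where "s = 2 * real n / (real n - 2)"
  have s: "s = q + 2" "s > 0" using n7 by (simp_all add: s_def q_def field_simps)
  note e = eps(1)
  have rng: "eps * t > 0" "rm < eps * t" "eps * t < 1" if "rm / eps < t" "t < 1 / eps" for t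
  proof -
    show a: "rm < eps * t" using that(1) e by (simp add: pos_divide_less_eq mult.commute)
    show "eps * t < 1" using that(2) e by (simp add: pos_less_divide_eq mult.commute)
    show "eps * t > 0" using a rm0 by simp
  qed
  have rng': "rm \<le> eps * t" "eps * t \<le> 1" if "rm / eps \<le> t" "t \<le> 1 / eps" for t
    using that e by (simp_all add: pos_divide_le_eq pos_le_divide_eq mult.commute)
  have sub: "(\<lambda>t. eps * t) ` {rm / eps..1 / eps} \<subseteq> {0..1}" using rng' rm0 by force
  have cv: "continuous_on {rm / eps..1 / eps} (\<lambda>t. v (eps * t))"
    by (rule continuous_on_compose2[OF cont_v _ sub]) (intro continuous_intros)
  have cf: "continuous_on {rm / eps..1 / eps} (\<lambda>t. f (eps * t))"
    by (rule continuous_on_compose2[OF cont_f _ sub]) (intro continuous_intros)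
  have vZ: "v (eps * t) = - (M * Z t)" for t using M0 by (simp add: Z_def)
  \<comment> \<open>The energy is invariant under the critical scaling, so the bounds on
    \<open>H\<close> carry over unchanged.\<close>
  have en: "profile_energy n (lam * eps\<^sup>2) Z (\<lambda>t. - F t) t = H (eps * t)" if "t > 0" "Z t \<ge> 0" for t
  proof -
    have p2: "(eps * t) ^ (n - 2) = t ^ (n - 2) / M\<^sup>2" by (simp add: power_mult_distrib eps(3))
    have pn: "(eps * t) ^ n = eps\<^sup>2 * t ^ n / M\<^sup>2"
      using eps(5) M0 by (simp add: power_mult_distrib field_simps)
    have "\<bar>v (eps * t)\<bar> powr s = M powr s * \<bar>Z t\<bar> powr s"
      unfolding vZ using M0 that by (simp add: abs_mult powr_mult)
    also have "M powr s = M\<^sup>2 / eps\<^sup>2" unfolding s(1) using M0 by (simp add: powr_add eps(4))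
    finally have vs: "\<bar>v (eps * t)\<bar> powr s = M\<^sup>2 / eps\<^sup>2 * \<bar>Z t\<bar> powr s" .
    have fF: "f (eps * t) = F t / M" using M0 by (simp add: F_def)
    have t1: "(F t / M)\<^sup>2 / (2 * (t ^ (n - 2) / M\<^sup>2)) = (- F t)\<^sup>2 / (2 * t ^ (n - 2))"
      using M0 that by (simp add: field_simps)
    have t2: "(F t / M) * (- (M * Z t)) = (- F t) * Z t" using M0 by simp
    have t3: "(eps\<^sup>2 * t ^ n / M\<^sup>2) * (M * Z t)\<^sup>2 = eps\<^sup>2 * t ^ n * (Z t)\<^sup>2" using M0 by (simp add: power_mult_distrib)
    have t4: "(eps\<^sup>2 * t ^ n / M\<^sup>2) * (M\<^sup>2 / eps\<^sup>2 * \<bar>Z t\<bar> powr s) = t ^ n * \<bar>Z t\<bar> powr s" using M0 e by simp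
    have "H (eps * t) = (F t / M)\<^sup>2 / (2 * (t ^ (n - 2) / M\<^sup>2)) + (real n - 2) / 2 * ((F t / M) * (- (M * Z t)))
        + lam * ((eps\<^sup>2 * t ^ n / M\<^sup>2) * (M * Z t)\<^sup>2) / 2
        + (eps\<^sup>2 * t ^ n / M\<^sup>2) * (M\<^sup>2 / eps\<^sup>2 * \<bar>Z t\<bar> powr s) / s"
      unfolding profile_energy_def s_def[symmetric] vs p2 pn fF unfolding vZ by (simp add: mult.assoc)
    then show ?thesis unfolding t1 t2 t3 t4 profile_energy_def s_def[symmetric] by (simp add: mult_ac)
  qed
  have Zn: "Z t \<ge> 0" if "rm / eps \<le> t" "t \<le> 1 / eps" for t
    using v_nonpos[OF rng'[OF that]] M0 by (simp add: Z_def divide_nonpos_pos)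
  have tm0: "0 < rm / eps" using rm0 e by simp
  have er: "eps * (rm / eps) = rm" using e by simp
  have "scaled_profile n (lam * eps\<^sup>2) (rm / eps) (1 / eps) (10 * W0) Z F"
  proof
    show "n \<ge> 7" by (rule n7)
    show "0 < lam * eps\<^sup>2" using lam e by simp
    show "0 < rm / eps" by (rule tm0)
    show tmT: "rm / eps < 1 / eps" using rm e by (simp add: divide_strict_right_mono)
    show "1 \<le> 1 / eps" using eps by simp
    show "continuous_on {rm / eps..1 / eps} Z" "continuous_on {rm / eps..1 / eps} F"
      unfolding Z_def[abs_def] F_def[abs_def] using M0 by (intro continuous_intros cv cf; simp)+
    show "Z (rm / eps) = 1" using v_rm unfolding Z_def er M_def by simp
    show "F (rm / eps) = 0" unfolding F_def er f_rm by simp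
    show "Z (1 / eps) = 0" using e by (simp add: Z_def v1)
    show "Z t > 0" if t: "rm / eps \<le> t" "t < 1 / eps" for t
    proof -
      have "rm \<le> eps * t" "eps * t < 1"
        using t e by (simp_all add: pos_divide_le_eq pos_less_divide_eq mult.commute)
      then show ?thesis using v_neg M0 by (simp add: Z_def divide_neg_pos)
    qed
    show "profile_energy n (lam * eps\<^sup>2) Z (\<lambda>t. - F t) t \<ge> 0" if "rm / eps \<le> t" "t \<le> 1 / eps" for t
      using en[OF _ Zn[OF that]] H_nonneg[of "eps * t"] rng'[OF that] rm0 tm0 that by simp
    have H_rm: "profile_energy n (lam * eps\<^sup>2) Z (\<lambda>t. - F t) (rm / eps) = H rm"
      using en[OF tm0 Zn] tmT unfolding er by simp
    have "H rm \<le> 2 * W0 * lam * rm\<^sup>2" using H_le_square[of rm] rm0 rm by simp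
    also have "\<dots> \<le> 10 * W0 * lam * rm\<^sup>2" using W0_pos lam by (intro mult_right_mono) simp_all
    also have "\<dots> = 10 * W0 * (lam * eps\<^sup>2) * (rm / eps)\<^sup>2" using e by (simp add: power_divide)
    finally show "profile_energy n (lam * eps\<^sup>2) Z (\<lambda>t. - F t) (rm / eps) \<le> 10 * W0 * (lam * eps\<^sup>2) * (rm / eps)\<^sup>2"
      unfolding H_rm .
    \<comment> \<open>At \<open>rm\<close> the flux vanishes and the remaining terms are
      nonnegative, so \<open>H rm\<close> is at least the power term rm^n M^s / s = (rm / eps)^n /
      s. The bound s \<le> 3 on the critical exponent turns 3 W0 lam into 9 W0 lam.\<close>
    show "(rm / eps) ^ n \<le> 10 * W0 * (lam * eps\<^sup>2 * (1 / eps)\<^sup>2)"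
    proof -
      have "H rm \<ge> rm ^ n * \<bar>v rm\<bar> powr s / s"
        using lam rm0 unfolding profile_energy_def s_def f_rm by simp
      also have "\<bar>v rm\<bar> powr s = M powr s" using v_rm by (simp add: M_def)
      also have "M powr s = M\<^sup>2 / eps\<^sup>2" unfolding s(1) using M0 by (simp add: powr_add eps(4))
      also have "\<dots> = 1 / eps ^ n" using eps(5) e M0 by (simp add: field_simps)
      finally have "(rm / eps) ^ n / s \<le> H rm" by (simp add: power_divide)
      also have "H rm \<le> 3 * W0 * lam" using H_le[of rm] rm0 rm by simp
      finally have "(rm / eps) ^ n \<le> 3 * W0 * lam * s" using s(2) by (simp add: pos_divide_le_eq)
      also have "\<dots> \<le> 3 * W0 * lam * 3"
        using W0_pos lam n7 by (intro mult_left_mono) (simp_all add: s_def field_simps)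
      also have "\<dots> \<le> 10 * W0 * lam" using W0_pos lam by simp
      finally show ?thesis using e by (simp add: power_divide)
    qed
    fix t assume t: "rm / eps < t" "t < 1 / eps"
    have t0: "t > 0" using t(1) tm0 by simp
    have m: "((\<lambda>t. eps * t) has_real_derivative eps) (at t)" by (rule DERIV_cmult_Id)
    have dvt: "((\<lambda>t. v (eps * t)) has_real_derivative f (eps * t) / (eps * t) ^ (n - 1) * eps) (at t)"
      by (rule DERIV_chain2[OF dv m]) (use rng[OF t] in simp_all)
    have "(Z has_real_derivative - (f (eps * t) / (eps * t) ^ (n - 1) * eps) / M) (at t)"
      unfolding Z_def[abs_def] by (intro DERIV_cdivide DERIV_minus dvt)
    moreover have "(eps * t) ^ (n - 1) = eps / M\<^sup>2 * t ^ (n - 1)"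
      unfolding power_mult_distrib npow(1)[of eps] eps(3) by simp
    then have "- (f (eps * t) / (eps * t) ^ (n - 1) * eps) / M = - (F t / t ^ (n - 1))"
      using e M0 t0 by (simp add: F_def power2_eq_square)
    ultimately show "(Z has_real_derivative - (F t / t ^ (n - 1))) (at t)" by simp
    have "(F has_real_derivative M * (((eps * t) ^ (n - 1) * (lam * (- v (eps * t)) + (- v (eps * t)) powr q * (- v (eps * t)))) * eps)) (at t)"
      unfolding F_def[abs_def] by (intro DERIV_cmult DERIV_chain2[OF df' m]) (use rng[OF t] in simp_all)
    moreover have "M * (((eps * t) ^ (n - 1) * (lam * (- v (eps * t)) + (- v (eps * t)) powr q * (- v (eps * t)))) * eps)
       = t ^ (n - 1) * (lam * eps\<^sup>2 * Z t + Z t powr (4 / (real n - 2)) * Z t)"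
    proof -
      have A: "(- v (eps * t)) powr q = Z t powr q / eps\<^sup>2"
        unfolding vZ using M0 Zn[of t] t by (simp add: powr_mult eps(4))
      have B: "(eps * t) ^ (n - 1) = eps / M\<^sup>2 * t ^ (n - 1)"
        unfolding power_mult_distrib npow(1)[of eps] eps(3) by simp
      show ?thesis unfolding q_def[symmetric] A B
        unfolding vZ using M0 e by (simp add: field_simps power2_eq_square)
    qed
    ultimately show "(F has_real_derivative t ^ (n - 1) * (lam * eps\<^sup>2 * Z t + Z t powr (4 / (real n - 2)) * Z t)) (at t)"
      by simp
  qed
  then show ?thesis unfolding Z_def[abs_def] F_def[abs_def] .
qed

end

section \<open>The limiting bubble\<close>

definition std_bubble :: "nat \<Rightarrow> real \<Rightarrow> real" where
  "std_bubble n t = (1 + t\<^sup>2 / (real n * (real n - 2))) powr (- ((real n - 2) / 2))"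

definition std_bubble' :: "nat \<Rightarrow> real \<Rightarrow> real" where
  "std_bubble' n t = - (t / n) * (1 + t\<^sup>2 / (real n * (real n - 2))) powr (- (real n / 2))"

definition bubble_base :: "nat \<Rightarrow> real \<Rightarrow> real" where
  "bubble_base n t = 1 + t\<^sup>2 / (real n * (real n - 2))"

text \<open>The value \<mu>^2 = n (n-2) is the one that normalises the bubble to 1 at its centre,
  matching the normalisation of the rescaled profile at its maximum.\<close>

lemma bubble_eq_std_bubble:
  assumes "n \<ge> 3"
  shows "bubble n (sqrt (real n * (real n - 2))) t = std_bubble n t"
proof -
  define p where "p = real n * (real n - 2)"
  have p: "p > 0" using assms by (simp add: p_def)
  have "(p * p) powr ((real n - 2) / 4) = (p powr 2) powr ((real n - 2) / 4)"
    using p by (simp add: power2_eq_square)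
  also have "\<dots> = p powr ((real n - 2) / 2)" unfolding powr_powr by (rule arg_cong[where f="\<lambda>x. p powr x"]) (simp add: field_simps)
  finally have *: "(p * p) powr ((real n - 2) / 4) = p powr ((real n - 2) / 2)" .
  define b where "b = 1 + t\<^sup>2 / p"
  have b: "b > 0" "p + t\<^sup>2 = p * b" using p by (simp_all add: b_def add_pos_nonneg field_simps)
  have mu: "(sqrt p)\<^sup>2 = p" using p by simp
  have "(p * b) powr ((real n - 2) / 2) = p powr ((real n - 2) / 2) * b powr ((real n - 2) / 2)"
    using p b(1) by (simp add: powr_mult)
  then show ?thesis
    unfolding bubble_def std_bubble_def p_def[symmetric] mu b(2) b_def[symmetric] *
    using p by (simp add: powr_minus inverse_eq_divide)
qed

lemma c1_eq: "n \<ge> 3 \<Longrightarrow> c1 n = (LBINT s:{0..}. std_bubble n s powr (1 + 4 / (real n - 2)) * s ^ (n - 1))"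
proof -
  assume n: "n \<ge> 3"
  have "critical_exponent n - 1 = 1 + 4 / (real n - 2)" using n by (simp add: critical_exponent_def field_simps)
  then show ?thesis unfolding c1_def Let_def bubble_eq_std_bubble[OF n] by simp
qed

lemma c2_eq: "n \<ge> 3 \<Longrightarrow> c2 n = 2 * (LBINT s:{0..}. std_bubble n s powr 2 * s ^ (n - 1))"
proof -
  assume n: "n \<ge> 3"
  have "std_bubble n s > 0" for s
    using n by (simp add: std_bubble_def add_pos_nonneg less_imp_neq[symmetric])
  then have "std_bubble n s powr 2 = (std_bubble n s)\<^sup>2" for s
    by (simp add: less_imp_le)
  then show ?thesis unfolding c2_def Let_def bubble_eq_std_bubble[OF n] by simp
qed

context
  fixes n :: nat
  assumes n7: "n \<ge> 7"
begin

lemma bubble_base_ge_1: "bubble_base n t \<ge> 1" using n7 by (simp add: bubble_base_def)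

lemma std_bubble_pos: "std_bubble n t > 0" using bubble_base_ge_1[of t] by (simp add: std_bubble_def bubble_base_def[symmetric])

lemma std_bubble_le_1: "std_bubble n t \<le> 1"
proof -
  have "bubble_base n t powr (- ((real n - 2) / 2)) \<le> bubble_base n t powr 0"
    using n7 bubble_base_ge_1[of t] by (intro powr_mono) auto
  then show ?thesis using bubble_base_ge_1[of t] by (simp add: std_bubble_def bubble_base_def[symmetric])
qed

lemma std_bubble_antimono: "0 \<le> s \<Longrightarrow> s \<le> t \<Longrightarrow> std_bubble n t \<le> std_bubble n s"
proof -
  assume st: "0 \<le> s" "s \<le> t"
  have "bubble_base n s \<le> bubble_base n t" unfolding bubble_base_def using n7 st by (intro add_left_mono divide_right_mono power_mono) auto
  then show ?thesis unfolding std_bubble_def bubble_base_def[symmetric]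
    using n7 bubble_base_ge_1[of s] by (intro powr_mono2') auto
qed

lemma DERIV_std_bubble: "(std_bubble n has_real_derivative std_bubble' n t) (at t)"
proof -
  have dY: "(bubble_base n has_real_derivative 2 * t / (real n * (real n - 2))) (at t)"
    unfolding bubble_base_def[abs_def] using n7 by (auto intro!: derivative_eq_intros)
  have "((\<lambda>t. bubble_base n t powr (- ((real n - 2) / 2))) has_real_derivative
      - ((real n - 2) / 2) * bubble_base n t powr (- ((real n - 2) / 2) - 1) * (2 * t / (real n * (real n - 2)))) (at t)"
    by (rule DERIV_chain2[OF has_real_derivative_powr dY]) (use bubble_base_ge_1[of t] in simp)
  moreover have "- ((real n - 2) / 2) - 1 = - (real n / 2)" by (simp add: field_simps)
  moreover have "- ((real n - 2) / 2) * y * (2 * t / (real n * (real n - 2))) = - (t / n) * y" for y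
    using n7 by (simp add: field_simps)
  ultimately show ?thesis
    unfolding std_bubble_def[abs_def] std_bubble'_def bubble_base_def[symmetric] by simp
qed

lemma DERIV_std_bubble':
  assumes "t > 0"
  shows "(std_bubble' n has_real_derivative - (std_bubble n t powr (4 / (real n - 2)) * std_bubble n t) - (real n - 1) / t * std_bubble' n t) (at t)"
proof -
  have dY: "(bubble_base n has_real_derivative 2 * t / (real n * (real n - 2))) (at t)"
    unfolding bubble_base_def[abs_def] using n7 by (auto intro!: derivative_eq_intros)
  have dp: "((\<lambda>t. bubble_base n t powr (- (real n / 2))) has_real_derivative
      - (real n / 2) * bubble_base n t powr (- (real n / 2) - 1) * (2 * t / (real n * (real n - 2)))) (at t)"
    by (rule DERIV_chain2[OF has_real_derivative_powr dY]) (use bubble_base_ge_1[of t] in simp)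
  define A where "A = bubble_base n t powr (- (real n / 2) - 1)"
  have A: "bubble_base n t powr (- (real n / 2)) = bubble_base n t * A"
    using bubble_base_ge_1[of t] by (simp add: A_def powr_diff)
  have UU: "std_bubble n t powr (4 / (real n - 2)) * std_bubble n t = A"
  proof -
    have "std_bubble n t powr (4 / (real n - 2)) * std_bubble n t = bubble_base n t powr (- ((real n - 2) / 2) * (4 / (real n - 2)) + - ((real n - 2) / 2))"
      unfolding std_bubble_def bubble_base_def[symmetric] powr_powr powr_add ..
    also have "- ((real n - 2) / 2) * (4 / (real n - 2)) + - ((real n - 2) / 2) = - (real n / 2) - 1"
      using n7 by (simp add: field_simps)
    finally show ?thesis by (simp add: A_def)
  qed
  have "((\<lambda>t. - (t / n) * bubble_base n t powr (- (real n / 2))) has_real_derivative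
     (- (1 / n)) * bubble_base n t powr (- (real n / 2)) + (- (real n / 2) * A * (2 * t / (real n * (real n - 2)))) * (- (t / n))) (at t)"
    by (rule DERIV_mult[OF _ dp[folded A_def]]) (use n7 in \<open>auto intro!: derivative_eq_intros\<close>)
  moreover have "(- (1 / n)) * (bubble_base n t * A) + (- (real n / 2) * A * (2 * t / (real n * (real n - 2)))) * (- (t / n))
      = - A - (real n - 1) / t * (- (t / n) * (bubble_base n t * A))"
  proof -
    have E1: "(- (real n / 2) * A * (2 * t / (real n * (real n - 2)))) * (- (t / n)) = A * (bubble_base n t - 1)"
      using n7 by (simp add: bubble_base_def field_simps power2_eq_square)
    have E2: "(real n - 1) / t * (- (t / n) * (bubble_base n t * A)) = - ((real n - 1) / n) * (bubble_base n t * A)"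
      using assms by simp
    show ?thesis unfolding E1 E2 using n7 by (simp add: field_simps)
  qed
  ultimately show ?thesis
    unfolding UU unfolding std_bubble'_def[abs_def] bubble_base_def[symmetric] A by simp
qed

lemma std_bubble'_bound: "t \<ge> 0 \<Longrightarrow> \<bar>std_bubble' n t\<bar> \<le> t / n"
proof -
  assume t: "t \<ge> 0"
  have "bubble_base n t powr (- (real n / 2)) \<le> bubble_base n t powr 0" using n7 bubble_base_ge_1[of t] by (intro powr_mono) auto
  then have "bubble_base n t powr (- (real n / 2)) \<le> 1" using bubble_base_ge_1[of t] by simp
  then have "t / n * bubble_base n t powr (- (real n / 2)) \<le> t / n * 1" using t by (intro mult_left_mono) auto
  then show ?thesis using t by (simp add: std_bubble'_def bubble_base_def[symmetric] abs_mult)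
qed

lemma std_bubble_near_0: "t \<ge> 0 \<Longrightarrow> 1 - std_bubble n t \<le> t\<^sup>2 / (2 * n)"
proof -
  assume t: "t \<ge> 0"
  have "std_bubble n 0 + 0\<^sup>2 / (2 * n) \<le> std_bubble n t + t\<^sup>2 / (2 * n)"
  proof (rule DERIV_nonneg_imp_nondecreasing[OF t, of "\<lambda>t. std_bubble n t + t\<^sup>2 / (2 * n)"])
    fix x assume "0 \<le> x" "x \<le> t"
    have "((\<lambda>t. std_bubble n t + t\<^sup>2 / (2 * n)) has_real_derivative std_bubble' n x + x / n) (at x)"
      using n7 by (intro DERIV_add DERIV_std_bubble) (auto intro!: derivative_eq_intros)
    moreover have "std_bubble' n x + x / n \<ge> 0" using std_bubble'_bound[of x] \<open>0 \<le> x\<close> by simp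
    ultimately show "\<exists>y. ((\<lambda>t. std_bubble n t + t\<^sup>2 / (2 * n)) has_real_derivative y) (at x) \<and> y \<ge> 0" by blast
  qed
  then show ?thesis by (simp add: std_bubble_def)
qed

text \<open>At the radius \<open>n\<^sup>2\<close> the bubble is already past the peak of \<open>t\<^sup>(\<^sup>n\<^sup>-\<^sup>2\<^sup>)\<^sup>/\<^sup>2 std_bubble n\<close>.\<close>

lemma std_bubble_at_square:
  defines "K \<equiv> (real n)\<^sup>2"
  shows "K\<^sup>2 * std_bubble n K powr (4 / (real n - 2)) < 1" "(real n - 2) / 2 * std_bubble n K < - (K * std_bubble' n K)"
proof -
  have K: "K \<ge> 49" using power_mono[of 7 "real n" 2] n7 by (simp add: K_def)
  define p where "p = real n * (real n - 2)"
  have p: "p > 0" "p < K" using n7 by (auto simp: p_def K_def power2_eq_square)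
  \<comment> \<open>This power is 1 / \<open>bubble_base\<close>^2, so the first claim reduces to K
    < 1 + K^2 / (n (n-2)), which holds because K = n^2 exceeds n (n-2).\<close>
  have "std_bubble n K powr (4 / (real n - 2)) = bubble_base n K powr (- ((real n - 2) / 2) * (4 / (real n - 2)))"
    unfolding std_bubble_def bubble_base_def[symmetric] powr_powr ..
  also have "- ((real n - 2) / 2) * (4 / (real n - 2)) = - 2" using n7 by (simp add: field_simps)
  also have "bubble_base n K powr (- 2) = 1 / (bubble_base n K)\<^sup>2" using bubble_base_ge_1[of K] by (simp add: powr_minus divide_inverse)
  finally have e: "std_bubble n K powr (4 / (real n - 2)) = 1 / (bubble_base n K)\<^sup>2" .
  have "K * p < K * K" using p K by simp
  also have "\<dots> \<le> bubble_base n K * p" using p by (simp add: bubble_base_def p_def[symmetric] field_simps power2_eq_square)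
  finally have "K < bubble_base n K" using p by simp
  then have "K\<^sup>2 < (bubble_base n K)\<^sup>2" using K by (intro power_strict_mono) auto
  then show "K\<^sup>2 * std_bubble n K powr (4 / (real n - 2)) < 1" unfolding e using K by (simp add: divide_less_eq)
  define A where "A = bubble_base n K powr (- (real n / 2))"
  have A: "A > 0" using bubble_base_ge_1[of K] by (simp add: A_def)
  have UK: "std_bubble n K = bubble_base n K * A"
  proof -
    have "std_bubble n K = bubble_base n K powr (1 + - (real n / 2))"
      unfolding std_bubble_def bubble_base_def[symmetric] by (rule arg_cong[where f="\<lambda>x. bubble_base n K powr x"]) (simp add: field_simps)
    also have "\<dots> = bubble_base n K * A" using bubble_base_ge_1[of K] unfolding powr_add A_def by simp
    finally show ?thesis .
  qed
  have "(real n - 2) / 2 * bubble_base n K < K\<^sup>2 / n"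
  proof -
    have "(real n - 2) / 2 * bubble_base n K = (real n - 2) / 2 + K\<^sup>2 / (2 * n)"
      using n7 by (simp add: bubble_base_def field_simps)
    moreover have "p < K\<^sup>2" using p(2) K power_increasing[of 1 2 K] by simp
    then have "(real n - 2) / 2 < K\<^sup>2 / (2 * n)" using n7 by (simp add: p_def field_simps)
    ultimately show ?thesis using n7 by (simp add: field_simps)
  qed
  then have "(real n - 2) / 2 * bubble_base n K * A < K\<^sup>2 / n * A" using A by (rule mult_strict_right_mono)
  then show "(real n - 2) / 2 * std_bubble n K < - (K * std_bubble' n K)"
    unfolding UK std_bubble'_def bubble_base_def[symmetric] A_def[symmetric] by (simp add: power2_eq_square mult_ac)
qed

end

text \<open>On the unit interval the derivative (q + 1) z^q is at most 2. It controls the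
  nonlinearity in the Gronwall comparison with the bubble.\<close>

lemma powr_Lipschitz:
  fixes x y q :: real
  assumes "0 < x" "x \<le> 1" "0 < y" "y \<le> 1" "0 < q" "q \<le> 1"
  shows "\<bar>x powr q * x - y powr q * y\<bar> \<le> 2 * \<bar>x - y\<bar>"
proof -
  have *: "\<bar>x powr (q + 1) - y powr (q + 1)\<bar> \<le> 2 * \<bar>x - y\<bar>" if xy: "0 < x" "x < y" "y \<le> 1" for x y
  proof -
    have "\<exists>z>x. z < y \<and> y powr (q + 1) - x powr (q + 1) = (y - x) * ((q + 1) * z powr (q + 1 - 1))"
      by (rule MVT2[OF xy(2)]) (rule has_real_derivative_powr, use xy in simp)
    then obtain z where z: "x < z" "z < y" "y powr (q + 1) - x powr (q + 1) = (y - x) * ((q + 1) * z powr q)"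
      by auto
    have "z powr q \<le> 1 powr q" by (rule powr_mono2) (use z xy assms in auto)
    then have "(q + 1) * z powr q \<le> 2 * 1" using assms by (intro mult_mono) auto
    then have "(y - x) * ((q + 1) * z powr q) \<le> (y - x) * 2" using xy by (intro mult_left_mono) auto
    moreover have "(y - x) * ((q + 1) * z powr q) \<ge> 0" using xy assms by simp
    ultimately show ?thesis using z(3) xy by simp
  qed
  have "\<bar>x powr (q + 1) - y powr (q + 1)\<bar> \<le> 2 * \<bar>x - y\<bar>"
    using *[of x y] *[of y x] assms by (cases x y rule: linorder_cases) (simp_all add: abs_minus_commute)
  then show ?thesis using assms by (simp add: powr_add)
qed

section \<open>Closeness to the bubble on bounded intervals\<close>

context scaled_profile
begin

definition "q = 4 / (real n - 2)"

lemma q: "0 < q" "q \<le> 1" using n7 by (simp_all add: q_def field_simps)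

lemma npow: "x ^ (n - 1) = x * x ^ (n - 2)" "x ^ n = x * x * x ^ (n - 2)" for x :: real
proof -
  have "n - 1 = Suc (n - 2)" "n = Suc (Suc (n - 2))" using n7 by simp_all
  then show "x ^ (n - 1) = x * x ^ (n - 2)" "x ^ n = x * x * x ^ (n - 2)"
    by (metis power_Suc, metis power_Suc mult.assoc)
qed

lemma F_mono:
  assumes "tm \<le> r" "r \<le> s" "s \<le> T"
  shows "F r \<le> F s"
proof (rule nondecreasing_interior[OF assms(2)])
  show "continuous_on {r..s} F" by (rule continuous_on_subset[OF cont_F]) (use assms in simp)
  fix x assume x: "r < x" "x < s"
  have x': "tm < x" "x < T" using x assms by auto
  have "0 \<le> x ^ (n - 1) * (k * Z x + Z x powr (4 / (real n - 2)) * Z x)"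
    using Z_pos[of x] k tm x' by (intro mult_nonneg_nonneg add_nonneg_nonneg zero_le_power) simp_all
  then show "\<exists>y. (F has_real_derivative y) (at x) \<and> y \<ge> 0" using dF[OF x'] by blast
qed

lemma F_nonneg: "tm \<le> t \<Longrightarrow> t \<le> T \<Longrightarrow> F t \<ge> 0" using F_mono[of tm t] F_tm by simp

lemma Z_nonneg: "tm \<le> t \<Longrightarrow> t \<le> T \<Longrightarrow> Z t \<ge> 0"
  using Z_pos[of t] Z_T by (cases "t = T") auto

lemma Z_le_1:
  assumes "tm \<le> t" "t \<le> T"
  shows "Z t \<le> 1"
proof -
  have "Z t \<le> Z tm"
  proof (rule nonincreasing_interior[OF assms(1)])
    show "continuous_on {tm..t} Z" by (rule continuous_on_subset[OF cont_Z]) (use assms in simp)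
    fix x assume x: "tm < x" "x < t"
    then have "- (F x / x ^ (n - 1)) \<le> 0" using F_nonneg[of x] tm assms by simp
    then show "\<exists>y. (Z has_real_derivative y) (at x) \<and> y \<le> 0" using dZ[of x] x assms by (intro exI conjI) auto
  qed
  then show ?thesis using Z_tm by simp
qed

text \<open>Gronwall for N = e^2 + d^2, the squared differences of values and of derivatives. The
  initial error is at most 2 tm^2 because the bubble is flat at 0; the perturbation k Z, at most k,
  contributes k^2 t.\<close>

lemma close_to_bubble:
  assumes tm1: "tm \<le> 1" and t: "tm \<le> t" "t \<le> T"
  shows "(Z t - std_bubble n t)\<^sup>2 + (F t / t ^ (n - 1) + std_bubble' n t)\<^sup>2 \<le> (2 * tm\<^sup>2 + k\<^sup>2 * t) * exp (4 * t)"
proof -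
  define e where "e t = Z t - std_bubble n t" for t
  define d where "d t = - (F t / t ^ (n - 1)) - std_bubble' n t" for t
  define N where "N t = (e t)\<^sup>2 + (d t)\<^sup>2" for t
  have N_tm: "N tm \<le> 2 * tm\<^sup>2"
  proof -
    have a: "0 \<le> 1 - std_bubble n tm" using std_bubble_le_1[OF n7] by simp
    have "1 - std_bubble n tm \<le> tm\<^sup>2 / (2 * n)" using std_bubble_near_0[OF n7, of tm] tm by simp
    also have "\<dots> \<le> tm\<^sup>2 / 1" using n7 by (intro divide_left_mono) auto
    also have "tm\<^sup>2 / 1 \<le> tm" using tm1 tm by (simp add: power2_eq_square mult_left_le)
    finally have "(1 - std_bubble n tm)\<^sup>2 \<le> tm\<^sup>2" using a by (intro power_mono) auto
    moreover have "\<bar>std_bubble' n tm\<bar> \<le> tm / n" using std_bubble'_bound[OF n7, of tm] tm by simp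
    then have "\<bar>std_bubble' n tm\<bar> \<le> \<bar>tm\<bar>"
      using tm n7 divide_left_mono[of 1 "real n" tm] by simp
    then have "(std_bubble' n tm)\<^sup>2 \<le> tm\<^sup>2" by (rule abs_le_square_iff[THEN iffD1])
    ultimately show ?thesis by (simp add: N_def e_def d_def Z_tm F_tm)
  qed
  have cU: "continuous_on S (std_bubble n)" for S
    by (intro continuous_at_imp_continuous_on ballI DERIV_isCont[OF DERIV_std_bubble[OF n7]])
  have cU': "continuous_on {tm..T} (std_bubble' n)"
    by (intro continuous_at_imp_continuous_on ballI DERIV_isCont[OF DERIV_std_bubble'[OF n7]]) (use tm in simp)
  have cd: "continuous_on {tm..T} d"
    unfolding d_def[abs_def] by (intro continuous_intros cont_F cU') (use tm in auto)
  have ce: "continuous_on {tm..T} e"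
    unfolding e_def[abs_def] by (intro continuous_intros cont_Z cU)
  have "exp (- 4 * t) * N t - k\<^sup>2 * t \<le> exp (- 4 * tm) * N tm - k\<^sup>2 * tm"
  proof (rule nonincreasing_interior[OF t(1), of "\<lambda>t. exp (- 4 * t) * N t - k\<^sup>2 * t"])
    show "continuous_on {tm..t} (\<lambda>t. exp (- 4 * t) * N t - k\<^sup>2 * t)"
      unfolding N_def by (intro continuous_intros continuous_on_subset[OF ce] continuous_on_subset[OF cd]) (use t in auto)
    fix x assume x: "tm < x" "x < t"
    have x': "tm < x" "x < T" "x > 0" using x t tm by auto
    define g where "g = k * Z x + (Z x powr q * Z x - std_bubble n x powr q * std_bubble n x)"
    have de: "(e has_real_derivative d x) (at x)"
      unfolding e_def[abs_def] d_def by (intro DERIV_diff dZ DERIV_std_bubble n7 x')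
    have dG: "((\<lambda>t. F t / t ^ (n - 1)) has_real_derivative
        (k * Z x + Z x powr q * Z x) - (real n - 1) / x * (F x / x ^ (n - 1))) (at x)"
    proof (rule DERIV_cong[OF DERIV_divide[OF dF[OF x'(1,2), folded q_def] DERIV_pow]])
      define R where "R = x ^ (n - 2)"
      have R: "R > 0" using x' by (simp add: R_def)
      have "n - 1 - Suc 0 = n - 2" "real (n - 1) = real n - 1" using n7 by auto
      then show "(x ^ (n - 1) * (k * Z x + Z x powr q * Z x) * x ^ (n - 1) - F x * (real (n - 1) * x ^ (n - 1 - Suc 0))) /
          (x ^ (n - 1) * x ^ (n - 1)) = (k * Z x + Z x powr q * Z x) - (real n - 1) / x * (F x / x ^ (n - 1))"
        using x' R unfolding npow(1) by (simp add: R_def[symmetric]) (simp add: field_simps)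
    qed (use x' in simp)
    have dd: "(d has_real_derivative - g - (real n - 1) / x * d x) (at x)"
      unfolding d_def[abs_def] using DERIV_diff[OF DERIV_minus[OF dG] DERIV_std_bubble'[OF n7 x'(3)], folded q_def]
      by (rule DERIV_cong) (simp add: g_def d_def algebra_simps)
    have "\<bar>g\<bar> \<le> k + 2 * \<bar>e x\<bar>"
    proof -
      have z: "0 < Z x" "Z x \<le> 1" using Z_pos[of x] Z_le_1[of x] x' by auto
      have "\<bar>g\<bar> \<le> \<bar>k * Z x\<bar> + \<bar>Z x powr q * Z x - std_bubble n x powr q * std_bubble n x\<bar>"
        unfolding g_def by (rule abs_triangle_ineq)
      also have "\<bar>k * Z x\<bar> \<le> k" using k z by (simp add: abs_mult mult_left_le)
      also have "\<bar>Z x powr q * Z x - std_bubble n x powr q * std_bubble n x\<bar> \<le> 2 * \<bar>e x\<bar>"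
        unfolding e_def by (rule powr_Lipschitz[OF z std_bubble_pos[OF n7] std_bubble_le_1[OF n7] q])
      finally show ?thesis by simp
    qed
    then have gd: "\<bar>d x * g\<bar> \<le> \<bar>d x\<bar> * (k + 2 * \<bar>e x\<bar>)"
      unfolding abs_mult by (rule mult_left_mono) simp
    have "2 * e x * d x + 2 * d x * (- g - (real n - 1) / x * d x) \<le> 4 * N x + k\<^sup>2"
    proof -
      \<comment> \<open>The friction coefficient is singular as the starting radius tends to 0, but
        its term has the favourable sign and is dropped. Young's inequality on what remains gives
        the rate 4.\<close>
      define c where "c = (real n - 1) / x"
      have "c * (d x)\<^sup>2 \<ge> 0" using n7 x' by (simp add: c_def)
      then have "2 * e x * d x + 2 * d x * (- g - (real n - 1) / x * d x) \<le> 2 * (e x * d x) - 2 * (d x * g)"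
        unfolding c_def[symmetric] by (simp add: algebra_simps power2_eq_square)
      also have "\<dots> \<le> 2 * (\<bar>e x\<bar> * \<bar>d x\<bar>) + 2 * (\<bar>d x\<bar> * (k + 2 * \<bar>e x\<bar>))"
        using gd abs_le_D1[of "e x * d x" "\<bar>e x\<bar> * \<bar>d x\<bar>"] abs_ge_minus_self[of "d x * g"] by (simp add: abs_mult)
      also have "\<dots> = 6 * (\<bar>e x\<bar> * \<bar>d x\<bar>) + 2 * (\<bar>d x\<bar> * k)" by (simp add: algebra_simps)
      also have "\<dots> \<le> 3 * ((e x)\<^sup>2 + (d x)\<^sup>2) + ((d x)\<^sup>2 + k\<^sup>2)"
      proof -
        have "2 * (\<bar>e x\<bar> * \<bar>d x\<bar>) \<le> (e x)\<^sup>2 + (d x)\<^sup>2"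
          using sum_squares_bound[of "\<bar>e x\<bar>" "\<bar>d x\<bar>"] by (simp add: mult.assoc)
        moreover have "2 * (\<bar>d x\<bar> * k) \<le> (d x)\<^sup>2 + k\<^sup>2"
          using sum_squares_bound[of "\<bar>d x\<bar>" k] by (simp add: mult.assoc)
        moreover have "3 * (2 * (\<bar>e x\<bar> * \<bar>d x\<bar>)) \<le> 3 * ((e x)\<^sup>2 + (d x)\<^sup>2)"
          by (rule mult_left_mono[OF \<open>2 * (\<bar>e x\<bar> * \<bar>d x\<bar>) \<le> (e x)\<^sup>2 + (d x)\<^sup>2\<close>]) simp
        ultimately have "3 * (2 * (\<bar>e x\<bar> * \<bar>d x\<bar>)) + 2 * (\<bar>d x\<bar> * k) \<le> 3 * ((e x)\<^sup>2 + (d x)\<^sup>2) + ((d x)\<^sup>2 + k\<^sup>2)"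
          by (intro add_mono)
        then show ?thesis by simp
      qed
      also have "\<dots> \<le> 4 * N x + k\<^sup>2" by (simp add: N_def)
      finally show ?thesis .
    qed
    then have "exp (- 4 * x) * (2 * e x * d x + 2 * d x * (- g - (real n - 1) / x * d x) - 4 * N x) \<le> exp (- 4 * x) * k\<^sup>2"
      by (intro mult_left_mono) auto
    also have "\<dots> \<le> 1 * k\<^sup>2" by (rule mult_right_mono) (use x' in auto)
    finally have le: "exp (- 4 * x) * (2 * e x * d x + 2 * d x * (- g - (real n - 1) / x * d x) - 4 * N x) - k\<^sup>2 \<le> 0" by simp
    have dN: "(N has_real_derivative 2 * e x * d x + 2 * d x * (- g - (real n - 1) / x * d x)) (at x)"
      unfolding N_def[abs_def] by (rule derivative_eq_intros de dd refl)+ simp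
    have dE: "((\<lambda>t. exp (- 4 * t)) has_real_derivative - 4 * exp (- 4 * x)) (at x)"
      by (auto intro!: derivative_eq_intros)
    have "((\<lambda>t. exp (- 4 * t) * N t - k\<^sup>2 * t) has_real_derivative
        exp (- 4 * x) * (2 * e x * d x + 2 * d x * (- g - (real n - 1) / x * d x) - 4 * N x) - k\<^sup>2) (at x)"
      by (rule DERIV_cong[OF DERIV_diff[OF DERIV_mult[OF dE dN] DERIV_cmult_Id]]) (simp add: algebra_simps)
    with le show "\<exists>y. ((\<lambda>t. exp (- 4 * t) * N t - k\<^sup>2 * t) has_real_derivative y) (at x) \<and> y \<le> 0" by blast
  qed
  also have "\<dots> \<le> exp (- 4 * tm) * N tm" using tm by simp
  also have "\<dots> \<le> 1 * N tm" by (rule mult_right_mono) (use tm in \<open>auto simp: N_def\<close>)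
  finally have "exp (- 4 * t) * N t \<le> 2 * tm\<^sup>2 + k\<^sup>2 * t" using N_tm by simp
  then have "exp (4 * t) * (exp (- 4 * t) * N t) \<le> exp (4 * t) * (2 * tm\<^sup>2 + k\<^sup>2 * t)" by simp
  then have "N t \<le> (2 * tm\<^sup>2 + k\<^sup>2 * t) * exp (4 * t)"
  proof -
    have "exp (4 * t) * (exp (- 4 * t) * N t) = N t"
      by (simp add: mult.assoc[symmetric] exp_add[symmetric])
    then show ?thesis using \<open>exp (4 * t) * (exp (- 4 * t) * N t) \<le> _\<close> by (simp only: mult.commute)
  qed
  moreover have "(F t / t ^ (n - 1) + std_bubble' n t)\<^sup>2 = (d t)\<^sup>2"
    by (simp add: d_def power2_eq_square algebra_simps)
  ultimately show ?thesis by (simp add: N_def e_def)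
qed

end

section \<open>Decay past the peak and the two integral identities\<close>

context scaled_profile
begin

text \<open>The logarithmic slope \<open>y = F / (t\<^sup>n\<^sup>-\<^sup>2 Z)\<close> satisfies \<open>y\<^sup>2 - (n - 2) y + small \<ge> 0\<close> by nonnegativity of
  the energy, so once it exceeds the middle of the forbidden interval it stays close to \<open>n - 2\<close>.\<close>

lemma slope_inequality:
  assumes t: "tm \<le> t" "t < T" and F: "F t = y * (t ^ (n - 2) * Z t)"
  shows "0 \<le> y\<^sup>2 - (real n - 2) * y + k * t\<^sup>2 + t\<^sup>2 * Z t powr q"
proof -
  define R where "R = t ^ (n - 2)"
  define z where "z = Z t"
  define s where "s = 2 * real n / (real n - 2)"
  have t0: "t > 0" using t tm by simp
  have R: "R > 0" using t0 by (simp add: R_def)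
  have z: "z > 0" using Z_pos t by (simp add: z_def)
  have s: "s = q + 2" "s \<ge> 2" using n7 by (simp_all add: s_def q_def field_simps)
  have "z powr s = z powr q * z\<^sup>2" unfolding s(1) powr_add using z by simp
  then have zs: "\<bar>z\<bar> powr s = z powr q * z\<^sup>2" using z by simp
  have tn: "t ^ n = t\<^sup>2 * R" unfolding npow R_def by (simp add: power2_eq_square)
  have "profile_energy n k Z (\<lambda>t. - F t) t = (y * (R * z))\<^sup>2 / (2 * R) - (real n - 2) / 2 * (y * (R * z)) * z
      + k * (t\<^sup>2 * R) * z\<^sup>2 / 2 + (t\<^sup>2 * R) * (z powr q * z\<^sup>2) / s"
    unfolding profile_energy_def s_def[symmetric] F z_def[symmetric] zs tn R_def[symmetric] by simp
  also have "\<dots> = (R * z\<^sup>2) * (y\<^sup>2 / 2 - (real n - 2) / 2 * y + k * t\<^sup>2 / 2 + t\<^sup>2 * z powr q / s)"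
    using R by (simp add: field_simps power2_eq_square)
  finally have "0 \<le> (R * z\<^sup>2) * (y\<^sup>2 / 2 - (real n - 2) / 2 * y + k * t\<^sup>2 / 2 + t\<^sup>2 * z powr q / s)"
    using energy_nonneg[of t] t by simp
  then have "0 \<le> y\<^sup>2 / 2 - (real n - 2) / 2 * y + k * t\<^sup>2 / 2 + t\<^sup>2 * z powr q / s"
    using mult_pos_neg[of "R * z\<^sup>2" "y\<^sup>2 / 2 - (real n - 2) / 2 * y + k * t\<^sup>2 / 2 + t\<^sup>2 * z powr q / s"] R z
    by (simp add: not_less[symmetric]) fastforce
  also have "t\<^sup>2 * z powr q / s \<le> t\<^sup>2 * z powr q / 2" using s(2) by (intro divide_left_mono) auto
  finally show ?thesis by (simp add: z_def)
qed

text \<open>Put a = (n-2)/2 and S = t^2 Z^q. While y \<ge> a, S does not increase, so k t^2 + S <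
  3/2 persists and y^2 - 2 a y + 3/2 > 0. This rules out y = a and every y between a and n - 5/2, so
  y \<ge> n - 5/2 from K on; integrating the logarithmic slope gives the decay.\<close>

lemma decay:
  assumes K: "tm < K" "K < T" and lam: "k * T\<^sup>2 \<le> 1 / 2"
    and small: "K\<^sup>2 * Z K powr q < 1"
    and slope: "(real n - 2) / 2 * (K ^ (n - 2) * Z K) < F K"
    and t: "K \<le> t" "t < T"
  shows "Z t \<le> (K / t) powr (real n - 5 / 2)"
proof -
  define a where "a = (real n - 2) / 2"
  define m where "m = real n - 5 / 2"
  have a: "a \<ge> 5 / 2" "2 * a = real n - 2" "q * a = 2" using n7 by (simp_all add: a_def q_def field_simps)
  have K0: "K > 0" using K tm by simp
  define y where "y t = F t / (t ^ (n - 2) * Z t)" for t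
  define S where "S t = t\<^sup>2 * Z t powr q" for t
  have pos: "t ^ (n - 2) * Z t > 0" if "K \<le> t" "t < T" for t
    using that K K0 Z_pos[of t] by simp
  have Fy: "F t = y t * (t ^ (n - 2) * Z t)" if "K \<le> t" "t < T" for t
    using pos[OF that] unfolding y_def by (metis less_irrefl nonzero_eq_divide_eq)
  have cZ: "continuous_on {K..x} Z" if "x < T" for x
    by (rule continuous_on_subset[OF cont_Z]) (use K that in auto)
  have cy: "continuous_on {K..x} y" if "x < T" for x
    unfolding y_def[abs_def]
  proof (intro continuous_intros cZ that)
    show "continuous_on {K..x} F" by (rule continuous_on_subset[OF cont_F]) (use K that in auto)
    show "\<forall>t\<in>{K..x}. t ^ (n - 2) * Z t \<noteq> 0" using pos that by (metis atLeastAtMost_iff le_less_trans less_irrefl)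
  qed
  have kt: "k * t\<^sup>2 \<le> 1 / 2" if "K \<le> t" "t < T" for t
  proof -
    have "k * t\<^sup>2 \<le> k * T\<^sup>2" using k that K0 by (intro mult_left_mono power_mono) auto
    then show ?thesis using lam by simp
  qed
  have ineq: "0 \<le> (y t)\<^sup>2 - 2 * a * y t + k * t\<^sup>2 + S t" if "K \<le> t" "t < T" for t
    using slope_inequality[of t "y t"] Fy[OF that] that K by (simp add: S_def a(2))
  have dZ': "(Z has_real_derivative - (y x * Z x / x)) (at x)" if "K < x" "x < T" for x
  proof -
    have "F x / x ^ (n - 1) = y x * Z x / x"
      using Fy[of x] that K0 unfolding npow by (simp add: field_simps)
    then show ?thesis using dZ[of x] that K by simp
  qed
  \<comment> \<open>S' has the sign of 2 - q y, and q a = 2.\<close>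
  have S_dec: "S x \<le> S K" if x: "K \<le> x" "x < T" and ya: "\<And>s. K < s \<Longrightarrow> s < x \<Longrightarrow> a \<le> y s" for x
  proof (rule nonincreasing_interior[OF x(1)])
    show "continuous_on {K..x} S"
      unfolding S_def[abs_def] using q
      by (intro continuous_on_mult continuous_on_power continuous_on_id continuous_on_powr' cZ x continuous_on_const ballI conjI)
         (use Z_nonneg K x in auto)
    fix s assume s: "K < s" "s < x"
    have s': "s > 0" "s < T" using s K0 x by auto
    have z: "Z s > 0" using Z_pos[of s] s' s K by simp
    have "((\<lambda>t. Z t powr q) has_real_derivative (q * Z s powr (q - 1)) * - (y s * Z s / s)) (at s)"
      by (rule DERIV_chain2[OF has_real_derivative_powr[OF z] dZ']) (use s s' in auto)
    moreover have "(q * Z s powr (q - 1)) * - (y s * Z s / s) = - (q * y s * Z s powr q / s)"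
    proof -
      have "Z s powr (q - 1) * Z s = Z s powr q" using z by (simp add: powr_diff)
      then show ?thesis by (simp add: mult_ac)
    qed
    ultimately have dq: "((\<lambda>t. Z t powr q) has_real_derivative - (q * y s * Z s powr q / s)) (at s)"
      by (rule DERIV_cong)
    have "(S has_real_derivative 2 * s * Z s powr q + - (q * y s * Z s powr q / s) * s\<^sup>2) (at s)"
      unfolding S_def[abs_def] by (rule DERIV_mult[OF _ dq]) (auto intro!: derivative_eq_intros)
    moreover have "2 * s * Z s powr q + - (q * y s * Z s powr q / s) * s\<^sup>2 = s * Z s powr q * (2 - q * y s)"
      using s' by (simp add: field_simps power2_eq_square)
    moreover have "q * a \<le> q * y s" using ya[OF s] q by simp
    then have "2 - q * y s \<le> 0" using a(3) by linarith
    then have "s * Z s powr q * (2 - q * y s) \<le> 0" using s' by (simp add: mult_nonneg_nonpos)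
    ultimately show "\<exists>y. (S has_real_derivative y) (at s) \<and> y \<le> 0" by metis
  qed
  have SK: "S K < 1" using small by (simp add: S_def)
  have yK: "y K > a" using slope pos[of K] K by (simp add: y_def a_def pos_less_divide_eq)
  \<comment> \<open>Otherwise consider the first radius where y = a. Up to it S decreases, and there
    the quadratic inequality reads 0 \<le> - a^2 + k s^2 + S, although a^2 \<ge> 2 and the rest is
    below 3/2.\<close>
  have y_gt: "y t > a" if t: "K \<le> t" "t < T" for t
  proof (rule ccontr)
    assume "\<not> y t > a"
    define X where "X = {x \<in> {K..t}. y x = a}"
    have "\<exists>x\<ge>K. x \<le> t \<and> y x = a"
      by (rule IVT2'[OF _ _ t(1) cy[OF t(2)]]) (use yK \<open>\<not> y t > a\<close> in auto)
    then have neX: "X \<noteq> {}" by (auto simp: X_def)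
    have "closed X" unfolding X_def
      by (rule continuous_closed_preimage_constant[OF cy[OF t(2)] closed_atLeastAtMost])
    then have cX: "compact X" by (rule compact_Int_closed[OF compact_Icc[of K t], of X, THEN back_subst[of compact]])
       (auto simp: X_def)
    obtain s where s: "s \<in> X" "\<And>x. x \<in> X \<Longrightarrow> s \<le> x"
      using compact_attains_inf[OF cX neX] by blast
    have s': "K \<le> s" "s \<le> t" "y s = a" using s(1) by (auto simp: X_def)
    have "a \<le> y x" if x: "K < x" "x < s" for x
    proof (rule ccontr)
      assume "\<not> a \<le> y x"
      have "\<exists>w\<ge>K. w \<le> x \<and> y w = a"
        by (rule IVT2') (use yK \<open>\<not> a \<le> y x\<close> x cy[of x] s' t in auto)
      then obtain w where "w \<in> X" "w \<le> x" using x s' by (auto simp: X_def)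
      then show False using s(2) x by fastforce
    qed
    then have "S s \<le> S K" using S_dec[of s] s' t by simp
    then have "S s < 1" using SK by simp
    moreover have "k * s\<^sup>2 \<le> 1 / 2" using kt[of s] s' t by simp
    moreover have "0 \<le> a\<^sup>2 - 2 * a * a + k * s\<^sup>2 + S s" using ineq[of s] s' t by simp
    moreover have "a\<^sup>2 \<ge> 2" using mult_mono[of "5/2" a "5/2" a] a by (simp add: power2_eq_square)
    ultimately show False by (simp add: power2_eq_square)
  qed
  \<comment> \<open>As m - a = a - 1/2, a value of y between a and m would give y^2 - 2 a y < 1/4 -
    a \<le> - 9/4, again beyond the available 3/2.\<close>
  have y_ge: "y t \<ge> m" if t: "K \<le> t" "t < T" for t
  proof (rule ccontr)
    assume "\<not> y t \<ge> m"
    then have d: "0 < y t - a" "y t - a < a - 1/2" using y_gt[OF t] by (auto simp: m_def a_def field_simps)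
    have "S t \<le> S K" using S_dec[OF t] y_gt t by (smt (verit))
    then have "S t < 1" using SK by simp
    moreover have "k * t\<^sup>2 \<le> 1 / 2" by (rule kt[OF t])
    moreover have "(y t - a)\<^sup>2 < (a - 1/2)\<^sup>2" using d by (intro power_strict_mono) auto
    then have "(y t)\<^sup>2 - 2 * a * y t < 1/4 - a" by (simp add: power2_eq_square algebra_simps)
    ultimately show False using ineq[OF t] a by simp
  qed
  have "t powr m * Z t \<le> K powr m * Z K"
  proof (rule nonincreasing_interior[OF t(1), of "\<lambda>t. t powr m * Z t"])
    show "continuous_on {K..t} (\<lambda>t. t powr m * Z t)"
      by (intro continuous_on_mult continuous_on_powr cZ t continuous_on_id continuous_on_const) (use K0 in auto)
    fix x assume x: "K < x" "x < t"
    have x': "x > 0" "x < T" using x K0 t by auto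
    have "((\<lambda>t. t powr m * Z t) has_real_derivative (m * x powr (m - 1)) * Z x + - (y x * Z x / x) * x powr m) (at x)"
      by (rule DERIV_mult[OF has_real_derivative_powr[OF x'(1)] dZ']) (use x x' in auto)
    moreover have "(m * x powr (m - 1)) * Z x + - (y x * Z x / x) * x powr m = x powr m * Z x / x * (m - y x)"
      using x' by (simp add: powr_diff field_simps)
    moreover have "x powr m * Z x / x * (m - y x) \<le> 0"
      using y_ge[of x] x x' Z_pos[of x] K by (intro mult_nonneg_nonpos) auto
    ultimately show "\<exists>y. ((\<lambda>t. t powr m * Z t) has_real_derivative y) (at x) \<and> y \<le> 0" by metis
  qed
  also have "\<dots> \<le> K powr m * 1" using Z_le_1[of K] K by (intro mult_left_mono) auto
  finally show ?thesis using t K0 by (simp add: powr_divide m_def[symmetric] pos_le_divide_eq mult.commute)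
qed

text \<open>The condition on s turns the decay into Z^s \<le> (K/t)^(n+1), leaving K^(n+1) / t^2
  after multiplication by t^(n-1). Before K only Z \<le> 1 is used; the form 1 / (1 + t^2) fits both
  ranges and has an integral independent of the profile.\<close>

lemma dominated:
  assumes K: "1 \<le> K" and dec: "\<And>t. K \<le> t \<Longrightarrow> t < T \<Longrightarrow> Z t \<le> (K / t) powr (real n - 5 / 2)"
    and s: "s > 0" "real n + 1 \<le> (real n - 5 / 2) * s"
    and t: "tm \<le> t" "t \<le> T"
  shows "Z t powr s * t ^ (n - 1) \<le> 2 * K ^ (n + 1) * (1 / (1 + t\<^sup>2))"
proof (cases "t \<le> K")
  case True
  have t0: "t > 0" using t tm by simp
  have "Z t powr s \<le> 1 powr s" by (rule powr_mono2) (use s Z_nonneg[OF t] Z_le_1[OF t] in auto)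
  then have "Z t powr s * t ^ (n - 1) \<le> 1 * K ^ (n - 1)"
    using True t0 by (intro mult_mono power_mono) auto
  moreover have "K ^ (n - 1) * (1 + t\<^sup>2) \<le> K ^ (n - 1) * (2 * K\<^sup>2)"
  proof (rule mult_left_mono)
    have "t\<^sup>2 \<le> K\<^sup>2" "1 \<le> K\<^sup>2" using True t0 K by (auto intro: power_mono)
    then show "1 + t\<^sup>2 \<le> 2 * K\<^sup>2" by simp
  qed (use K in simp)
  moreover have "n + 1 = (n - 1) + 2" using n7 by simp
  then have "K ^ (n + 1) = K ^ (n - 1) * K\<^sup>2" by (metis power_add)
  moreover have "1 + t\<^sup>2 > 0" by (simp add: add_pos_nonneg)
  ultimately show ?thesis
    using order_trans[of "Z t powr s * t ^ (n - 1)" "K ^ (n - 1)" "2 * K ^ (n + 1) * (1 / (1 + t\<^sup>2))"]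
    by (simp add: pos_le_divide_eq mult_ac)
next
  case False
  then have tK: "K \<le> t" "t > 0" "t \<ge> 1" using K by auto
  have "Z t powr s \<le> (K / t) ^ (n + 1)"
  proof (cases "t = T")
    case True
    then show ?thesis using s Z_T K tK by simp
  next
    case ne: False
    have "Z t powr s \<le> ((K / t) powr (real n - 5 / 2)) powr s"
      by (rule powr_mono2) (use s Z_nonneg[OF t] dec[of t] tK t ne in auto)
    also have "\<dots> = (K / t) powr ((real n - 5 / 2) * s)" by (rule powr_powr)
    also have "\<dots> \<le> (K / t) powr (real (n + 1))"
      by (rule powr_mono') (use s tK K in auto)
    also have "\<dots> = (K / t) ^ (n + 1)" using K tK by (intro powr_realpow) auto
    finally show ?thesis .
  qed
  then have "Z t powr s * t ^ (n - 1) \<le> (K / t) ^ (n + 1) * t ^ (n - 1)"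
    using tK by (intro mult_right_mono) auto
  also have "\<dots> = K ^ (n + 1) * (1 / t\<^sup>2)"
  proof -
    have "n + 1 = (n - 1) + 2" using n7 by simp
    then have "t ^ (n + 1) = t ^ (n - 1) * t\<^sup>2" by (metis power_add)
    then show ?thesis using tK by (simp add: power_divide)
  qed
  also have "\<dots> \<le> K ^ (n + 1) * (2 * (1 / (1 + t\<^sup>2)))"
  proof (rule mult_left_mono)
    have "1 \<le> t\<^sup>2" using tK by simp
    moreover have "1 + t\<^sup>2 > 0" by (simp add: add_pos_nonneg)
    ultimately show "1 / t\<^sup>2 \<le> 2 * (1 / (1 + t\<^sup>2))" using tK by (simp add: field_simps)
  qed (use K in simp)
  finally show ?thesis by (simp add: mult_ac)
qed

text \<open>Comparison with the harmonic function of flux \<open>F T\<close>, as before rescaling.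
  This form bounds the linear source by k t times the final flux.\<close>

lemma flux_upper:
  assumes t: "tm \<le> t" "t \<le> T"
  shows "t ^ (n - 1) * Z t \<le> F T * t"
proof -
  define c where "c = F T / (real n - 2)"
  have t0: "t > 0" using t tm by simp
  have FT: "F T \<ge> 0" using F_nonneg[of T] tm by simp
  have c: "c \<ge> 0" "c \<le> F T" using FT n7 by (auto simp: c_def divide_le_eq mult_le_cancel_left1)
  have "Z t - c * (1 / t ^ (n - 2)) \<le> Z T - c * (1 / T ^ (n - 2))"
  proof (rule nondecreasing_interior[OF t(2), of "\<lambda>t. Z t - c * (1 / t ^ (n - 2))"])
    show "continuous_on {t..T} (\<lambda>t. Z t - c * (1 / t ^ (n - 2)))"
      by (intro continuous_intros continuous_on_subset[OF cont_Z]) (use t t0 in auto)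
    fix x assume x: "t < x" "x < T"
    have x': "x > 0" "tm < x" using x t0 t by auto
    have dinv: "((\<lambda>r. 1 / r ^ (n - 2)) has_real_derivative - ((real n - 2) / x ^ (n - 1))) (at x)"
    proof -
      define Q where "Q = x ^ (n - 2 - Suc 0)"
      have Q: "Q > 0" using x' by (simp add: Q_def)
      have "n - 2 = Suc (n - 2 - Suc 0)" using n7 by simp
      then have e: "x ^ (n - 2) = x * Q" unfolding Q_def by (metis power_Suc)
      have "real (n - 2) = real n - 2" using n7 by simp
      then have "(0 * x ^ (n - 2) - 1 * (real (n - 2) * Q)) / (x ^ (n - 2) * x ^ (n - 2)) = - ((real n - 2) / x ^ (n - 1))"
        unfolding npow e using x' Q by (simp add: field_simps)
      then show ?thesis
        using DERIV_divide[OF DERIV_const[of 1] DERIV_pow[of "n - 2" x]] x' by (simp add: Q_def)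
    qed
    have "((\<lambda>t. Z t - c * (1 / t ^ (n - 2))) has_real_derivative
        - (F x / x ^ (n - 1)) - c * - ((real n - 2) / x ^ (n - 1))) (at x)"
      by (intro DERIV_diff DERIV_cmult dinv dZ x' x)
    moreover have "F x / x ^ (n - 1) \<le> F T / x ^ (n - 1)"
      using F_mono[of x T] x x' by (intro divide_right_mono) auto
    then have "- (F x / x ^ (n - 1)) - c * - ((real n - 2) / x ^ (n - 1)) \<ge> 0" using n7 by (simp add: c_def)
    ultimately show "\<exists>y. ((\<lambda>t. Z t - c * (1 / t ^ (n - 2))) has_real_derivative y) (at x) \<and> y \<ge> 0" by blast
  qed
  moreover have "0 \<le> c * (1 / T ^ (n - 2))" using c T1 by simp
  ultimately have "Z t \<le> c / t ^ (n - 2)" using Z_T by simp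
  then have "t ^ (n - 2) * Z t \<le> c" using t0 by (simp add: pos_le_divide_eq mult.commute)
  then have "t * (t ^ (n - 2) * Z t) \<le> t * F T" using c t0 by (intro mult_left_mono) auto
  then show ?thesis unfolding npow by (simp add: mult_ac)
qed

text \<open>Used for s = 1 + q, the critical exponent minus 1, and for s = 2; in the limit these
  give \<open>c1\<close> and half of \<open>c2\<close>.\<close>

definition "mass s = (LBINT t:{tm..T}. Z t powr s * t ^ (n - 1))"

lemma set_integrable_power_Z:
  assumes "s > 0"
  shows "set_integrable lborel {tm..T} (\<lambda>t. Z t powr s * t ^ (n - 1))"
proof -
  have "continuous_on {tm..T} (\<lambda>t. Z t powr s * t ^ (n - 1))"
    by (intro continuous_on_mult continuous_on_power continuous_on_id continuous_on_powr' cont_Z continuous_on_const ballI conjI)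
       (use Z_nonneg assms in auto)
  then show ?thesis by (rule borel_integrable_atLeastAtMost')
qed

text \<open>Integrate F' from \<open>tm\<close>, where F vanishes. The power source gives the mass;
  the linear source contributes a nonnegative amount, at most k T^2 times the final flux.\<close>

lemma flux_mass: "mass (1 + q) \<le> F T" "F T * (1 - k * T\<^sup>2) \<le> mass (1 + q)"
proof -
  define J where "J t = Z t powr (1 + q) * t ^ (n - 1)" for t
  have int: "((\<lambda>t. k * (t ^ (n - 1) * Z t) + J t) has_integral (F T - F tm)) {tm..T}"
  proof (rule fundamental_theorem_of_calculus_interior)
    show "(F has_vector_derivative k * (t ^ (n - 1) * Z t) + J t) (at t)" if t: "t \<in> {tm<..<T}" for t
    proof -
      have "Z t > 0" using Z_pos t by simp
      then have "t ^ (n - 1) * (k * Z t + Z t powr q * Z t) = k * (t ^ (n - 1) * Z t) + J t"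
        by (simp add: J_def powr_add algebra_simps)
      then show ?thesis using dF[folded q_def, of t] t by (simp add: has_real_derivative_iff_has_vector_derivative)
    qed
  qed (use tm cont_F in auto)
  have J: "set_integrable lborel {tm..T} J" unfolding J_def[abs_def] using set_integrable_power_Z q by simp
  have Jint: "(J has_integral mass (1 + q)) {tm..T}"
    unfolding mass_def J_def[symmetric] set_borel_integral_eq_integral(2)[OF J]
    by (rule integrable_integral[OF set_borel_integral_eq_integral(1)[OF J]])
  have "((\<lambda>t. k * (t ^ (n - 1) * Z t)) has_integral (F T - mass (1 + q))) {tm..T}"
    using has_integral_diff[OF int Jint] F_tm by simp
  note I = this
  have "0 \<le> F T - mass (1 + q)"
    by (rule has_integral_nonneg[OF I]) (use k tm Z_nonneg in auto)
  then show "mass (1 + q) \<le> F T" by simp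
  have "((\<lambda>t. k * (F T * T)) has_integral (T - tm) *\<^sub>R (k * (F T * T))) {tm..T}"
    using has_integral_const_real[of "k * (F T * T)" tm T] tm by simp
  from I this have "F T - mass (1 + q) \<le> (T - tm) *\<^sub>R (k * (F T * T))"
  proof (rule has_integral_le)
    fix t assume t: "t \<in> {tm..T}"
    have "t ^ (n - 1) * Z t \<le> F T * t" using flux_upper t by simp
    also have "\<dots> \<le> F T * T" using F_nonneg[of T] tm t by (intro mult_left_mono) auto
    finally show "k * (t ^ (n - 1) * Z t) \<le> k * (F T * T)" using k by simp
  qed
  also have "\<dots> \<le> T * (k * (F T * T))"
    using k F_nonneg[of T] tm by (simp add: mult_right_mono)
  finally show "F T * (1 - k * T\<^sup>2) \<le> mass (1 + q)" by (simp add: algebra_simps power2_eq_square)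
qed

text \<open>At T the profile vanishes, so the energy there is F(T)^2 / (2 T^(n-2)), and its increase
  from \<open>tm\<close> is k \<open>mass 2\<close>. After division by k the initial energy leaves
  an error O(tm^2); this is where its quadratic bound is indispensable.\<close>

lemma energy_mass:
  "\<bar>(F T)\<^sup>2 / (k * T ^ (n - 2)) - 2 * mass 2\<bar> \<le> 2 * C * tm\<^sup>2"
proof -
  define E where "E = profile_energy n k Z (\<lambda>t. - F t)"
  have "continuous_on {tm..T} (\<lambda>r. (- F r)\<^sup>2 / (2 * r ^ (n - 2)))"
    by (intro continuous_on_divide continuous_on_mult continuous_on_power continuous_on_minus continuous_on_id
        continuous_on_const cont_F) (use tm in auto)
  moreover have "continuous_on {tm..T} (\<lambda>r. (real n - 2) / 2 * (- F r) * Z r)"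
    "continuous_on {tm..T} (\<lambda>r. k * r ^ n * (Z r)\<^sup>2 / 2)"
    by (intro continuous_intros cont_F cont_Z; simp)+
  moreover have "continuous_on {tm..T} (\<lambda>r. r ^ n * \<bar>Z r\<bar> powr (2 * real n / (real n - 2)) / (2 * real n / (real n - 2)))"
    using n7 by (intro continuous_on_divide continuous_on_mult continuous_on_power continuous_on_id continuous_on_const
        continuous_on_powr'[OF continuous_on_rabs[OF cont_Z]]) auto
  ultimately have cE: "continuous_on {tm..T} E"
    unfolding E_def profile_energy_def[abs_def] by (intro continuous_on_add)
  have int: "((\<lambda>t. k * (Z t powr 2 * t ^ (n - 1))) has_integral (E T - E tm)) {tm..T}"
  proof (rule fundamental_theorem_of_calculus_interior)
    show "(E has_vector_derivative k * (Z t powr 2 * t ^ (n - 1))) (at t)" if t: "t \<in> {tm<..<T}" for t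
    proof -
      have t': "tm < t" "t < T" "t > 0" "Z t > 0" using t tm Z_pos by auto
      have "(E has_real_derivative k * t ^ (n - 1) * (Z t)\<^sup>2) (at t)"
        unfolding E_def
      proof (rule DERIV_profile_energy)
        show "(Z has_real_derivative - F t / t ^ (n - 1)) (at t)" using dZ[OF t'(1,2)] by simp
        show "((\<lambda>t. - F t) has_real_derivative
            - (t ^ (n - 1) * (k * Z t + \<bar>Z t\<bar> powr (4 / (real n - 2)) * Z t))) (at t)"
          using DERIV_minus[OF dF[OF t'(1,2)]] t'(4) by simp
      qed (use n7 t' in auto)
      then show ?thesis using t' by (simp add: has_real_derivative_iff_has_vector_derivative mult_ac)
    qed
  qed (use tm cE in auto)
  have m: "set_integrable lborel {tm..T} (\<lambda>t. Z t powr 2 * t ^ (n - 1))" by (rule set_integrable_power_Z) simp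
  have "((\<lambda>t. Z t powr 2 * t ^ (n - 1)) has_integral mass 2) {tm..T}"
    unfolding mass_def set_borel_integral_eq_integral(2)[OF m]
    by (rule integrable_integral[OF set_borel_integral_eq_integral(1)[OF m]])
  from has_integral_unique[OF int has_integral_mult_right[OF this, of k]]
  have e: "E T - E tm = k * mass 2" .
  have "E T = (F T)\<^sup>2 / (2 * T ^ (n - 2))" using n7 by (simp add: E_def profile_energy_def Z_T)
  then have "(F T)\<^sup>2 / (k * T ^ (n - 2)) - 2 * mass 2 = 2 * E tm / k"
  proof -
    define R where "R = T ^ (n - 2)"
    have "R > 0" using tm by (simp add: R_def)
    then have "(F T)\<^sup>2 = 2 * R * (E tm + k * mass 2)"
      using e \<open>E T = _\<close> by (simp add: R_def[symmetric] field_simps)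
    then show ?thesis unfolding R_def[symmetric] using k \<open>R > 0\<close> by (simp add: field_simps)
  qed
  moreover have "0 \<le> E tm" using energy_nonneg[of tm] tm by (simp add: E_def)
  moreover have "E tm / k \<le> C * tm\<^sup>2" using energy_tm k by (simp add: E_def field_simps)
  ultimately show ?thesis using k by simp
qed

end

lemma tendsto_0_from_square:
  fixes x :: "nat \<Rightarrow> real"
  assumes "(\<lambda>j. (x j)\<^sup>2) \<longlonglongrightarrow> 0"
  shows "x \<longlonglongrightarrow> 0"
proof -
  have "(\<lambda>j. sqrt ((x j)\<^sup>2)) \<longlonglongrightarrow> sqrt 0" by (rule tendsto_real_sqrt[OF assms])
  then have "(\<lambda>j. \<bar>x j\<bar>) \<longlonglongrightarrow> 0" by simp
  then show ?thesis by (rule tendsto_rabs_zero_cancel)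
qed

lemma set_integrable_inverse_1_plus_square: "set_integrable lborel {0..} (\<lambda>t::real. 1 / (1 + t\<^sup>2))"
proof -
  have "(\<integral>\<^sup>+t. ennreal (1 / (1 + t\<^sup>2)) * indicator {0..} t \<partial>lborel) = ennreal (pi / 2 - arctan 0)"
  proof (rule nn_integral_FTC_atLeast)
    show "(arctan has_real_derivative 1 / (1 + t\<^sup>2)) (at t)" for t
      using DERIV_arctan[of t] by (simp add: inverse_eq_divide)
    show "(arctan \<longlongrightarrow> pi / 2) at_top" by (rule tendsto_arctan_at_top)
  qed simp_all
  then have "(\<integral>\<^sup>+t. ennreal (indicator {0..} t *\<^sub>R (1 / (1 + t\<^sup>2))) \<partial>lborel) < \<infinity>"
  proof -
    assume *: "(\<integral>\<^sup>+t. ennreal (1 / (1 + t\<^sup>2)) * indicator {0..} t \<partial>lborel) = ennreal (pi / 2 - arctan 0)"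
    have "ennreal (indicator {0..} t *\<^sub>R (1 / (1 + t\<^sup>2))) = ennreal (1 / (1 + t\<^sup>2)) * indicator {0..} t" for t :: real
      by (simp split: split_indicator)
    then show ?thesis using * by simp
  qed
  then show ?thesis
    unfolding set_integrable_def by (intro integrableI_nonneg) (auto simp: less_top)
qed

section \<open>Limits along a sequence of rescaled profiles\<close>

context
  fixes n :: nat and C :: real and k tm T :: "nat \<Rightarrow> real" and Z F :: "nat \<Rightarrow> real \<Rightarrow> real"
  assumes sp: "\<And>j. scaled_profile n (k j) (tm j) (T j) C (Z j) (F j)"
    and lam0: "(\<lambda>j. k j * (T j)\<^sup>2) \<longlonglongrightarrow> 0"
begin

lemma dimension_ge_7: "n \<ge> 7" using sp[of 0] by (rule scaled_profile.n7)

lemma sequence_bounds: "k j > 0" "0 < tm j" "tm j < T j" "T j \<ge> 1" "tm j ^ n \<le> C * (k j * (T j)\<^sup>2)"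
  using scaled_profile.k[OF sp[of j]] scaled_profile.tm[OF sp[of j]] scaled_profile.T1[OF sp[of j]]
    scaled_profile.tm_small[OF sp[of j]]
  by simp_all

lemma k_tendsto_0: "k \<longlonglongrightarrow> 0"
proof (rule tendsto_sandwich[OF _ _ tendsto_const lam0])
  have "k j * 1 \<le> k j * (T j)\<^sup>2" for j using sequence_bounds[of j] by (intro mult_left_mono) auto
  then show "\<forall>\<^sub>F j in sequentially. k j \<le> k j * (T j)\<^sup>2" by simp
  show "\<forall>\<^sub>F j in sequentially. 0 \<le> k j" using sequence_bounds(1) by (simp add: less_imp_le)
qed

lemma tm_tendsto_0: "tm \<longlonglongrightarrow> 0"
proof (rule LIMSEQ_I)
  fix r :: real assume r: "0 < r"
  have "(\<lambda>j. C * (k j * (T j)\<^sup>2)) \<longlonglongrightarrow> C * 0" by (intro tendsto_intros lam0)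
  then have "\<forall>\<^sub>F j in sequentially. C * (k j * (T j)\<^sup>2) < r ^ n"
    using order_tendstoD(2)[of _ "C * 0" sequentially "r ^ n"] r by simp
  then obtain N where N: "\<And>j. j \<ge> N \<Longrightarrow> C * (k j * (T j)\<^sup>2) < r ^ n"
    unfolding eventually_sequentially by blast
  have "tm j < r" if "j \<ge> N" for j
    by (rule power_less_imp_less_base[of _ n]) (use N[OF that] sequence_bounds(5)[of j] r in linarith)+
  then show "\<exists>no. \<forall>j\<ge>no. norm (tm j - 0) < r" using sequence_bounds(2) by (intro exI[of _ N]) (simp add: less_imp_le)
qed

lemma error_tendsto_0: "(\<lambda>j. (2 * (tm j)\<^sup>2 + (k j)\<^sup>2 * t) * exp (4 * t)) \<longlonglongrightarrow> 0"
proof -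
  have "(\<lambda>j. (2 * (tm j)\<^sup>2 + (k j)\<^sup>2 * t) * exp (4 * t)) \<longlonglongrightarrow> (2 * 0\<^sup>2 + 0\<^sup>2 * t) * exp (4 * t)"
    by (intro tendsto_intros tm_tendsto_0 k_tendsto_0)
  then show ?thesis by simp
qed

lemma eventually_tm_less: "r > 0 \<Longrightarrow> \<forall>\<^sub>F j in sequentially. tm j < r"
  using order_tendstoD(2)[OF tm_tendsto_0] by blast

text \<open>Z vanishes at T, whereas the bubble stays bounded away from 0 on [0, b]; closeness to
  the bubble is therefore impossible if T \<le> b.\<close>

lemma eventually_T_greater: "\<forall>\<^sub>F j in sequentially. B < T j"
proof -
  define b where "b = max B 1"
  have U: "0 < (std_bubble n b)\<^sup>2" using std_bubble_pos[OF dimension_ge_7, of b] by simp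
  have "\<forall>\<^sub>F j in sequentially. (2 * (tm j)\<^sup>2 + (k j)\<^sup>2 * b) * exp (4 * b) < (std_bubble n b)\<^sup>2"
    by (rule order_tendstoD(2)[OF error_tendsto_0 U])
  moreover have "\<forall>\<^sub>F j in sequentially. tm j < 1" by (rule eventually_tm_less) simp
  ultimately show ?thesis
  proof eventually_elim
    case (elim j)
    show "B < T j"
    proof (rule ccontr)
      assume "\<not> B < T j"
      then have Tb: "T j \<le> b" by (simp add: b_def)
      have T0: "T j > 0" using sequence_bounds[of j] by linarith
      have "(std_bubble n (T j))\<^sup>2 \<le> (Z j (T j) - std_bubble n (T j))\<^sup>2 + (F j (T j) / T j ^ (n - 1) + std_bubble' n (T j))\<^sup>2"
        by (simp add: scaled_profile.Z_T[OF sp])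
      also have "\<dots> \<le> (2 * (tm j)\<^sup>2 + (k j)\<^sup>2 * T j) * exp (4 * T j)"
        by (rule scaled_profile.close_to_bubble[OF sp]) (use elim sequence_bounds[of j] in auto)
      also have "\<dots> \<le> (2 * (tm j)\<^sup>2 + (k j)\<^sup>2 * b) * exp (4 * b)"
        using Tb T0 by (intro mult_mono add_left_mono mult_left_mono) auto
      also have "\<dots> < (std_bubble n b)\<^sup>2" by (rule elim)
      finally have "(std_bubble n (T j))\<^sup>2 < (std_bubble n b)\<^sup>2" .
      moreover have "(std_bubble n b)\<^sup>2 \<le> (std_bubble n (T j))\<^sup>2"
        using std_bubble_antimono[OF dimension_ge_7, of "T j" b] Tb T0 std_bubble_pos[OF dimension_ge_7, of b]
        by (intro power_mono) auto
      ultimately show False by simp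
    qed
  qed
qed

lemma
  assumes t: "t > 0"
  shows Z_tendsto: "(\<lambda>j. Z j t) \<longlonglongrightarrow> std_bubble n t"
    and F_tendsto: "(\<lambda>j. F j t) \<longlonglongrightarrow> - std_bubble' n t * t ^ (n - 1)"
proof -
  have "\<forall>\<^sub>F j in sequentially. tm j < 1" "\<forall>\<^sub>F j in sequentially. tm j < t"
    by (rule eventually_tm_less, use t in simp)+
  moreover have "\<forall>\<^sub>F j in sequentially. t < T j" by (rule eventually_T_greater)
  ultimately have *: "\<forall>\<^sub>F j in sequentially. (Z j t - std_bubble n t)\<^sup>2 + (F j t / t ^ (n - 1) + std_bubble' n t)\<^sup>2
      \<le> (2 * (tm j)\<^sup>2 + (k j)\<^sup>2 * t) * exp (4 * t)"
    by eventually_elim (rule scaled_profile.close_to_bubble[OF sp], auto)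
  have "(\<lambda>j. (Z j t - std_bubble n t)\<^sup>2) \<longlonglongrightarrow> 0"
    by (rule tendsto_sandwich[OF _ _ tendsto_const error_tendsto_0])
       (use * in \<open>auto elim!: eventually_mono intro: order_trans[rotated]\<close>)
  from tendsto_0_from_square[OF this] show "(\<lambda>j. Z j t) \<longlonglongrightarrow> std_bubble n t"
    by (rule LIM_zero_cancel)
  have "(\<lambda>j. (F j t / t ^ (n - 1) - - std_bubble' n t)\<^sup>2) \<longlonglongrightarrow> 0"
    by (rule tendsto_sandwich[OF _ _ tendsto_const error_tendsto_0])
       (use * in \<open>auto elim!: eventually_mono intro: order_trans[rotated]\<close>)
  from tendsto_0_from_square[OF this] have "(\<lambda>j. F j t / t ^ (n - 1)) \<longlonglongrightarrow> - std_bubble' n t"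
    by (rule LIM_zero_cancel)
  from tendsto_mult_right[OF this, of "t ^ (n - 1)"]
  show "(\<lambda>j. F j t) \<longlonglongrightarrow> - std_bubble' n t * t ^ (n - 1)" using t by simp
qed

text \<open>The entry conditions of \<open>decay\<close> at K = n^2 are strict inequalities
  satisfied by the bubble, so pointwise convergence at this one radius passes them on to all late
  members of the sequence.\<close>

lemma eventually_dominated:
  assumes s: "s > 0" "real n + 1 \<le> (real n - 5 / 2) * s"
  shows "\<forall>\<^sub>F j in sequentially. \<forall>t. tm j \<le> t \<and> t \<le> T j \<longrightarrow>
    Z j t powr s * t ^ (n - 1) \<le> 2 * ((real n)\<^sup>2) ^ (n + 1) * (1 / (1 + t\<^sup>2))"
proof -
  define K where "K = (real n)\<^sup>2"
  have K: "K \<ge> 1" "K > 0" using dimension_ge_7 by (simp_all add: K_def)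
  define p where "p = 4 / (real n - 2)"
  have p: "p > 0" using dimension_ge_7 by (simp add: p_def)
  have "(\<lambda>j. K\<^sup>2 * Z j K powr p) \<longlonglongrightarrow> K\<^sup>2 * std_bubble n K powr p"
    by (intro tendsto_intros Z_tendsto K) (use std_bubble_pos[OF dimension_ge_7, of K] in auto)
  then have e1: "\<forall>\<^sub>F j in sequentially. K\<^sup>2 * Z j K powr p < 1"
    by (rule order_tendstoD(2)) (use std_bubble_at_square(1)[OF dimension_ge_7] in \<open>simp add: K_def p_def\<close>)
  have lim: "(\<lambda>j. F j K - (real n - 2) / 2 * (K ^ (n - 2) * Z j K)) \<longlonglongrightarrow>
      - std_bubble' n K * K ^ (n - 1) - (real n - 2) / 2 * (K ^ (n - 2) * std_bubble n K)"
    by (intro tendsto_intros Z_tendsto F_tendsto K)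
  have "- std_bubble' n K * K ^ (n - 1) - (real n - 2) / 2 * (K ^ (n - 2) * std_bubble n K)
      = K ^ (n - 2) * (- (K * std_bubble' n K) - (real n - 2) / 2 * std_bubble n K)"
  proof -
    have "n - 1 = Suc (n - 2)" using dimension_ge_7 by simp
    then have "K ^ (n - 1) = K * K ^ (n - 2)" by (metis power_Suc)
    then show ?thesis by (simp add: algebra_simps)
  qed
  also have "\<dots> > 0"
    using std_bubble_at_square(2)[OF dimension_ge_7] K by (simp add: K_def)
  finally have e2: "\<forall>\<^sub>F j in sequentially. 0 < F j K - (real n - 2) / 2 * (K ^ (n - 2) * Z j K)"
    by (rule order_tendstoD(1)[OF lim])
  have e3: "\<forall>\<^sub>F j in sequentially. k j * (T j)\<^sup>2 < 1 / 2"
    by (rule order_tendstoD(2)[OF lam0]) simp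
  have e4: "\<forall>\<^sub>F j in sequentially. tm j < K" by (rule eventually_tm_less[OF K(2)])
  have e5: "\<forall>\<^sub>F j in sequentially. K < T j" by (rule eventually_T_greater)
  from e1 e2 e3 e4 e5 show ?thesis
  proof eventually_elim
    case (elim j)
    interpret scaled_profile n "k j" "tm j" "T j" C "Z j" "F j" by (rule sp)
    have dec: "Z j t \<le> (K / t) powr (real n - 5 / 2)" if "K \<le> t" "t < T j" for t
      by (rule decay) (use elim that in \<open>auto simp: q_def p_def\<close>)
    show ?case
      unfolding K_def[symmetric] using dominated[OF K(1) dec s] by blast
  qed
qed

text \<open>Dominated convergence after extension by zero outside [tm, T]. Positivity of the limit
  is what later allows division by \<open>c2\<close> and negative powers of the constants.\<close>

lemma mass_tendsto:
  assumes s: "s > 0" "real n + 1 \<le> (real n - 5 / 2) * s"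
  shows "(\<lambda>j. LBINT t:{tm j..T j}. Z j t powr s * t ^ (n - 1)) \<longlonglongrightarrow> (LBINT t:{0..}. std_bubble n t powr s * t ^ (n - 1))"
    and "0 < (LBINT t:{0..}. std_bubble n t powr s * t ^ (n - 1))"
proof -
  define A where "A = 2 * ((real n)\<^sup>2) ^ (n + 1)"
  define g where "g j t = indicator {tm j..T j} t *\<^sub>R (Z j t powr s * t ^ (n - 1))" for j t
  define h where "h t = indicator {0..} t *\<^sub>R (std_bubble n t powr s * t ^ (n - 1))" for t
  define w where "w t = A * (indicator {0..} t *\<^sub>R (1 / (1 + t\<^sup>2)))" for t :: real
  have A: "A \<ge> 0" by (simp add: A_def)
  obtain N where N: "\<And>j t. j \<ge> N \<Longrightarrow> tm j \<le> t \<Longrightarrow> t \<le> T j \<Longrightarrow> Z j t powr s * t ^ (n - 1) \<le> A * (1 / (1 + t\<^sup>2))"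
    using eventually_dominated[OF s] unfolding eventually_sequentially A_def by blast
  have gm: "g j \<in> borel_measurable lborel" for j
  proof -
    have "integrable lborel (g j)"
      using scaled_profile.set_integrable_power_Z[OF sp s(1), of j]
      unfolding set_integrable_def g_def[abs_def] .
    then show ?thesis by (rule borel_measurable_integrable)
  qed
  have hc: "continuous_on {0..} (\<lambda>t. std_bubble n t powr s * t ^ (n - 1))"
  proof -
    have "continuous_on {0..} (std_bubble n)"
      by (intro continuous_at_imp_continuous_on ballI DERIV_isCont[OF DERIV_std_bubble[OF dimension_ge_7]])
    then show ?thesis
      using std_bubble_pos[OF dimension_ge_7] by (intro continuous_intros continuous_on_powr') (auto simp: less_imp_le less_imp_neq[symmetric])
  qed
  have hm: "h \<in> borel_measurable lborel"
    unfolding h_def[abs_def] using borel_measurable_continuous_on_indicator[OF _ hc] by simp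
  have wi: "integrable lborel w"
    using set_integrable_inverse_1_plus_square unfolding set_integrable_def w_def[abs_def]
    by (intro integrable_mult_right)
  have lim: "(\<lambda>j. g j t) \<longlonglongrightarrow> h t" for t
  proof (cases "t > 0")
    case True
    have "\<forall>\<^sub>F j in sequentially. tm j < t" "\<forall>\<^sub>F j in sequentially. t < T j"
      using eventually_tm_less[OF True] eventually_T_greater by auto
    then have "\<forall>\<^sub>F j in sequentially. Z j t powr s * t ^ (n - 1) = g j t"
      by eventually_elim (simp add: g_def)
    moreover have "(\<lambda>j. Z j t powr s * t ^ (n - 1)) \<longlonglongrightarrow> h t"
      unfolding h_def using True std_bubble_pos[OF dimension_ge_7, of t]
      by (auto intro!: tendsto_intros Z_tendsto)
    ultimately show ?thesis by (rule Lim_transform_eventually[rotated])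
  next
    case False
    have "g j t = 0" for j using False sequence_bounds(2)[of j] by (simp add: g_def)
    moreover have "h t = 0" using False dimension_ge_7 by (cases "t = 0") (auto simp: h_def)
    ultimately show ?thesis by simp
  qed
  \<comment> \<open>The majorant is valid only from index N on, so the sequence is shifted.\<close>
  have bound: "norm (g (j + N) t) \<le> w t" for j t
  proof (cases "tm (j + N) \<le> t \<and> t \<le> T (j + N)")
    case True
    then have "t > 0" using sequence_bounds(2)[of "j + N"] by linarith
    then show ?thesis using N[of "j + N" t] True by (simp add: g_def w_def)
  qed (use A in \<open>auto simp: g_def w_def\<close>)
  have hi: "integrable lborel h"
    by (rule integrable_dominated_convergence[where s="\<lambda>j. g (j + N)" and w=w])
       (use hm gm wi bound LIMSEQ_ignore_initial_segment[OF lim] in auto)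
  have "(\<lambda>j. integral\<^sup>L lborel (g (j + N))) \<longlonglongrightarrow> integral\<^sup>L lborel h"
    by (rule integral_dominated_convergence[where w=w])
       (use hm gm wi bound LIMSEQ_ignore_initial_segment[OF lim] in auto)
  then have "(\<lambda>j. integral\<^sup>L lborel (g j)) \<longlonglongrightarrow> integral\<^sup>L lborel h" by (rule LIMSEQ_offset)
  then show "(\<lambda>j. LBINT t:{tm j..T j}. Z j t powr s * t ^ (n - 1)) \<longlonglongrightarrow> (LBINT t:{0..}. std_bubble n t powr s * t ^ (n - 1))"
    unfolding set_lebesgue_integral_def g_def[abs_def] h_def[abs_def] .
  have h0: "h t \<ge> 0" for t by (simp add: h_def indicator_def)
  have "integral\<^sup>L lborel h \<noteq> 0"
  proof
    assume "integral\<^sup>L lborel h = 0"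
    then have "AE t in lborel. h t = 0" using integral_nonneg_eq_0_iff_AE[OF hi] h0 by simp
    then have "AE t in lborel. \<not> (t \<in> {0<..<1::real})"
    proof eventually_elim
      case (elim t)
      show ?case
      proof
        assume "t \<in> {0<..<1::real}"
        then have "h t > 0" using std_bubble_pos[OF dimension_ge_7, of t] by (simp add: h_def)
        then show False using elim by simp
      qed
    qed
    then have "{0<..<1::real} \<in> null_sets lborel"
      by (subst AE_iff_null_sets) (auto elim: eventually_mono)
    then have "emeasure lborel {0<..<1::real} = 0" by (rule null_setsD1)
    then show False by simp
  qed
  moreover have "integral\<^sup>L lborel h \<ge> 0" using h0 by simp
  ultimately show "0 < (LBINT t:{0..}. std_bubble n t powr s * t ^ (n - 1))"
    unfolding set_lebesgue_integral_def h_def[abs_def] by simp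
qed

lemma scaled_limits:
  shows "(\<lambda>j. F j (T j)) \<longlonglongrightarrow> c1 n" "(\<lambda>j. (F j (T j))\<^sup>2 / (k j * T j ^ (n - 2))) \<longlonglongrightarrow> c2 n"
    "c1 n > 0" "c2 n > 0"
proof -
  define q where "q = 4 / (real n - 2)"
  have n3: "n \<ge> 3" using dimension_ge_7 by simp
  have "4 * (real n - 5 / 2) \<ge> 5 / 2 * (real n - 2)" using dimension_ge_7 by simp
  then have s1: "1 + q > 0" "real n + 1 \<le> (real n - 5 / 2) * (1 + q)"
  proof -
    show "1 + q > 0" using dimension_ge_7 by (simp add: q_def add_pos_pos)
    assume "4 * (real n - 5 / 2) \<ge> 5 / 2 * (real n - 2)"
    \<comment> \<open>Since (n - 5/2)(1 + q) = n - 5/2 + (n - 5/2) q, the requirement amounts to (n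
      - 5/2) q \<ge> 7/2.\<close>
    have "7 / 2 * (real n - 2) \<le> 4 * (real n - 5 / 2)" using dimension_ge_7 by simp
    then have "7 / 2 \<le> 4 * (real n - 5 / 2) / (real n - 2)" using dimension_ge_7 by (simp add: pos_le_divide_eq)
    then have "7 / 2 \<le> (real n - 5 / 2) * q" by (simp add: q_def mult.commute)
    then show "real n + 1 \<le> (real n - 5 / 2) * (1 + q)" by (simp add: distrib_left)
  qed
  have s2: "(2::real) > 0" "real n + 1 \<le> (real n - 5 / 2) * 2" using dimension_ge_7 by simp_all
  define m where "m s j = (LBINT t:{tm j..T j}. Z j t powr s * t ^ (n - 1))" for s j
  have mass: "scaled_profile.mass n (tm j) (T j) (Z j) s = m s j" for j s
    by (simp add: scaled_profile.mass_def[OF sp] m_def)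
  have m1: "m (1 + q) \<longlonglongrightarrow> c1 n" and c1: "c1 n > 0"
    using mass_tendsto[OF s1] unfolding m_def[abs_def] c1_eq[OF n3] q_def by auto
  have "m 2 \<longlonglongrightarrow> c2 n / 2" and c2: "c2 n > 0"
    using mass_tendsto[OF s2] unfolding m_def[abs_def] c2_eq[OF n3] by auto
  note m2 = \<open>m 2 \<longlonglongrightarrow> c2 n / 2\<close>
  show "c1 n > 0" "c2 n > 0" by (fact c1 c2)+
  have fm: "m (1 + q) j \<le> F j (T j)" "F j (T j) * (1 - k j * (T j)\<^sup>2) \<le> m (1 + q) j" for j
    using scaled_profile.flux_mass[OF sp, of j] unfolding mass scaled_profile.q_def[OF sp] q_def by auto
  have "(\<lambda>j. m (1 + q) j / (1 - k j * (T j)\<^sup>2)) \<longlonglongrightarrow> c1 n / (1 - 0)"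
    by (intro tendsto_intros m1 lam0) simp
  then have lim: "(\<lambda>j. m (1 + q) j / (1 - k j * (T j)\<^sup>2)) \<longlonglongrightarrow> c1 n" by simp
  show "(\<lambda>j. F j (T j)) \<longlonglongrightarrow> c1 n"
  proof (rule tendsto_sandwich[OF _ _ m1 lim])
    show "\<forall>\<^sub>F j in sequentially. m (1 + q) j \<le> F j (T j)" using fm(1) by simp
    have "\<forall>\<^sub>F j in sequentially. k j * (T j)\<^sup>2 < 1" by (rule order_tendstoD(2)[OF lam0]) simp
    then show "\<forall>\<^sub>F j in sequentially. F j (T j) \<le> m (1 + q) j / (1 - k j * (T j)\<^sup>2)"
      by eventually_elim (use fm(2) in \<open>simp add: pos_le_divide_eq\<close>)
  qed
  have em: "\<bar>(F j (T j))\<^sup>2 / (k j * T j ^ (n - 2)) - 2 * m 2 j\<bar> \<le> 2 * C * (tm j)\<^sup>2" for j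
    using scaled_profile.energy_mass[OF sp, of j] unfolding mass .
  have z: "(\<lambda>j. 2 * C * (tm j)\<^sup>2) \<longlonglongrightarrow> 0"
    using tendsto_mult[OF tendsto_const[of "2 * C"] tendsto_power[OF tm_tendsto_0, of 2]] by simp
  have "(\<lambda>j. (F j (T j))\<^sup>2 / (k j * T j ^ (n - 2)) - 2 * m 2 j) \<longlonglongrightarrow> 0"
    by (rule Lim_null_comparison[OF _ z]) (use em in simp)
  from tendsto_add[OF this tendsto_mult[OF tendsto_const[of 2] m2]]
  show "(\<lambda>j. (F j (T j))\<^sup>2 / (k j * T j ^ (n - 2))) \<longlonglongrightarrow> c2 n" by simp
qed

end

text \<open>With \<open>\<epsilon> = 1 / T\<close> the limits above read \<open>f 1 / \<epsilon>\<^sup>(\<^sup>n\<^sup>-\<^sup>2\<^sup>)\<^sup>/\<^sup>2 \<longrightarrow> c\<^sub>1\<close> and \<open>(f 1)\<^sup>2 / (\<lambda> \<epsilon>\<^sup>2) \<longrightarrow> c\<^sub>2\<close>;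
  eliminating \<open>\<epsilon>\<close> gives the rate in \<open>\<lambda>\<close>.\<close>

lemma flux_limit:
  fixes lam :: "nat \<Rightarrow> real"
  assumes rp: "\<And>j. radial_profile n (lam j) (\<rho> j) (v j) (f j)" and lam0: "lam \<longlonglongrightarrow> 0"
  shows "(\<lambda>j. lam j powr (- ((real n - 2) / (2 * real n - 8))) * f j 1) \<longlonglongrightarrow> c_tilde n / sphere_area n"
    and "\<And>\<alpha>. \<alpha> > 0 \<Longrightarrow> \<forall>\<^sub>F j in sequentially. \<exists>rm\<le>\<alpha>. radial_profile_min n (lam j) (\<rho> j) (v j) (f j) rm"
    and "(\<lambda>j. f j 1) \<longlonglongrightarrow> 0"
proof -
  have n7: "n \<ge> 7" using rp[of 0] by (rule radial_profile.n7)
  obtain rm where rm: "\<And>j. radial_profile_min n (lam j) (\<rho> j) (v j) (f j) (rm j)"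
    using radial_profile.nodal_min_exists[OF rp] by metis
  define M where "M j = radial_profile_min.M (v j) (rm j)" for j
  define e where "e j = radial_profile_min.eps n (v j) (rm j)" for j
  define C where "C = 10 * radial_profile.W0 n"
  define k where "k j = lam j * (e j)\<^sup>2" for j
  define tm where "tm j = rm j / e j" for j
  define T where "T j = 1 / e j" for j
  define Z where "Z j t = - v j (e j * t) / M j" for j t
  define F where "F j t = M j * f j (e j * t)" for j t
  have sp: "scaled_profile n (k j) (tm j) (T j) C (Z j) (F j)" for j
    using radial_profile_min.scaled[OF rm, of j]
    unfolding k_def tm_def T_def C_def Z_def[abs_def] F_def[abs_def] M_def e_def .
  have e: "e j > 0" "e j \<le> 1" "e j ^ (n - 2) = 1 / (M j)\<^sup>2" for j
    using radial_profile_min.eps[OF rm, of j] unfolding e_def M_def by auto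
  have M0: "M j > 0" for j using radial_profile_min.M0[OF rm, of j] by (simp add: M_def)
  have lam: "lam j > 0" for j using radial_profile.lam[OF rp, of j] by simp
  have kT: "k j * (T j)\<^sup>2 = lam j" for j using e(1)[of j] by (simp add: k_def T_def power_divide)
  have lam0': "(\<lambda>j. k j * (T j)\<^sup>2) \<longlonglongrightarrow> 0" unfolding kT by (rule lam0)
  note L = scaled_limits[OF sp lam0']
  define \<kappa> where "\<kappa> = (real n - 2) / (2 * real n - 8)"
  define a where "a = (real n - 2) / 2"
  have FT: "F j (T j) = M j * f j 1" for j using e(1)[of j] by (simp add: F_def T_def)
  have fpos: "f j 1 > 0" for j by (rule radial_profile_min.flux_pos[OF rm])
  have MT: "M j = T j powr a" for j
  proof -
    have "T j > 0" using e(1)[of j] by (simp add: T_def)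
    then have "T j ^ (n - 2) = T j powr real (n - 2)" by (simp add: powr_realpow)
    moreover have "real (n - 2) = a + a" using n7 by (simp add: a_def of_nat_diff field_simps)
    ultimately have "(T j powr a)\<^sup>2 = T j ^ (n - 2)" by (simp only: powr_add power2_eq_square)
    also have "\<dots> = (M j)\<^sup>2" using e(3)[of j] by (simp add: T_def power_one_over)
    finally have "(T j powr a)\<^sup>2 = (M j)\<^sup>2" .
    then show ?thesis using M0[of j] by (simp add: power2_eq_iff_nonneg)
  qed
  \<comment> \<open>The quotient of the two limits isolates lam T^(n-4), which tends to c1^2 / c2.
    As (n-4) \<kappa> = (n-2)/2, its power - \<kappa> contains exactly the factor 1/M that cancels M
    in F(T) = M f(1).\<close>
  define R where "R j = lam j * T j powr (real n - 4)" for j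
  have R: "(F j (T j))\<^sup>2 / ((F j (T j))\<^sup>2 / (k j * T j ^ (n - 2))) = R j" for j
  proof -
    have T0: "T j > 0" using e(1)[of j] by (simp add: T_def)
    have "k j * T j ^ (n - 2) = lam j * (T j ^ (n - 2) / (T j)\<^sup>2)"
      using e(1)[of j] by (simp add: k_def T_def power_divide)
    also have "T j ^ (n - 2) / (T j)\<^sup>2 = T j powr (real n - 4)"
    proof -
      have "T j ^ (n - 2) / (T j)\<^sup>2 = T j powr (real (n - 2)) / T j powr (real 2)"
        using T0 by (simp add: powr_realpow)
      also have "\<dots> = T j powr (real (n - 2) - real 2)" using T0 by (simp add: powr_diff)
      also have "real (n - 2) - real 2 = real n - 4" using n7 by (simp add: of_nat_diff)
      finally show ?thesis .
    qed
    finally show ?thesis using FT[of j] fpos[of j] M0[of j] by (simp add: R_def)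
  qed
  have "(\<lambda>j. (F j (T j))\<^sup>2 / ((F j (T j))\<^sup>2 / (k j * T j ^ (n - 2)))) \<longlonglongrightarrow> (c1 n)\<^sup>2 / c2 n"
    by (intro tendsto_intros L) (use L(4) in simp)
  then have RL: "R \<longlonglongrightarrow> (c1 n)\<^sup>2 / c2 n" unfolding R .
  have "(\<lambda>j. F j (T j) * R j powr (- \<kappa>)) \<longlonglongrightarrow> c1 n * ((c1 n)\<^sup>2 / c2 n) powr (- \<kappa>)"
    using L(3,4) by (intro tendsto_intros L(1) RL) simp
  moreover have "F j (T j) * R j powr (- \<kappa>) = lam j powr (- \<kappa>) * f j 1" for j
  proof -
    have T0: "T j > 0" using e(1)[of j] by (simp add: T_def)
    have "(real n - 4) * (- \<kappa>) = - a" using n7 by (simp add: \<kappa>_def a_def field_simps)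
    then have "R j powr (- \<kappa>) = lam j powr (- \<kappa>) * T j powr (- a)"
      using lam[of j] T0 by (simp add: R_def powr_mult powr_powr)
    also have "T j powr (- a) = 1 / M j" unfolding MT by (simp add: powr_minus divide_inverse)
    finally show ?thesis unfolding FT using M0[of j] by simp
  qed
  moreover have "c1 n * ((c1 n)\<^sup>2 / c2 n) powr (- \<kappa>) = c_tilde n / sphere_area n"
  proof -
    define x where "x = c1 n"
    define y where "y = c2 n"
    have x: "x > 0" and y: "y > 0" using L by (auto simp: x_def y_def)
    have "(x\<^sup>2 / y) powr (- \<kappa>) = (x powr 2) powr (- \<kappa>) / y powr (- \<kappa>)"
      using x y by (simp add: powr_divide)
    also have "\<dots> = x powr (- 2 * \<kappa>) * y powr \<kappa>" by (simp add: powr_powr powr_minus divide_inverse del: powr_numeral)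
    finally have "x * (x\<^sup>2 / y) powr (- \<kappa>) = x powr 1 * x powr (- 2 * \<kappa>) * y powr \<kappa>" using x by simp
    also have "x powr 1 * x powr (- 2 * \<kappa>) = x powr (1 + - 2 * \<kappa>)" by (rule powr_add[symmetric])
    \<comment> \<open>Origin of the exponent of \<open>c1\<close> in \<open>c_tilde\<close>: one
      factor from the final flux, - 2 \<kappa> from \<open>R\<close>.\<close>
    also have "1 + - 2 * \<kappa> = - (4 / (2 * real n - 8))" using n7 by (simp add: \<kappa>_def field_simps)
    finally have "x * (x\<^sup>2 / y) powr (- \<kappa>) = y powr \<kappa> / x powr (4 / (2 * real n - 8))"
      by (simp add: powr_minus divide_inverse mult.commute)
    moreover have "sphere_area n > 0" using n7 by (simp add: sphere_area_def)
    ultimately show ?thesis by (simp add: c_tilde_def x_def y_def \<kappa>_def)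
  qed
  ultimately show "(\<lambda>j. lam j powr (- ((real n - 2) / (2 * real n - 8))) * f j 1) \<longlonglongrightarrow> c_tilde n / sphere_area n"
    unfolding \<kappa>_def by simp
  show "\<forall>\<^sub>F j in sequentially. \<exists>rm\<le>\<alpha>. radial_profile_min n (lam j) (\<rho> j) (v j) (f j) rm" if "\<alpha> > 0" for \<alpha>
    using eventually_tm_less[OF sp lam0' that]
  proof eventually_elim
    case (elim j)
    have "rm j = tm j * e j" using e(1)[of j] by (simp add: tm_def)
    also have "\<dots> \<le> tm j * 1" using e(2)[of j] sequence_bounds(2)[OF sp lam0', of j] by (intro mult_left_mono) auto
    finally show ?case using elim rm by (intro exI[of _ "rm j"]) auto
  qed
  have b: "(f j 1)\<^sup>2 \<le> 6 * radial_profile.W0 n * lam j" for j by (rule radial_profile_min.flux_le[OF rm])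
  have lim: "(\<lambda>j. 6 * radial_profile.W0 n * lam j) \<longlonglongrightarrow> 0"
    using tendsto_mult[OF tendsto_const[of "6 * radial_profile.W0 n"] lam0] by simp
  have "(\<lambda>j. (f j 1)\<^sup>2) \<longlonglongrightarrow> 0"
    by (rule tendsto_sandwich[OF _ _ tendsto_const lim]) (simp_all add: b)
  then show "(\<lambda>j. f j 1) \<longlonglongrightarrow> 0" by (rule tendsto_0_from_square)
qed

section \<open>Reduction to the radial equation\<close>

lemma has_derivative_norm_inner:
  fixes x :: "'a::euclidean_space"
  assumes "x \<noteq> 0"
  shows "(norm has_derivative (\<lambda>h. (x \<bullet> h) / norm x)) (at x)"
proof -
  have i: "((\<lambda>y. y \<bullet> y) has_derivative (\<lambda>h. 2 * (x \<bullet> h))) (at x)"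
    by (auto intro!: derivative_eq_intros simp: inner_commute)
  have x: "0 < x \<bullet> x" using assms by simp
  have m: "(\<lambda>h. h * c) = (*) c" for c :: real by (simp add: fun_eq_iff mult.commute)
  have "(sqrt has_derivative (\<lambda>h. h * (inverse (sqrt (x \<bullet> x)) / 2))) (at (x \<bullet> x))"
    using DERIV_real_sqrt[OF x] unfolding has_field_derivative_def m .
  from has_derivative_compose[OF i this]
  have "((\<lambda>y. sqrt (y \<bullet> y)) has_derivative (\<lambda>h. 2 * (x \<bullet> h) * (inverse (sqrt (x \<bullet> x)) / 2))) (at x)" .
  moreover have "(\<lambda>y. sqrt (y \<bullet> y)) = (norm :: 'a \<Rightarrow> real)" by (rule ext) (rule norm_eq_sqrt_inner[symmetric])
  moreover have "(\<lambda>h. 2 * (x \<bullet> h) * (inverse (sqrt (x \<bullet> x)) / 2)) = (\<lambda>h. (x \<bullet> h) / norm x)"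
    unfolding norm_eq_sqrt_inner[of x] divide_inverse by (rule ext) (simp only: mult.assoc mult.left_commute mult.commute, simp)
  ultimately show ?thesis by (simp only:)
qed

lemma
  fixes w :: "'a::euclidean_space \<Rightarrow> real"
  assumes S: "open S" "x \<in> S" "x \<noteq> 0" and w: "\<And>y. y \<in> S \<Longrightarrow> w y = \<phi> (norm y)"
    and \<phi>: "(\<phi> has_real_derivative \<phi>') (at (norm x))"
  shows partial_radial: "partial b w x = \<phi>' * (x \<bullet> b) / norm x"
    and gradient_radial: "gradient w x = (\<phi>' / norm x) *\<^sub>R x"
proof -
  have "((\<lambda>y. \<phi> (norm y)) has_derivative (\<lambda>h. \<phi>' * ((x \<bullet> h) / norm x))) (at x)"
    using has_derivative_compose[OF has_derivative_norm_inner[OF S(3)]] \<phi> unfolding has_field_derivative_def by blast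
  then have "(w has_derivative (\<lambda>h. \<phi>' * ((x \<bullet> h) / norm x))) (at x)"
    by (rule has_derivative_transform_within_open[OF _ S(1,2)]) (simp add: w)
  from partial_eqI[OF this] show p: "partial b w x = \<phi>' * (x \<bullet> b) / norm x" for b by simp
  have "gradient w x = (\<Sum>b\<in>Basis. (\<phi>' / norm x) *\<^sub>R ((x \<bullet> b) *\<^sub>R b))"
    unfolding gradient_def p by simp
  also have "\<dots> = (\<phi>' / norm x) *\<^sub>R x"
    by (simp only: scaleR_right.sum[symmetric] euclidean_representation)
  finally show "gradient w x = (\<phi>' / norm x) *\<^sub>R x" .
qed

text \<open>For a basis vector b orthogonal to e, the derivative of u along b at r e + s b is v'(N)
  s / N with N the norm of that point. Its difference quotient at s = 0 tends to v'(r) / r, and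
  there are n - 1 such directions.\<close>

lemma radial_laplacian:
  fixes u :: "'a::euclidean_space \<Rightarrow> real"
  assumes C2: "Ck_on 2 (ball 0 1) u" and radial: "radial_on (ball 0 1) u"
    and e: "e \<in> Basis" and r: "0 < r" "r < 1"
  shows "laplacian u (r *\<^sub>R e) = partial e (partial e u) (r *\<^sub>R e) + (real DIM('a) - 1) / r * partial e u (r *\<^sub>R e)"
proof -
  define v where "v t = u (t *\<^sub>R e)" for t
  define v' where "v' t = partial e u (t *\<^sub>R e)" for t
  have ne: "norm e = 1" using e by simp
  have d: "u differentiable (at y)" "\<And>b. b \<in> Basis \<Longrightarrow> partial b u differentiable (at y)" if "y \<in> ball 0 1" for y
    using C2 that by (auto simp: numeral_2_eq_2)
  have dv: "(v has_real_derivative v' t) (at t)" if "\<bar>t\<bar> < 1" for t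
    using DERIV_along_line[of u 0 t e] d(1)[of "t *\<^sub>R e"] that ne by (simp add: v_def[abs_def] v'_def)
  have u_eq: "u y = v (norm y)" if "y \<in> ball 0 1" for y
  proof -
    have "norm y *\<^sub>R e \<in> ball 0 1" "norm y = norm (norm y *\<^sub>R e)" using that ne by simp_all
    then show ?thesis using radial that unfolding radial_on_def v_def by blast
  qed
  have p: "partial b u y = v' (norm y) * (y \<bullet> b) / norm y" if "y \<in> ball 0 1" "y \<noteq> 0" for b y
    by (rule partial_radial[OF open_ball that u_eq dv]) (use that in auto)
  have xr: "r *\<^sub>R e \<in> ball 0 1" using r ne by simp
  have "partial b (partial b u) (r *\<^sub>R e) = v' r / r" if b: "b \<in> Basis" "b \<noteq> e" for b
  proof -
    define h where "h s = partial b u (r *\<^sub>R e + s *\<^sub>R b)" for s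
    define N where "N s = norm (r *\<^sub>R e + s *\<^sub>R b)" for s
    have eb: "e \<bullet> b = 0" "b \<bullet> b = 1" using e b inner_not_same_Basis by (auto simp: inner_same_Basis)
    have cN: "isCont N 0" unfolding N_def by (intro continuous_intros)
    have N0: "N 0 = r" using r ne by (simp add: N_def)
    have h0: "h 0 = 0" unfolding h_def using p[of "r *\<^sub>R e" b] xr r eb nonzero_Basis[OF e] by simp
    have "(h has_real_derivative partial b (partial b u) (r *\<^sub>R e)) (at 0)"
      unfolding h_def using DERIV_along_line[of "partial b u" "r *\<^sub>R e" 0 b] d(2)[OF xr b(1)] by simp
    then have l1: "((\<lambda>s. h s / s) \<longlongrightarrow> partial b (partial b u) (r *\<^sub>R e)) (at 0)"
      using h0 by (simp add: has_field_derivative_iff)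
    have "isCont v' r"
    proof -
      have "isCont (partial e u) (r *\<^sub>R e)"
        using differentiable_imp_continuous_within[OF d(2)[OF xr e]] by simp
      then show ?thesis unfolding v'_def
        by (intro isCont_o2[where g="partial e u" and f="\<lambda>t. t *\<^sub>R e"] continuous_intros)
    qed
    then have "isCont (\<lambda>s. v' (N s) / N s) 0"
      using N0 r by (intro continuous_divide isCont_o2[OF cN] cN) auto
    then have "((\<lambda>s. v' (N s) / N s) \<longlongrightarrow> v' r / r) (at 0)" using N0 by (simp add: isCont_def)
    moreover have "\<forall>\<^sub>F s in at 0. v' (N s) / N s = h s / s"
    proof -
      have "\<forall>\<^sub>F s in at 0. N s < 1"
        using order_tendstoD(2)[of N r "at 0" 1] cN N0 r by (simp add: isCont_def)
      moreover have "\<forall>\<^sub>F s in at 0. N s > 0"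
        using order_tendstoD(1)[of N r "at 0" 0] cN N0 r by (simp add: isCont_def)
      moreover have "\<forall>\<^sub>F s in at 0. s \<noteq> (0::real)" by (simp add: eventually_at_filter)
      ultimately show ?thesis
      proof eventually_elim
        case (elim s)
        have "h s = v' (N s) * s / N s"
          unfolding h_def N_def using elim eb by (subst p) (auto simp: N_def inner_add_left)
        then show ?case using elim by simp
      qed
    qed
    ultimately have "((\<lambda>s. h s / s) \<longlongrightarrow> v' r / r) (at 0)" by (rule Lim_transform_eventually)
    with l1 show ?thesis by (rule LIM_unique)
  qed
  then have "(\<Sum>b\<in>Basis - {e}. partial b (partial b u) (r *\<^sub>R e)) = (\<Sum>b\<in>Basis - {e}. v' r / r)"
    by (intro sum.cong) auto
  also have "\<dots> = (real DIM('a) - 1) / r * v' r"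
    using e by (simp add: card_Diff_singleton of_nat_diff Suc_leI)
  finally show ?thesis
    unfolding laplacian_def using sum.remove[OF finite_Basis e, of "\<lambda>b. partial b (partial b u) (r *\<^sub>R e)"]
    by (simp add: v'_def)
qed

text \<open>The flux \<open>r\<^sup>n\<^sup>-\<^sup>1 v'\<close> is defined through the equation, so that it extends continuously to \<open>r = 1\<close>.\<close>

definition radial_flux :: "nat \<Rightarrow> real \<Rightarrow> (real \<Rightarrow> real) \<Rightarrow> real \<Rightarrow> real" where
  "radial_flux n lam v r = - integral {0..r} (\<lambda>s. s ^ (n - 1) * (lam * v s + \<bar>v s\<bar> powr (4 / (real n - 2)) * v s))"

text \<open>By the radial form of the equation, r^(n-1) times the derivative along \<open>e\<close>
  and the flux defined by integration have the same derivative on (0, 1); both vanish at 0, so they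
  coincide.\<close>

lemma radial_solution_profile:
  fixes u :: "'a::euclidean_space \<Rightarrow> real"
  assumes n7: "DIM('a) \<ge> 7" and lam: "0 < lam" "lam \<le> 1"
    and sol: "BN_solution (ball 0 1) lam u" and radial: "radial_on (ball 0 1) u"
    and e: "e \<in> Basis"
    and \<rho>: "0 < \<rho>" "\<rho> < 1" and pos: "\<And>x. norm x < \<rho> \<Longrightarrow> u x > 0"
    and neg: "\<And>x. \<rho> < norm x \<Longrightarrow> norm x < 1 \<Longrightarrow> u x < 0"
  shows "radial_profile DIM('a) lam \<rho> (\<lambda>r. u (r *\<^sub>R e)) (radial_flux DIM('a) lam (\<lambda>r. u (r *\<^sub>R e)))"
proof -
  define n where "n = DIM('a)"
  define v where "v r = u (r *\<^sub>R e)" for r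
  define v' where "v' r = partial e u (r *\<^sub>R e)" for r
  define g where "g s = s ^ (n - 1) * (lam * v s + \<bar>v s\<bar> powr (4 / (real n - 2)) * v s)" for s
  define f where "f r = - integral {0..r} g" for r
  have n: "n \<ge> 7" using n7 by (simp add: n_def)
  have ne: "norm e = 1" using e by simp
  have C2: "Ck_on 2 (ball 0 1) u" and cu: "continuous_on (cball 0 1) u" and ub: "\<And>x. norm x = 1 \<Longrightarrow> u x = 0"
    and eq: "\<And>x. norm x < 1 \<Longrightarrow> - laplacian u x = lam * u x + \<bar>u x\<bar> powr (critical_exponent n - 2) * u x"
    using sol unfolding BN_solution_def classical_dirichlet_def n_def by auto
  have ce: "critical_exponent n - 2 = 4 / (real n - 2)" using n by (simp add: critical_exponent_def field_simps)
  have cv: "continuous_on {0..1} v" unfolding v_def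
    by (rule continuous_on_compose2[OF cu]) (use ne in \<open>auto intro!: continuous_intros\<close>)
  have cg: "continuous_on {0..1} g"
  proof -
    have "continuous_on {0..1} (\<lambda>s. \<bar>v s\<bar> powr (4 / (real n - 2)))"
      by (rule continuous_on_powr'[OF continuous_on_rabs[OF cv] continuous_on_const]) (use n in simp)
    then show ?thesis unfolding g_def[abs_def]
      by (intro continuous_on_mult continuous_on_add continuous_on_power continuous_on_const continuous_on_id cv)
  qed
  have cf: "continuous_on {0..1} f"
    unfolding f_def[abs_def]
    by (intro continuous_on_minus indefinite_integral_continuous_1 integrable_continuous_real cg)
  have f0: "f 0 = 0" by (simp add: f_def)
  have df: "(f has_real_derivative - g r) (at r)" if r: "0 < r" "r < 1" for r
  proof -
    have "((\<lambda>x. integral {0..x} g) has_real_derivative g r) (at r within {0..1})"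
      by (rule integral_has_real_derivative[OF cg]) (use r in simp)
    then have "((\<lambda>x. integral {0..x} g) has_real_derivative g r) (at r)"
      using r at_within_Icc_at[of 0 r 1] by simp
    from DERIV_minus[OF this] show ?thesis unfolding f_def[abs_def] .
  qed
  have d: "u differentiable (at y)" "partial e u differentiable (at y)" if "y \<in> ball 0 1" for y
    using C2 that e by (auto simp: numeral_2_eq_2)
  have dv: "(v has_real_derivative v' r) (at r)" if "\<bar>r\<bar> < 1" for r
    using DERIV_along_line[of u 0 r e] d(1)[of "r *\<^sub>R e"] that ne by (simp add: v_def[abs_def] v'_def)
  have dv': "(v' has_real_derivative partial e (partial e u) (r *\<^sub>R e)) (at r)" if "\<bar>r\<bar> < 1" for r
    using DERIV_along_line[of "partial e u" 0 r e] d(2)[of "r *\<^sub>R e"] that ne by (simp add: v'_def[abs_def])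
  define D where "D r = r ^ (n - 1) * v' r - f r" for r
  have dD: "(D has_real_derivative 0) (at r)" if r: "0 < r" "r < 1" for r
  proof -
    have np: "r ^ (n - 1) = r * r ^ (n - 2)"
    proof -
      have "n - 1 = Suc (n - 2)" using n by simp
      then show ?thesis by (simp only: power_Suc)
    qed
    have nn: "n - 1 - Suc 0 = n - 2" "real (n - 1) = real n - 1" using n by auto
    have lap: "partial e (partial e u) (r *\<^sub>R e) + (real n - 1) / r * v' r = - (lam * v r + \<bar>v r\<bar> powr (4 / (real n - 2)) * v r)"
      using radial_laplacian[OF C2 radial e r] eq[of "r *\<^sub>R e"] r ne unfolding v_def v'_def n_def[symmetric] ce by simp
    have dD': "(D has_real_derivative (real (n - 1) * r ^ (n - 1 - Suc 0)) * v' r + partial e (partial e u) (r *\<^sub>R e) * r ^ (n - 1) - - g r) (at r)"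
      unfolding D_def[abs_def] by (intro DERIV_diff DERIV_mult DERIV_pow dv' df) (use r in auto)
    have E2: "(real (n - 1) * r ^ (n - 1 - Suc 0)) * v' r + partial e (partial e u) (r *\<^sub>R e) * r ^ (n - 1)
        = r ^ (n - 1) * (partial e (partial e u) (r *\<^sub>R e) + (real n - 1) / r * v' r)"
      unfolding nn np using r by (simp add: field_simps)
    have E3: "(real (n - 1) * r ^ (n - 1 - Suc 0)) * v' r + partial e (partial e u) (r *\<^sub>R e) * r ^ (n - 1) = - g r"
      unfolding E2 lap g_def by (simp only: mult_minus_right)
    show ?thesis using dD' unfolding E3 by simp
  qed
  have D0: "D r = 0" if r: "0 < r" "r < 1" for r
  proof -
    have cD: "continuous_on {0..r} D"
      unfolding D_def[abs_def]
    proof (intro continuous_intros)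
      show "continuous_on {0..r} f" by (rule continuous_on_subset[OF cf]) (use r in auto)
      show "continuous_on {0..r} v'"
        by (intro continuous_at_imp_continuous_on ballI DERIV_isCont[OF dv']) (use r in auto)
    qed
    have dD0: "(D has_real_derivative 0) (at x)" if "0 < x" "x < r" for x
      using dD[of x] that r by simp
    have "D r \<le> D 0" by (rule nonincreasing_interior[of 0 r D]) (use r cD dD0 in force)+
    moreover have "D 0 \<le> D r" by (rule nondecreasing_interior[of 0 r D]) (use r cD dD0 in force)+
    moreover have "D 0 = 0" using n f0 by (simp add: D_def zero_power)
    ultimately show ?thesis by simp
  qed
  have v\<rho>: "v \<rho> = 0"
  proof -
    have "isCont v \<rho>" using dv[of \<rho>] \<rho> DERIV_isCont by auto
    then have lim: "(v \<longlongrightarrow> v \<rho>) (at_left \<rho>)" "(v \<longlongrightarrow> v \<rho>) (at_right \<rho>)"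
      unfolding isCont_def filterlim_at_split by auto
    have "\<forall>\<^sub>F r in at_left \<rho>. 0 \<le> v r"
      using eventually_at_left_real[OF \<rho>(1)]
    proof eventually_elim
      case (elim r)
      then show ?case using pos[of "r *\<^sub>R e"] ne by (simp add: v_def)
    qed
    then have "0 \<le> v \<rho>" by (intro tendsto_lowerbound[OF lim(1)]) auto
    moreover have "\<forall>\<^sub>F r in at_right \<rho>. v r \<le> 0"
      using eventually_at_right_real[OF \<rho>(2)]
    proof eventually_elim
      case (elim r)
      then show ?case using neg[of "r *\<^sub>R e"] ne \<rho> by (simp add: v_def)
    qed
    then have "v \<rho> \<le> 0" by (intro tendsto_upperbound[OF lim(2)]) auto
    ultimately show ?thesis by simp
  qed
  have "radial_profile n lam \<rho> v f"
  proof
    show "n \<ge> 7" "0 < lam" "lam \<le> 1" "0 < \<rho>" "\<rho> < 1" by (fact n lam \<rho>)+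
    show "continuous_on {0..1} v" "continuous_on {0..1} f" "f 0 = 0" "v \<rho> = 0" by (fact cv cf f0 v\<rho>)+
    show "(v has_real_derivative f r / r ^ (n - 1)) (at r)" if r: "0 < r" "r < 1" for r
    proof -
      have "f r = r ^ (n - 1) * v' r" using D0[OF r] unfolding D_def by linarith
      then have "f r / r ^ (n - 1) = v' r" using r(1) by simp
      then show ?thesis using dv[of r] r by simp
    qed
    show "(f has_real_derivative - (r ^ (n - 1) * (lam * v r + \<bar>v r\<bar> powr (4 / (real n - 2)) * v r))) (at r)"
      if r: "0 < r" "r < 1" for r
      using df[OF r] unfolding g_def .
    show "v r < 0" if "\<rho> < r" "r < 1" for r using neg[of "r *\<^sub>R e"] that ne \<rho> by (simp add: v_def)
    show "v 1 = 0" using ub[of e] ne by (simp add: v_def)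
  qed
  then show ?thesis unfolding n_def v_def[abs_def] f_def[abs_def] g_def[abs_def] radial_flux_def[abs_def] .
qed

section \<open>The limit\<close>

text \<open>A failing property would supply a null sequence of counterexamples. Dominated
  convergence was applied along sequences; this transfers its consequences to
  \<open>at_right 0\<close>. The bound X j < 1 keeps the parameters where profiles are
  available.\<close>

lemma eventually_at_right_0_sequentially:
  assumes "\<And>X :: nat \<Rightarrow> real. (\<And>j. 0 < X j) \<Longrightarrow> (\<And>j. X j < 1) \<Longrightarrow> X \<longlonglongrightarrow> 0 \<Longrightarrow> \<forall>\<^sub>F j in sequentially. P (X j)"
  shows "\<forall>\<^sub>F x in at_right (0::real). P x"
proof (rule ccontr)
  assume neg: "\<not> (\<forall>\<^sub>F x in at_right 0. P x)"
  have "\<exists>x>0. x < 1 / real (Suc j) \<and> \<not> P x" for j :: nat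
  proof (rule ccontr)
    assume "\<not> (\<exists>x>0. x < 1 / real (Suc j) \<and> \<not> P x)"
    then have "\<forall>\<^sub>F x in at_right 0. P x"
      unfolding eventually_at_right_field by (intro exI[of _ "1 / real (Suc j)"]) auto
    with neg show False by simp
  qed
  then obtain X where X: "\<And>j. X j > 0" "\<And>j. X j < 1 / real (Suc j)" "\<And>j. \<not> P (X j)" by metis
  have "X j < 1" for j
    using X(2)[of j] by (rule less_le_trans) simp
  moreover have "X \<longlonglongrightarrow> 0"
  proof (rule tendsto_sandwich[OF _ _ tendsto_const])
    show "(\<lambda>j. 1 / real (Suc j)) \<longlonglongrightarrow> 0"
      using LIMSEQ_inverse_real_of_nat by (simp add: inverse_eq_divide)
    show "\<forall>\<^sub>F j in sequentially. 0 \<le> X j" "\<forall>\<^sub>F j in sequentially. X j \<le> 1 / real (Suc j)"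
      using X(1,2) by (auto intro: less_imp_le always_eventually)
  qed
  ultimately have "\<forall>\<^sub>F j in sequentially. P (X j)" using assms X(1) by blast
  then show False using X(3) by (simp add: eventually_sequentially)
qed

theorem theorem3:
  fixes u :: "real \<Rightarrow> real ^ 'n \<Rightarrow> real"
    and G :: "real ^ 'n \<Rightarrow> real ^ 'n \<Rightarrow> real"
    and n :: nat
  assumes n_def: "n = CARD('n)"
    and dim: "n \<ge> 7"
    and least_energy:
      "\<And>lam. 0 < lam \<Longrightarrow> lam < first_dirichlet_eigenvalue (ball (0 :: real ^ 'n) 1) \<Longrightarrow>
         least_energy_radial_sign_changing_solution lam (u lam)"
    and pos_at_0:
      "\<And>lam. 0 < lam \<Longrightarrow> lam < first_dirichlet_eigenvalue (ball (0 :: real ^ 'n) 1) \<Longrightarrow>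
         u lam 0 > 0"
    and two_nodal_regions:
      "\<And>lam. 0 < lam \<Longrightarrow> lam < first_dirichlet_eigenvalue (ball (0 :: real ^ 'n) 1) \<Longrightarrow>
         \<exists>r. 0 < r \<and> r < 1 \<and>
             (\<forall>x. norm x < r \<longrightarrow> u lam x > 0) \<and>
             (\<forall>x. r < norm x \<and> norm x < 1 \<longrightarrow> u lam x < 0)"
    and green: "green_function (ball 0 1) G"
  shows "C1_loc_limit (ball 0 1 - {0})
           (\<lambda>lam x. lam powr (- ((real n - 2) / (2 * real n - 8))) * u lam x)
           (\<lambda>x. c_tilde n * G x 0)
           (at_right 0)"
proof -
  have DIM: "DIM(real ^ 'n) = n" by (simp add: n_def)
  have n7: "n \<ge> 7" by (rule dim)
  define \<Omega> where "\<Omega> = ball (0 :: real ^ 'n) 1 - {0}"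
  have o\<Omega>: "open \<Omega>" by (auto simp: \<Omega>_def)
  \<comment> \<open>By radial symmetry the profile may be read off along any fixed unit
    vector.\<close>
  obtain e :: "real ^ 'n" where e: "e \<in> Basis" using nonempty_Basis by blast
  have ne: "norm e = 1" using e by simp
  define \<kappa> where "\<kappa> = (real n - 2) / (2 * real n - 8)"
  \<comment> \<open>The limit of the normalised flux \<open>c\<close>. It is also the flux of
    \<open>c_tilde n * G x 0\<close>, whose radial profile is \<open>\<phi>\<close> below.\<close>
  define L where "L = c_tilde n / sphere_area n"
  define V where "V lam r = u lam (r *\<^sub>R e)" for lam r
  define f where "f lam = radial_flux n lam (V lam)" for lam
  define c where "c lam = lam powr (- \<kappa>) * f lam 1" for lam
  have "2 * real n \<le> first_dirichlet_eigenvalue (ball (0 :: real ^ 'n) 1)"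
    using first_dirichlet_eigenvalue_ge[where 'a="real ^ 'n"] n7 unfolding DIM by simp
  then have eig: "lam < first_dirichlet_eigenvalue (ball (0 :: real ^ 'n) 1)" if "lam < 1" for lam
    using that n7 by simp
  have sol: "BN_solution (ball 0 1) lam (u lam)" and radial: "radial_on (ball 0 1) (u lam)" if "0 < lam" "lam < 1" for lam
    using least_energy[OF that(1) eig[OF that(2)]]
    unfolding least_energy_radial_sign_changing_solution_def radial_sign_changing_solution_def by auto
  have "\<exists>\<rho>. radial_profile n lam \<rho> (V lam) (f lam)" if lam: "0 < lam" "lam < 1" for lam
  proof -
    obtain \<rho> where "0 < \<rho>" "\<rho> < 1" "\<And>x. norm x < \<rho> \<Longrightarrow> u lam x > 0"
      "\<And>x. \<rho> < norm x \<Longrightarrow> norm x < 1 \<Longrightarrow> u lam x < 0"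
      using two_nodal_regions[OF lam(1) eig[OF lam(2)]] by blast
    then have "radial_profile DIM(real ^ 'n) lam \<rho> (\<lambda>r. u lam (r *\<^sub>R e)) (radial_flux DIM(real ^ 'n) lam (\<lambda>r. u lam (r *\<^sub>R e)))"
      using n7 lam sol[OF lam] radial[OF lam] e n_def by (intro radial_solution_profile) simp_all
    moreover have "V lam = (\<lambda>r. u lam (r *\<^sub>R e))" by (simp add: V_def fun_eq_iff)
    ultimately show ?thesis unfolding DIM f_def by auto
  qed
  then obtain \<rho> where rp: "\<And>lam. 0 < lam \<Longrightarrow> lam < 1 \<Longrightarrow> radial_profile n lam (\<rho> lam) (V lam) (f lam)"
    by metis
  have ev1: "\<forall>\<^sub>F lam in at_right (0::real). 0 < lam \<and> lam < 1"
    unfolding eventually_at_right_field by (intro exI[of _ 1]) auto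
  have c_lim: "(c \<longlongrightarrow> L) (at_right 0)"
    unfolding tendsto_iff
  proof (intro allI impI eventually_at_right_0_sequentially)
    fix d :: real and X :: "nat \<Rightarrow> real" assume "0 < d" and X: "\<And>j. 0 < X j" "\<And>j. X j < 1" "X \<longlonglongrightarrow> 0"
    have "(\<lambda>j. c (X j)) \<longlonglongrightarrow> L"
      unfolding c_def \<kappa>_def L_def by (rule flux_limit(1)[OF rp[OF X(1,2)] X(3)])
    then show "\<forall>\<^sub>F j in sequentially. dist (c (X j)) L < d" using \<open>0 < d\<close> unfolding tendsto_iff by blast
  qed
  have f_lim: "((\<lambda>lam. f lam 1) \<longlongrightarrow> 0) (at_right 0)"
    unfolding tendsto_iff
  proof (intro allI impI eventually_at_right_0_sequentially)
    fix d :: real and X :: "nat \<Rightarrow> real" assume "0 < d" and X: "\<And>j. 0 < X j" "\<And>j. X j < 1" "X \<longlonglongrightarrow> 0"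
    have "(\<lambda>j. f (X j) 1) \<longlonglongrightarrow> 0" by (rule flux_limit(3)[OF rp[OF X(1,2)] X(3)])
    then show "\<forall>\<^sub>F j in sequentially. dist (f (X j) 1) 0 < d" using \<open>0 < d\<close> unfolding tendsto_iff by blast
  qed
  have rm_ev: "\<forall>\<^sub>F lam in at_right 0. \<exists>rm\<le>\<alpha>. radial_profile_min n lam (\<rho> lam) (V lam) (f lam) rm" if "\<alpha> > 0" for \<alpha>
    by (rule eventually_at_right_0_sequentially) (rule flux_limit(2)[OF rp _ that])
  define \<delta> where "\<delta> \<alpha> lam = lam * (1 / \<alpha> ^ (n - 2)) + (f lam 1 * (1 / \<alpha> ^ (n - 2))) powr (4 / (real n - 2)) * (1 / \<alpha> ^ (n - 2))" for \<alpha> lam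
  \<comment> \<open>The first summand measures convergence of the normalised flux, the second the
    variation of the flux on the region outside radius \<alpha>.\<close>
  define E where "E \<alpha> lam = \<bar>c lam - L\<bar> + \<bar>c lam\<bar> * \<bar>\<delta> \<alpha> lam\<bar>" for \<alpha> lam
  have E_lim: "(E \<alpha> \<longlongrightarrow> 0) (at_right 0)" if "\<alpha> > 0" for \<alpha>
  proof -
    have q: "4 / (real n - 2) > 0" using n7 by simp
    have fB: "((\<lambda>lam. f lam 1 * (1 / \<alpha> ^ (n - 2))) \<longlongrightarrow> 0) (at_right 0)"
      using tendsto_mult_left_zero[OF f_lim] .
    have "\<forall>\<^sub>F lam in at_right 0. 0 \<le> f lam 1 * (1 / \<alpha> ^ (n - 2))"
      using rm_ev[OF that]
    proof eventually_elim
      case (elim lam)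
      then obtain rm where "radial_profile_min n lam (\<rho> lam) (V lam) (f lam) rm" by blast
      then have "f lam 1 > 0" by (rule radial_profile_min.flux_pos)
      then show ?case using that by simp
    qed
    then have p: "((\<lambda>lam. (f lam 1 * (1 / \<alpha> ^ (n - 2))) powr (4 / (real n - 2))) \<longlongrightarrow> 0 powr (4 / (real n - 2))) (at_right 0)"
      using q by (intro tendsto_powr'[OF fB tendsto_const]) simp
    have "(\<delta> \<alpha> \<longlongrightarrow> 0 * (1 / \<alpha> ^ (n - 2)) + 0 powr (4 / (real n - 2)) * (1 / \<alpha> ^ (n - 2))) (at_right 0)"
      unfolding \<delta>_def[abs_def]
      by (intro tendsto_add tendsto_mult[OF tendsto_ident_at tendsto_const] tendsto_mult[OF p tendsto_const])
    then have "(\<delta> \<alpha> \<longlongrightarrow> 0) (at_right 0)" by simp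
    then have "(E \<alpha> \<longlongrightarrow> \<bar>L - L\<bar> + \<bar>L\<bar> * \<bar>0\<bar>) (at_right 0)"
      unfolding E_def[abs_def] by (intro tendsto_intros c_lim)
    then show ?thesis by simp
  qed
  define \<phi> where "\<phi> r = L / (2 - real n) * (1 / r ^ (n - 2) - 1)" for r
  have g_eq: "c_tilde n * G x 0 = \<phi> (norm x)" if x: "x \<in> \<Omega>" for x
  proof -
    have "(real n - 2) * sphere_area n * G x 0 = 1 - 1 / norm x ^ (n - 2)"
      using green_function_value[OF green, of x] x n7 unfolding DIM by (simp add: \<Omega>_def)
    moreover have "sphere_area n > 0" using n7 by (simp add: sphere_area_def)
    ultimately have "G x 0 = (1 - 1 / norm x ^ (n - 2)) / ((real n - 2) * sphere_area n)"
      using n7 by (simp add: eq_divide_eq mult_ac)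
    then have "c_tilde n * G x 0 = L / (real n - 2) * (1 - 1 / norm x ^ (n - 2))"
      by (simp add: L_def)
    also have "\<dots> = \<phi> (norm x)" using n7 unfolding \<phi>_def by (simp add: divide_simps) (simp add: algebra_simps)
    finally show ?thesis .
  qed
  have d\<phi>: "(\<phi> has_real_derivative L / r ^ (n - 1)) (at r)" if r: "r > 0" for r
  proof -
    define Q where "Q = r ^ (n - 2 - Suc 0)"
    have Q: "Q > 0" using r by (simp add: Q_def)
    have "n - 2 = Suc (n - 2 - Suc 0)" "n - 1 = Suc (Suc (n - 2 - Suc 0))" using n7 by simp_all
    then have e: "r ^ (n - 2) = r * Q" "r ^ (n - 1) = r * (r * Q)" unfolding Q_def by (metis power_Suc)+
    have "real (n - 2) = real n - 2" using n7 by simp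
    then have "L / (2 - real n) * ((0 * r ^ (n - 2) - 1 * (real (n - 2) * Q)) / (r ^ (n - 2) * r ^ (n - 2)) - 0) = L / r ^ (n - 1)"
      unfolding e using r Q n7 by (simp add: divide_simps) (simp add: algebra_simps)
    then show ?thesis
      using DERIV_cmult[OF DERIV_diff[OF DERIV_divide[OF DERIV_const[of 1] DERIV_pow[of "n - 2" r]] DERIV_const[of 1]], of "L / (2 - real n)"] r
      by (simp add: Q_def \<phi>_def[abs_def])
  qed
  have grad_g: "gradient (\<lambda>x. c_tilde n * G x 0) x = (L / norm x ^ n) *\<^sub>R x" if x: "x \<in> \<Omega>" for x
  proof -
    have x0: "x \<noteq> 0" using x by (simp add: \<Omega>_def)
    have "gradient (\<lambda>x. c_tilde n * G x 0) x = (L / norm x ^ (n - 1) / norm x) *\<^sub>R x"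
      by (rule gradient_radial[OF o\<Omega> x x0 g_eq d\<phi>]) (use x0 in simp_all)
    moreover have "norm x ^ n = norm x ^ (n - 1) * norm x" using n7 by (cases n) auto
    ultimately show ?thesis by simp
  qed
  have C1g: "Ck_on 1 \<Omega> (\<lambda>x. c_tilde n * G x 0)"
  proof (rule Ck_on_cong[OF o\<Omega>])
    define a where "a = (real n - 2) / 2"
    have "Ck_on 1 \<Omega> (\<lambda>x. (x \<bullet> x) powr (- a))"
      by (rule Ck_on_compose[OF o\<Omega> _ Ck_on_powr Ck_on_inner_self]) (auto simp: \<Omega>_def)
    then show "Ck_on 1 \<Omega> (\<lambda>x. L / (2 - real n) * ((x \<bullet> x) powr (- a) - 1))"
      by (intro Ck_on_scale Ck_on_diff o\<Omega> Ck_on_const)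
    fix x assume x: "x \<in> \<Omega>"
    have x0: "norm x > 0" using x by (simp add: \<Omega>_def)
    have "x \<bullet> x = norm x powr 2" by (simp add: power2_norm_eq_inner)
    then have "(x \<bullet> x) powr (- a) = norm x powr (2 * - a)" by (simp only: powr_powr)
    also have "2 * - a = - real (n - 2)" using n7 by (simp add: a_def of_nat_diff field_simps)
    finally have "(x \<bullet> x) powr (- a) = 1 / norm x ^ (n - 2)" using x0 by (simp add: powr_minus powr_realpow divide_inverse)
    then show "L / (2 - real n) * ((x \<bullet> x) powr (- a) - 1) = c_tilde n * G x 0"
      using g_eq[OF x] by (simp add: \<phi>_def)
  qed
  define F where "F lam x = lam powr (- \<kappa>) * u lam x" for lam x
  have C1F: "Ck_on 1 \<Omega> (F lam)" if "0 < lam" "lam < 1" for lam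
  proof -
    have "Ck_on 2 (ball 0 1) (u lam)" using sol[OF that] by (simp add: BN_solution_def classical_dirichlet_def)
    then have "Ck_on 1 (ball 0 1) (u lam)" by (rule Ck_on_le) simp
    then have "Ck_on 1 \<Omega> (u lam)" by (rule Ck_on_subset) (auto simp: \<Omega>_def)
    then show ?thesis unfolding F_def by (intro Ck_on_scale o\<Omega>)
  qed
  have F_eq: "F lam x = lam powr (- \<kappa>) * V lam (norm x)" if "0 < lam" "lam < 1" "x \<in> \<Omega>" for lam x
  proof -
    have "x \<in> ball 0 1" "norm x *\<^sub>R e \<in> ball 0 1" "norm x = norm (norm x *\<^sub>R e)"
      using that(3) ne by (simp_all add: \<Omega>_def)
    then have "u lam x = u lam (norm x *\<^sub>R e)" using radial[OF that(1,2)] unfolding radial_on_def by blast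
    then show ?thesis by (simp add: F_def V_def)
  qed
  have grad_F: "gradient (F lam) x = (lam powr (- \<kappa>) * f lam (norm x) / norm x ^ n) *\<^sub>R x"
    if lam: "0 < lam" "lam < 1" and x: "x \<in> \<Omega>" for lam x
  proof -
    have x0: "x \<noteq> 0" "norm x < 1" using x by (auto simp: \<Omega>_def)
    have d: "((\<lambda>r. lam powr (- \<kappa>) * V lam r) has_real_derivative lam powr (- \<kappa>) * (f lam (norm x) / norm x ^ (n - 1))) (at (norm x))"
      by (intro DERIV_cmult radial_profile.dv[OF rp[OF lam]]) (use x0 in auto)
    have "gradient (F lam) x = (lam powr (- \<kappa>) * (f lam (norm x) / norm x ^ (n - 1)) / norm x) *\<^sub>R x"
      by (rule gradient_radial[OF o\<Omega> x x0(1) F_eq[OF lam] d])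
    moreover have "norm x ^ n = norm x ^ (n - 1) * norm x" using n7 by (cases n) auto
    ultimately show ?thesis by simp
  qed
  have bounds: "\<bar>F lam x - c_tilde n * G x 0\<bar> \<le> E \<alpha> lam * (1 / \<alpha> ^ n)"
    "norm (gradient (F lam) x - gradient (\<lambda>x. c_tilde n * G x 0) x) \<le> E \<alpha> lam * (1 / \<alpha> ^ n)"
    if lam: "0 < lam" "lam < 1" and rm: "radial_profile_min n lam (\<rho> lam) (V lam) (f lam) rm" "rm \<le> \<alpha>"
      and \<alpha>: "0 < \<alpha>" and x: "x \<in> \<Omega>" "\<alpha> \<le> norm x" for lam rm \<alpha> x
  proof -
    define r where "r = norm x"
    define B where "B = 1 / \<alpha> ^ n"
    define R where "R = (1 / r ^ (n - 2) - 1) / (real n - 2)"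
    define l where "l = lam powr (- \<kappa>)"
    define p where "p = f lam 1"
    have r: "\<alpha> \<le> r" "0 < r" "r < 1" using x \<alpha> by (auto simp: r_def \<Omega>_def)
    have l0: "l \<ge> 0" by (simp add: l_def)
    have cl: "c lam = l * p" by (simp add: c_def l_def p_def)
    have R: "0 \<le> R" "R \<le> B"
    proof -
      have "r ^ (n - 2) \<le> 1" using r by (intro power_le_one) auto
      then show "0 \<le> R" unfolding R_def using r n7 by (intro divide_nonneg_pos) auto
      have "\<alpha> ^ n \<le> r ^ n" using r \<alpha> by (intro power_mono) auto
      also have "\<dots> \<le> r ^ (n - 2)" using r by (intro power_decreasing) auto
      finally have "1 / r ^ (n - 2) \<le> B" unfolding B_def using \<alpha> r by (intro divide_left_mono) auto
      then have "1 / r ^ (n - 2) - 1 \<le> B" by simp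
      then have "R \<le> B / (real n - 2)" unfolding R_def using n7 by (intro divide_right_mono) auto
      also have "\<dots> \<le> B / 1" unfolding B_def using n7 \<alpha> by (intro divide_left_mono) auto
      finally show "R \<le> B" by simp
    qed
    have ob: "p * (1 - \<delta> \<alpha> lam) \<le> f lam r" "f lam r \<le> p"
      "p * (1 - \<delta> \<alpha> lam) * R \<le> - V lam r" "- V lam r \<le> p * R"
      using radial_profile_min.outer_bounds[OF rm(1) \<alpha> rm(2) r(1) less_imp_le[OF r(3)]]
      unfolding \<delta>_def p_def R_def radial_profile_min.q_def[OF rm(1)] by simp_all
    \<comment> \<open>Values and gradients obey the same enclosure, so one estimate serves both: w =
      \<open>R\<close> with y = -v for values, w = 1 with y the flux for gradients.\<close>
    have "\<bar>l * y - L * w\<bar> \<le> E \<alpha> lam * w" if "0 \<le> w" "p * (1 - \<delta> \<alpha> lam) * w \<le> y" "y \<le> p * w" for y w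
    proof -
      have "l * (p * (1 - \<delta> \<alpha> lam) * w) \<le> l * y" "l * y \<le> l * (p * w)"
        using that l0 by (auto intro: mult_left_mono)
      then have "\<bar>l * y - c lam * w\<bar> \<le> \<bar>c lam * \<delta> \<alpha> lam * w\<bar>"
        unfolding cl by (simp add: algebra_simps)
      also have "\<dots> = \<bar>c lam\<bar> * \<bar>\<delta> \<alpha> lam\<bar> * w" using that(1) by (simp add: abs_mult)
      finally have "\<bar>l * y - c lam * w\<bar> \<le> \<bar>c lam\<bar> * \<bar>\<delta> \<alpha> lam\<bar> * w" .
      moreover have "\<bar>c lam * w - L * w\<bar> = \<bar>c lam - L\<bar> * w"
        using that(1) by (simp add: left_diff_distrib[symmetric] abs_mult)
      ultimately show ?thesis unfolding E_def by (simp add: distrib_right)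
    qed
    note key = this
    have E0: "E \<alpha> lam \<ge> 0" by (simp add: E_def)
    have "\<bar>F lam x - c_tilde n * G x 0\<bar> = \<bar>l * (- V lam r) - L * R\<bar>"
    proof -
      have "\<phi> r = - (L * R)" using n7 unfolding \<phi>_def R_def by (simp add: divide_simps) (simp add: algebra_simps)
      then show ?thesis using F_eq[OF lam x(1)] g_eq[OF x(1)] by (simp add: r_def[symmetric] l_def[symmetric])
    qed
    also have "\<dots> \<le> E \<alpha> lam * R" by (rule key[OF R(1) ob(3,4)])
    also have "\<dots> \<le> E \<alpha> lam * B" by (rule mult_left_mono[OF R(2) E0])
    finally show "\<bar>F lam x - c_tilde n * G x 0\<bar> \<le> E \<alpha> lam * (1 / \<alpha> ^ n)" unfolding B_def .
    have "norm (gradient (F lam) x - gradient (\<lambda>x. c_tilde n * G x 0) x) = \<bar>l * f lam r / r ^ n - L / r ^ n\<bar> * r"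
      unfolding grad_F[OF lam x(1)] grad_g[OF x(1)] scaleR_left_diff_distrib[symmetric] norm_scaleR
      by (simp add: r_def l_def)
    also have "\<dots> = \<bar>l * f lam r - L\<bar> / r ^ n * r"
      using r by (simp add: diff_divide_distrib[symmetric] abs_divide)
    also have "\<dots> \<le> \<bar>l * f lam r - L\<bar> / r ^ n * 1" using r by (intro mult_left_mono) auto
    also have "\<dots> \<le> E \<alpha> lam / r ^ n"
      using key[of 1 "f lam r"] ob(1,2) r by (simp add: divide_right_mono)
    also have "\<dots> \<le> E \<alpha> lam / \<alpha> ^ n"
      using E0 r \<alpha> by (intro divide_left_mono power_mono) auto
    finally show "norm (gradient (F lam) x - gradient (\<lambda>x. c_tilde n * G x 0) x) \<le> E \<alpha> lam * (1 / \<alpha> ^ n)" by simp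
  qed
  have unif: "uniform_limit K F (\<lambda>x. c_tilde n * G x 0) (at_right 0) \<and>
      uniform_limit K (\<lambda>lam. gradient (F lam)) (gradient (\<lambda>x. c_tilde n * G x 0)) (at_right 0)"
    if K: "compact K" "K \<subseteq> \<Omega>" for K
  proof -
    \<comment> \<open>A compact set avoiding the origin keeps a positive distance from it, and
      \<open>rm\<close> is eventually below that distance.\<close>
    obtain \<alpha> where \<alpha>: "\<alpha> > 0" "\<And>x. x \<in> K \<Longrightarrow> \<alpha> \<le> norm x"
    proof (cases "K = {}")
      case True
      then show thesis using that[of 1] by simp
    next
      case False
      obtain z where z: "z \<in> K" "\<And>x. x \<in> K \<Longrightarrow> norm z \<le> norm x"
        using continuous_attains_inf[OF K(1) False continuous_on_norm[OF continuous_on_id]] by blast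
      have "norm z > 0" using z(1) K(2) by (auto simp: \<Omega>_def)
      then show thesis using that z(2) by blast
    qed
    have ev: "\<forall>\<^sub>F lam in at_right 0. \<forall>x\<in>K. \<bar>F lam x - c_tilde n * G x 0\<bar> < d \<and>
        norm (gradient (F lam) x - gradient (\<lambda>x. c_tilde n * G x 0) x) < d" if d: "d > 0" for d
    proof -
      have "((\<lambda>lam. E \<alpha> lam * (1 / \<alpha> ^ n)) \<longlongrightarrow> 0) (at_right 0)"
        using tendsto_mult_left_zero[OF E_lim[OF \<alpha>(1)]] .
      then have "\<forall>\<^sub>F lam in at_right 0. E \<alpha> lam * (1 / \<alpha> ^ n) < d" using d by (rule order_tendstoD(2))
      with ev1 rm_ev[OF \<alpha>(1)] show ?thesis
      proof eventually_elim
        case (elim lam)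
        then obtain rm where rm: "radial_profile_min n lam (\<rho> lam) (V lam) (f lam) rm" "rm \<le> \<alpha>" by blast
        show ?case
        proof
          fix x assume "x \<in> K"
          then have "x \<in> \<Omega>" "\<alpha> \<le> norm x" using K(2) \<alpha>(2) by auto
          from bounds[OF _ _ rm \<alpha>(1) this] elim
          show "\<bar>F lam x - c_tilde n * G x 0\<bar> < d \<and>
              norm (gradient (F lam) x - gradient (\<lambda>x. c_tilde n * G x 0) x) < d" by linarith
        qed
      qed
    qed
    show ?thesis
      unfolding uniform_limit_iff
    proof (intro conjI allI impI)
      fix d :: real assume d: "0 < d"
      show "\<forall>\<^sub>F lam in at_right 0. \<forall>x\<in>K. dist (F lam x) (c_tilde n * G x 0) < d"
        using ev[OF d] by eventually_elim (simp add: dist_real_def)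
      show "\<forall>\<^sub>F lam in at_right 0. \<forall>x\<in>K. dist (gradient (F lam) x) (gradient (\<lambda>x. c_tilde n * G x 0) x) < d"
        using ev[OF d] by eventually_elim (simp add: dist_norm)
    qed
  qed
  have "C1_loc_limit \<Omega> F (\<lambda>x. c_tilde n * G x 0) (at_right 0)"
    unfolding C1_loc_limit_def
  proof (intro conjI allI impI)
    show "Ck_on 1 \<Omega> (\<lambda>x. c_tilde n * G x 0)" by (rule C1g)
    show "\<forall>\<^sub>F lam in at_right 0. Ck_on 1 \<Omega> (F lam)" using ev1 by eventually_elim (simp only: C1F)
  qed (use unif in blast)+
  then show ?thesis unfolding F_def[abs_def] \<kappa>_def \<Omega>_def .
qed

end
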